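(* Let $G=(\Lambda,E)$ be a finite connected undirected graph without self-loops and let $0\le l\le r$. Endow the subdivided graph $G_r=(\Lambda_r,E_r)$ with i.i.d. edge weights $W_e>0$, $e\in E_r$, and let $W^{(m)}=(W^{(m)}_e)_{e\in E_m}$, $0\le m\le r$, be the corresponding effective weights, all on one probability space with expectation $\mathbb{E}$. Let $C_\alpha:=2^{-\alpha}\Gamma(\frac12-\alpha)/\sqrt\pi$ for $0\le\alpha<\frac12$ and $c_2:=\gamma+\log2$, where $\gamma=-\int_0^\infty e^{-t}\log t\,dt$ is the Euler–Mascheroni constant. Then for all $\bar e\in E_l$ and $e'\in E_r$: $$\mathbb{E}[(W^{(l)}_{\bar e})^\alpha]\le (2^{-\alpha})^{r-l}\mathbb{E}[W_{e'}^\alpha]\quad\text{for }\alpha\in[0,1],$$ $$\mathbb{E}[(W^{(l)}_{\bar e})^\alpha]\le \frac1{C_\alpha}\min_{m\in\{l,\ldots,r\}}\Big(C_\alpha(2^{-\alpha})^{r-m}\mathbb{E}[W_{e'}^\alpha]\Big)^{2^{m-l}}\quad\text{for }\alpha\in[0,\tfrac12),$$ $$\mathbb{E}[\log W^{(l)}_{\bar e}]\le \min_{m\in\{l,\ldots,r\}}2^{m-l}\big(\mathbb{E}[\log W_{e'}]-(r-m)\log2+c_2\big)-c_2.$$ Moreover, let $m_0:=r-2-\lfloor\alpha^{-1}\log_2(C_\alpha\mathbb{E}[W_{e'}^\alpha])\rfloor$ and $m_1:=r-2-\lfloor(\log2)^{-1}(\mathbb{E}[\log W_{e'}]+c_2)\rfloor$.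 If $m_0\in\{l,\ldots,r\}$, then $m=m_0$ is a minimizer in the second bound; if $m_0<l$ (resp. $m_0>r$), then $m=l$ (resp. $m=r$) is a minimizer. The analogous statement holds for $m_1$ and the third bound.
   Context: Subdivision: the $2^r$-subdivision $G_r=(\Lambda_r,E_r)$ replaces each edge $e\in E$ (with endpoints $v_{e,0},v_{e,1}$) by the path of edges $e_{j,r}=\{v_{e,2^{-r}(j-1)},v_{e,2^{-r}j}\}$, $1\le j\le 2^r$, with new vertices $v_{e,2^{-r}j}$; $\Lambda_m\subseteq\Lambda_r$ for $m\le r$. Edge weights are identified with the symmetric matrix $W$ on $\Lambda_r$ with $W_{ij}=W_e$ if $e=\{i,j\}\in E_r$, $W_{ij}=0$ otherwise. The random field $\beta$: for finite $\Lambda$ and symmetric $W\in[0,\infty)^{\Lambda\times\Lambda}$, $H^W_\beta=2\operatorname{diag}(\beta)-W$ and $\nu^W_\Lambda(d\beta)=(2/\pi)^{|\Lambda|/2}1_{\{H^W_\beta>0\}}e^{-\frac12\langle1,H^W_\beta1\rangle}(\det H^W_\beta)^{-1/2}d\beta$. Given $W$, let $\beta\in\mathbb{R}^{\Lambda_r}$ have conditional law $\nu^W_{\Lambda_r}$. Effective weights: for $J\subseteq\Lambda_r$, $I=\Lambda_r\setminus J$, $W^J(\beta_I):=W_{JJ}+W_{JI}([H^W_\beta]_{II})^{-1}W_{IJ}$ ($A_{IJ}$ denotes the submatrix). For $0\le m\le r$ and $e=\{i,j\}\in E_m$, $W^{(m)}_e:=W^{\Lambda_m}_{ij}(\beta_{\Lambda_r\setminus\Lambda_m})$;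 in particular $W^{(r)}=W$. *)

theory Defs
  imports "HOL-Probability.Probability" "HOL-Combinatorics.Permutations"
begin

section \<open>Finite connected simple graphs\<close>

text \<open>An undirected simple graph on the finite vertex set V; every undirected edge
  is stored exactly once as an ordered pair (v0, v1), which fixes the labelling of its
  endpoints as v_{e,0} = fst e and v_{e,1} = snd e.\<close>
definition simple_conn_graph :: "'v set \<Rightarrow> ('v \<times> 'v) set \<Rightarrow> bool" where
  "simple_conn_graph V E \<longleftrightarrow>
     finite V \<and> V \<noteq> {} \<and> E \<subseteq> V \<times> V \<and>
     (\<forall>(u, w) \<in> E. u \<noteq> w \<and> (w, u) \<notin> E) \<and>
     (\<forall>u\<in>V. \<forall>w\<in>V. (u, w) \<in> (E \<union> E\<inverse>)\<^sup>*)"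

section \<open>Dyadic subdivisions\<close>

text \<open>Vertices of all subdivided graphs live in one type: original vertices, and
  points v_{e,q} with 0 < q < 1 on an edge e.\<close>
type_synonym 'v svtx = "'v + (('v \<times> 'v) \<times> real)"

definition pt :: "'v \<times> 'v \<Rightarrow> real \<Rightarrow> 'v svtx" where
  "pt e q = (if q = 0 then Inl (fst e) else if q = 1 then Inl (snd e) else Inr (e, q))"

text \<open>Lambda_m\<close>
definition sub_vertices :: "'v set \<Rightarrow> ('v \<times> 'v) set \<Rightarrow> nat \<Rightarrow> 'v svtx set" where
  "sub_vertices V E m = Inl ` V \<union> {pt e (real k / 2 ^ m) | e k. e \<in> E \<and> k \<le> 2 ^ m}"

text \<open>E_m: the edges e_{j,m} = {v_{e,2^-m(j-1)}, v_{e,2^-m j}}, 1 <= j <= 2^m\<close>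
definition sub_edges :: "('v \<times> 'v) set \<Rightarrow> nat \<Rightarrow> 'v svtx set set" where
  "sub_edges E m = {{pt e (real (j - 1) / 2 ^ m), pt e (real j / 2 ^ m)} | e j.
                      e \<in> E \<and> 1 \<le> j \<and> j \<le> 2 ^ m}"

section \<open>Matrices indexed by finite sets\<close>

text \<open>Weight matrix W_{ij} = W_e if e = {i,j} is an edge, 0 otherwise.\<close>
definition wmat :: "'x set set \<Rightarrow> ('x set \<Rightarrow> real) \<Rightarrow> 'x \<Rightarrow> 'x \<Rightarrow> real" where
  "wmat Es w i j = (if {i, j} \<in> Es then w {i, j} else 0)"

text \<open>H^W_beta = 2 diag(beta) - W\<close>
definition Hmat :: "('x \<Rightarrow> 'x \<Rightarrow> real) \<Rightarrow> ('x \<Rightarrow> real) \<Rightarrow> 'x \<Rightarrow> 'x \<Rightarrow> real" where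
  "Hmat W b i j = (if i = j then 2 * b i else 0) - W i j"

text \<open>Positive definiteness of the (symmetric) block A_{II}\<close>
definition posdef_on :: "'x set \<Rightarrow> ('x \<Rightarrow> 'x \<Rightarrow> real) \<Rightarrow> bool" where
  "posdef_on I A \<longleftrightarrow>
     (\<forall>x. (\<exists>i\<in>I. x i \<noteq> 0) \<longrightarrow> (\<Sum>i\<in>I. \<Sum>j\<in>I. x i * A i j * x j) > 0)"

text \<open>Determinant of the block A_{II} (Leibniz formula)\<close>
definition det_on :: "'x set \<Rightarrow> ('x \<Rightarrow> 'x \<Rightarrow> real) \<Rightarrow> real" where
  "det_on I A = (\<Sum>p\<in>{p. p permutes I}. of_int (sign p) * (\<Prod>i\<in>I. A i (p i)))"

text \<open>Inverse of the block A_{II} (extended by 0 outside I x I)\<close>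
definition inv_on :: "'x set \<Rightarrow> ('x \<Rightarrow> 'x \<Rightarrow> real) \<Rightarrow> 'x \<Rightarrow> 'x \<Rightarrow> real" where
  "inv_on I A = (THE B. (\<forall>i\<in>I. \<forall>k\<in>I. (\<Sum>j\<in>I. A i j * B j k) = (if i = k then 1 else 0)) \<and>
                         (\<forall>i k. i \<notin> I \<or> k \<notin> I \<longrightarrow> B i k = 0))"

section \<open>The random field beta and effective weights\<close>

text \<open>Density of nu^W_Lambda with respect to Lebesgue measure on R^Lambda\<close>
definition nu_density :: "'x set \<Rightarrow> ('x \<Rightarrow> 'x \<Rightarrow> real) \<Rightarrow> ('x \<Rightarrow> real) \<Rightarrow> real" where
  "nu_density L W b =
     (2 / pi) powr (real (card L) / 2) *
     (if posdef_on L (Hmat W b) then 1 else 0) *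
     exp (- (1/2) * (\<Sum>i\<in>L. \<Sum>j\<in>L. Hmat W b i j)) *
     det_on L (Hmat W b) powr (- 1 / 2)"

definition nu_law :: "'x set \<Rightarrow> ('x \<Rightarrow> 'x \<Rightarrow> real) \<Rightarrow> ('x \<Rightarrow> real) measure" where
  "nu_law L W = density (PiM L (\<lambda>_. lborel)) (\<lambda>b. ennreal (nu_density L W b))"

text \<open>W^J(beta_I)_{ij} = W_{ij} + (W_{JI} ([H^W_beta]_{II})^{-1} W_{IJ})_{ij}, I = L - J\<close>
definition eff_weight :: "'x set \<Rightarrow> 'x set \<Rightarrow> ('x \<Rightarrow> 'x \<Rightarrow> real) \<Rightarrow> ('x \<Rightarrow> real)
                          \<Rightarrow> 'x \<Rightarrow> 'x \<Rightarrow> real" where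
  "eff_weight L J W b i j =
     W i j + (\<Sum>a\<in>L - J. \<Sum>c\<in>L - J. W i a * inv_on (L - J) (Hmat W b) a c * W c j)"

text \<open>The effective weight W^{(m)}_{ij} computed from weights w on E_r and the field b on Lambda_r.\<close>
definition eff_W :: "'v set \<Rightarrow> ('v \<times> 'v) set \<Rightarrow> nat \<Rightarrow> nat \<Rightarrow> ('v svtx set \<Rightarrow> real)
                     \<Rightarrow> ('v svtx \<Rightarrow> real) \<Rightarrow> 'v svtx \<Rightarrow> 'v svtx \<Rightarrow> real" where
  "eff_W V E r m w b i j =
     eff_weight (sub_vertices V E r) (sub_vertices V E m) (wmat (sub_edges E r) w) b i j"

section \<open>Constants and expectations\<close>

definition C_const :: "real \<Rightarrow> real" where
  "C_const \<alpha> = 2 powr (- \<alpha>) * Gamma (1/2 - \<alpha>) / sqrt pi"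

definition c2_const :: real where
  "c2_const = euler_mascheroni + ln 2"

text \<open>Extended-real expectation E[f] = E[f^+] - E[f^-]  (with the ereal convention
  infinity - infinity = infinity).\<close>
definition ext_expectation :: "'a measure \<Rightarrow> ('a \<Rightarrow> real) \<Rightarrow> ereal" where
  "ext_expectation M f =
     enn2ereal (\<integral>\<^sup>+ x. ennreal (f x) \<partial>M) - enn2ereal (\<integral>\<^sup>+ x. ennreal (- f x) \<partial>M)"

text \<open>Right-hand sides of the second and third bounds as functions of m.\<close>
definition pow_bound :: "real \<Rightarrow> ennreal \<Rightarrow> nat \<Rightarrow> nat \<Rightarrow> nat \<Rightarrow> ennreal" where
  "pow_bound \<alpha> EW l r m =
     ennreal (1 / C_const \<alpha>) *
     (ennreal (C_const \<alpha> * (2 powr (- \<alpha>)) ^ (r - m)) * EW) ^ (2 ^ (m - l))"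

definition log_bound :: "ereal \<Rightarrow> nat \<Rightarrow> nat \<Rightarrow> nat \<Rightarrow> ereal" where
  "log_bound EL l r m =
     ereal (2 ^ (m - l)) * (EL - ereal (real (r - m) * ln 2) + ereal c2_const) - ereal c2_const"

lemma "(\<infinity>::ereal) - \<infinity> = \<infinity>" by simp

end

theory Submission
  imports Defs "HOL-Real_Asymp.Real_Asymp"
begin

text \<open>
  Eliminating the midpoint of two consecutive edges with effective weights a and b replaces them
  by one edge of weight ab/X, where X is the Schur complement of H at the midpoint.
  Integrating out the field one vertex at a time keeps the density in closed form and shows that,
  given a and b, X has the reciprocal inverse Gaussian density with parameter s = a + b; moreover
  a and b depend on disjoint parts of the weights and of the field and are therefore i.i.d.
  Hence the law of the effective weight of level l is the (r - l)-fold iterate of the map sending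
  a law to the law of ab/X. One step of this map is controlled in two ways: E[s/X] = 1 together
  with the inequality between harmonic and geometric mean gives the factor 1/2, while X is
  stochastically larger than in the case s = 0 (a chi-squared variable, for which the moment of
  order -\<alpha> is C_\<alpha> and the mean of -log X is c2), which gives the squaring. Applying the
  first bound r - m times and the second m - l times yields all the estimates.
\<close>

section \<open>Schur complements by successive elimination\<close>

text \<open>The effective weight inverts the block over all fine vertices at once, whereas
  independence becomes visible only vertex by vertex. Elimination reconciles the two because its
  order is free. The interior of the chosen coarse edge is eliminated first, each half before its
  midpoint; the remaining fine vertices lie inside other coarse edges, so their elimination leaves
  the entry of the chosen edge unchanged. The same order serves the field: the density factor of a
  vertex involves the field only at this vertex and at those eliminated before it, so everything
  eliminated after the chosen interior integrates to 1. The parameter of a pivot density is minus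
  the off-diagonal sum of the pivot's column. At the midpoint of a segment only the two adjacent
  effective weights survive in this sum, hence s = a + b. The \<open>- 2\<close> in the minimizers
  stems from 2 (x + 1) - x = x + 2: passing from m to m + 1 doubles the power and raises the linear
  factor x by one.\<close>

text \<open>
  The last element of the list is eliminated first. A vanishing pivot leaves the matrix unchanged,
  since division by 0 gives 0.
\<close>
primrec elim :: "'x list \<Rightarrow> ('x \<Rightarrow> 'x \<Rightarrow> real) \<Rightarrow> 'x \<Rightarrow> 'x \<Rightarrow> real" where
  "elim [] A = A"
| "elim (k # ks) A = (\<lambda>i j. elim ks A i j - elim ks A i k * elim ks A k j / elim ks A k k)"

primrec pos_pivots :: "'x list \<Rightarrow> ('x \<Rightarrow> 'x \<Rightarrow> real) \<Rightarrow> bool" where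
  "pos_pivots [] A \<longleftrightarrow> True"
| "pos_pivots (k # ks) A \<longleftrightarrow> pos_pivots ks A \<and> elim ks A k k > 0"

lemma elim_append: "elim (ks @ ks') A = elim ks (elim ks' A)"
  by (induction ks) auto

lemma pos_pivots_append: "pos_pivots (ks @ ks') A \<longleftrightarrow> pos_pivots ks (elim ks' A) \<and> pos_pivots ks' A"
  by (induction ks) (auto simp: elim_append)

lemma elim_sym:
  assumes "\<And>i j. A i j = A j i"
  shows "elim ks A i j = elim ks A j i"
  by (induction ks arbitrary: i j) (use assms in \<open>auto simp: mult.commute\<close>)

text \<open>A perturbation that vanishes on the rows and columns of the eliminated indices never
  enters a quotient, so it passes through unchanged. This decouples the two halves of a segment, and
  it isolates the field value at a single vertex.\<close>

lemma elim_add: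
  assumes "\<And>i j. i \<in> set ks \<or> j \<in> set ks \<Longrightarrow> D i j = 0"
  shows "elim ks (\<lambda>i j. A i j + D i j) i j = elim ks A i j + D i j"
  using assms
proof (induction ks arbitrary: i j)
  case (Cons k ks)
  have "elim ks (\<lambda>i j. A i j + D i j) i j = elim ks A i j + D i j" for i j
    by (rule Cons.IH) (use Cons.prems in auto)
  then show ?case using Cons.prems by simp
qed auto

lemma pos_pivots_add:
  assumes "\<And>i j. i \<in> set ks \<or> j \<in> set ks \<Longrightarrow> D i j = 0"
  shows "pos_pivots ks (\<lambda>i j. A i j + D i j) \<longleftrightarrow> pos_pivots ks A"
  using assms
proof (induction ks)
  case (Cons k ks)
  have "elim ks (\<lambda>i j. A i j + D i j) k k = elim ks A k k + D k k"
    by (rule elim_add) (use Cons.prems in auto)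
  moreover have "pos_pivots ks (\<lambda>i j. A i j + D i j) \<longleftrightarrow> pos_pivots ks A"
    by (rule Cons.IH) (use Cons.prems in auto)
  ultimately show ?case using Cons.prems by simp
qed auto

text \<open>Each correction carries the factor \<open>elim ks A i k\<close>, which stays equal to
  \<open>A i k = 0\<close>. The next lemma is the version for columns.\<close>

lemma elim_eq_nonadjacent:
  assumes "\<And>a. a \<in> set ks \<Longrightarrow> A i a = 0"
  shows "elim ks A i j = A i j"
  using assms by (induction ks arbitrary: j) auto

lemma elim_eq_nonadjacent':
  assumes "\<And>a. a \<in> set ks \<Longrightarrow> A a j = 0"
  shows "elim ks A i j = A i j"
  using assms
proof (induction ks arbitrary: i)
  case (Cons k ks)
  have "elim ks A i j = A i j" for i
    by (rule Cons.IH) (use Cons.prems in auto)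
  then show ?case using Cons.prems by simp
qed auto

text \<open>No path through the eliminated indices leads from P to Q.\<close>
lemma elim_eq_separated:
  assumes "set ks \<subseteq> P \<union> Q"
    and "\<And>u k. u \<in> P \<Longrightarrow> k \<in> Q \<inter> set ks \<Longrightarrow> A u k = 0"
    and "\<And>k v. k \<in> P \<inter> set ks \<Longrightarrow> v \<in> Q \<Longrightarrow> A k v = 0"
    and "u \<in> P" "v \<in> Q"
  shows "elim ks A u v = A u v"
  using assms
proof (induction ks arbitrary: u v)
  case (Cons k ks)
  have IH: "elim ks A u v = A u v" if "u \<in> P" "v \<in> Q" for u v
    by (rule Cons.IH) (use Cons.prems that in auto)
  from Cons.prems have "k \<in> P \<or> k \<in> Q" by auto
  then have "elim ks A u k * elim ks A k v = 0"
    using IH[of u k] IH[of k v] Cons.prems by auto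
  then show ?case using IH Cons.prems by simp
qed auto

text \<open>The correction subtracts a product of two nonpositive entries over a positive pivot, so
  the sign pattern persists. It makes the parameters of the pivot densities nonnegative.\<close>

lemma elim_offdiag_nonpos:
  assumes "distinct ks" "pos_pivots ks A" "i \<noteq> j" "i \<notin> set ks" "j \<notin> set ks"
    and "\<And>i j. i \<noteq> j \<Longrightarrow> A i j \<le> 0"
  shows "elim ks A i j \<le> 0"
  using assms
proof (induction ks arbitrary: i j)
  case (Cons k ks)
  have "elim ks A i j \<le> 0" "elim ks A i k \<le> 0" "elim ks A k j \<le> 0"
    by (rule Cons.IH; use Cons.prems in auto)+
  moreover from this have "elim ks A i k * elim ks A k j / elim ks A k k \<ge> 0"
    using Cons.prems by (auto intro!: divide_nonneg_pos mult_nonpos_nonpos)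
  ultimately show ?case by simp
qed auto

text \<open>Elimination acts by column operations: each column receives a combination of the pivot
  columns that clears the eliminated rows. The coefficients \<open>y\<close> thus solve a linear
  system on the block, which later ties elimination to definiteness, determinant and
  inverse.\<close>

lemma elim_solution:
  assumes "distinct ks" "pos_pivots ks A"
  obtains y where "\<And>i. elim ks A i j = A i j + (\<Sum>a\<in>set ks. A i a * y a)"
    and "\<And>i. i \<in> set ks \<Longrightarrow> elim ks A i j = 0"
proof -
  have "\<exists>y. (\<forall>i. elim ks A i j = A i j + (\<Sum>a\<in>set ks. A i a * y a)) \<and>
      (\<forall>i\<in>set ks. elim ks A i j = 0)" for j
    using assms
  proof (induction ks arbitrary: j)
    case (Cons k ks)
    from Cons.prems have x: "elim ks A k k > 0" and k: "k \<notin> set ks" by auto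
    from Cons.IH[of j] Cons.prems obtain y where
      y: "\<And>i. elim ks A i j = A i j + (\<Sum>a\<in>set ks. A i a * y a)"
      and y0: "\<And>i. i \<in> set ks \<Longrightarrow> elim ks A i j = 0" by auto
    from Cons.IH[of k] Cons.prems obtain z where
      z: "\<And>i. elim ks A i k = A i k + (\<Sum>a\<in>set ks. A i a * z a)"
      and z0: "\<And>i. i \<in> set ks \<Longrightarrow> elim ks A i k = 0" by auto
    \<comment> \<open>\<open>c\<close> clears row k. Column k enters with coefficient
      \<open>- c\<close> and brings along its own coefficients \<open>z\<close>.\<close>
    define c where "c = elim ks A k j / elim ks A k k"
    define y' where "y' a = (if a = k then - c else y a - c * z a)" for a
    have "elim (k # ks) A i j = A i j + (\<Sum>a\<in>set (k # ks). A i a * y' a)" for i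
    proof -
      have "(\<Sum>a\<in>set ks. A i a * y' a) = (\<Sum>a\<in>set ks. A i a * y a - c * (A i a * z a))"
        using k by (intro sum.cong) (auto simp: y'_def algebra_simps)
      also have "\<dots> = (elim ks A i j - A i j) - c * (elim ks A i k - A i k)"
        unfolding y z by (simp add: sum_subtractf sum_distrib_left)
      finally have "(\<Sum>a\<in>set (k # ks). A i a * y' a) =
          A i k * y' k + (elim ks A i j - A i j - c * (elim ks A i k - A i k))"
        using k by simp
      also have "y' k = - c" by (simp add: y'_def)
      finally have "A i j + (\<Sum>a\<in>set (k # ks). A i a * y' a) = elim ks A i j - c * elim ks A i k"
        by (simp only: algebra_simps)
      then show ?thesis by (simp add: c_def)
    qed
    moreover have "\<forall>i\<in>set (k # ks). elim (k # ks) A i j = 0"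
      using y0 z0 x by auto
    ultimately show ?case by blast
  qed auto
  then show ?thesis using that by blast
qed

lemma elim_zero_row:
  assumes "distinct ks" "pos_pivots ks A" "i \<in> set ks"
  shows "elim ks A i j = 0"
  by (rule elim_solution[OF assms(1,2)]) (use assms(3) in blast)

text \<open>The vector of \<open>elim_solution\<close> for column k, extended by 1 at k, is
  annihilated by the earlier rows and mapped to the pivot by row k. A multiple of it therefore
  corrects the last equation without spoiling the others.\<close>

lemma linear_system_solvable:
  assumes "distinct ks" "pos_pivots ks A"
  obtains z where "\<And>i. i \<in> set ks \<Longrightarrow> (\<Sum>a\<in>set ks. A i a * z a) = g i"
proof -
  have "\<exists>z. \<forall>i\<in>set ks. (\<Sum>a\<in>set ks. A i a * z a) = g i"
    using assms
  proof (induction ks)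
    case (Cons k ks)
    from Cons.prems have x: "elim ks A k k > 0" and k: "k \<notin> set ks" by auto
    from Cons.IH Cons.prems obtain z0
      where z0: "\<And>i. i \<in> set ks \<Longrightarrow> (\<Sum>a\<in>set ks. A i a * z0 a) = g i" by auto
    obtain y where y: "\<And>i. elim ks A i k = A i k + (\<Sum>a\<in>set ks. A i a * y a)"
      and y0: "\<And>i. i \<in> set ks \<Longrightarrow> elim ks A i k = 0"
      using elim_solution[of ks A k] Cons.prems by (auto simp del: elim.simps)
    define t where "t = (g k - (\<Sum>a\<in>set ks. A k a * z0 a)) / elim ks A k k"
    define z where "z a = (if a = k then t else z0 a + t * y a)" for a
    have *: "(\<Sum>a\<in>set (k # ks). A i a * z a) = (\<Sum>a\<in>set ks. A i a * z0 a) + t * elim ks A i k" for i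
    proof -
      have "(\<Sum>a\<in>set ks. A i a * z a) = (\<Sum>a\<in>set ks. A i a * z0 a + t * (A i a * y a))"
        using k by (intro sum.cong) (auto simp: z_def algebra_simps)
      also have "\<dots> = (\<Sum>a\<in>set ks. A i a * z0 a) + t * (elim ks A i k - A i k)"
        unfolding y by (simp add: sum.distrib sum_distrib_left)
      finally have "(\<Sum>a\<in>set (k # ks). A i a * z a) =
          A i k * z k + ((\<Sum>a\<in>set ks. A i a * z0 a) + t * (elim ks A i k - A i k))"
        using k by simp
      also have "z k = t" by (simp add: z_def)
      finally show ?thesis by (simp add: algebra_simps)
    qed
    have "\<forall>i\<in>set (k # ks). (\<Sum>a\<in>set (k # ks). A i a * z a) = g i"
      unfolding * using z0 y0 x by (auto simp: t_def)
    then show ?case by blast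
  qed auto
  then show ?thesis using that by blast
qed

section \<open>Positive definiteness, determinant and inverse in terms of pivots\<close>

text \<open>Completing the square: subtracting \<open>v k\<close> times \<open>y\<close> from v
  splits the form into the square of \<open>v k\<close> times the Schur complement at k plus the
  form on \<open>I\<close>.\<close>

lemma posdef_on_insert:
  assumes sym: "\<And>i j. A i j = A j i" and fin: "finite I" and k: "k \<notin> I"
    and y: "\<And>i. i \<in> I \<Longrightarrow> A i k + (\<Sum>a\<in>I. A i a * y a) = 0"
  shows "posdef_on (insert k I) A \<longleftrightarrow> posdef_on I A \<and> A k k + (\<Sum>a\<in>I. A k a * y a) > 0"
proof -
  define x where "x = A k k + (\<Sum>a\<in>I. A k a * y a)"
  define Q where "Q J v = (\<Sum>i\<in>J. \<Sum>j\<in>J. v i * A i j * v j)" for J and v :: "'a \<Rightarrow> real"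
  have Q_insert: "Q (insert k I) v = v k ^ 2 * A k k + 2 * v k * (\<Sum>i\<in>I. A k i * v i) + Q I v" for v
  proof -
    have "Q (insert k I) v = v k * A k k * v k + (\<Sum>j\<in>I. v k * A k j * v j)
        + (\<Sum>i\<in>I. v i * A i k * v k + (\<Sum>j\<in>I. v i * A i j * v j))"
      using fin k by (simp add: Q_def)
    also have "(\<Sum>j\<in>I. v k * A k j * v j) = v k * (\<Sum>i\<in>I. A k i * v i)"
      by (simp add: sum_distrib_left algebra_simps)
    also have "(\<Sum>i\<in>I. v i * A i k * v k + (\<Sum>j\<in>I. v i * A i j * v j)) =
        v k * (\<Sum>i\<in>I. A k i * v i) + Q I v"
      unfolding Q_def sum.distrib sum_distrib_left sym[of _ k]
      by (simp add: algebra_simps)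
    finally show ?thesis by (simp add: power2_eq_square algebra_simps)
  qed
  have Q_shift: "Q (insert k I) v = v k ^ 2 * x + Q I (\<lambda>i. v i - v k * y i)" for v
  proof -
    have Ay: "(\<Sum>a\<in>I. A i a * y a) = - A k i" if "i \<in> I" for i
      using y[OF that] sym[of i k] by linarith
    have yAv: "(\<Sum>i\<in>I. \<Sum>j\<in>I. y i * A i j * v j) = - (\<Sum>j\<in>I. A k j * v j)" for v
    proof -
      have "(\<Sum>i\<in>I. \<Sum>j\<in>I. y i * A i j * v j) = (\<Sum>j\<in>I. (\<Sum>i\<in>I. A j i * y i) * v j)"
        unfolding sum_distrib_right
        by (subst sum.swap) (intro sum.cong refl, subst sym, simp)
      also have "\<dots> = (\<Sum>j\<in>I. - (A k j * v j))" by (intro sum.cong) (simp_all add: Ay)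
      finally show ?thesis by (simp add: sum_negf)
    qed
    have vAy: "(\<Sum>i\<in>I. \<Sum>j\<in>I. v i * A i j * y j) = - (\<Sum>j\<in>I. A k j * v j)" for v
    proof -
      have "(\<Sum>i\<in>I. \<Sum>j\<in>I. v i * A i j * y j) = (\<Sum>i\<in>I. v i * (\<Sum>j\<in>I. A i j * y j))"
        by (simp add: sum_distrib_left mult.assoc)
      also have "\<dots> = (\<Sum>j\<in>I. - (A k j * v j))" by (intro sum.cong) (simp_all add: Ay)
      finally show ?thesis by (simp add: sum_negf)
    qed
    have "Q I (\<lambda>i. v i - v k * y i) = (\<Sum>i\<in>I. \<Sum>j\<in>I. v i * A i j * v j
        - v k * (y i * A i j * v j) - v k * (v i * A i j * y j) + v k ^ 2 * (y i * A i j * y j))"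
      unfolding Q_def by (intro sum.cong) (auto simp: algebra_simps power2_eq_square)
    also have "\<dots> = Q I v - v k * (\<Sum>i\<in>I. \<Sum>j\<in>I. y i * A i j * v j)
       - v k * (\<Sum>i\<in>I. \<Sum>j\<in>I. v i * A i j * y j) + v k ^ 2 * (\<Sum>i\<in>I. \<Sum>j\<in>I. y i * A i j * y j)"
      unfolding Q_def by (simp add: sum.distrib sum_subtractf sum_distrib_left)
    finally show ?thesis unfolding Q_insert x_def yAv vAy by (simp add: algebra_simps)
  qed
  show ?thesis
  proof (intro iffI conjI)
    assume P: "posdef_on (insert k I) A"
    show "posdef_on I A"
      unfolding posdef_on_def
    proof (intro allI impI)
      fix v :: "'a \<Rightarrow> real" assume "\<exists>i\<in>I. v i \<noteq> 0"
      then have "\<exists>i\<in>insert k I. (v(k := 0)) i \<noteq> 0" using k by auto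
      then have "Q (insert k I) (v(k := 0)) > 0"
        using P unfolding posdef_on_def Q_def by blast
      then have "Q I (v(k := 0)) > 0" by (simp add: Q_insert)
      moreover have "Q I (v(k := 0)) = Q I v"
        unfolding Q_def using k by (intro sum.cong) auto
      ultimately show "(\<Sum>i\<in>I. \<Sum>j\<in>I. v i * A i j * v j) > 0" by (simp add: Q_def)
    qed
    \<comment> \<open>The vector with entries \<open>y\<close> on \<open>I\<close> and 1 at k has
      shifted part 0, so its form equals the Schur complement.\<close>
    have "\<exists>i\<in>insert k I. (y(k := 1)) i \<noteq> 0" by auto
    then have "Q (insert k I) (y(k := 1)) > 0"
      using P unfolding posdef_on_def Q_def by blast
    moreover have "Q I (\<lambda>i. (y(k := 1)) i - (y(k := 1)) k * y i) = 0"
      unfolding Q_def using k by (intro sum.neutral ballI) auto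
    ultimately show "A k k + (\<Sum>a\<in>I. A k a * y a) > 0"
      by (simp add: Q_shift x_def)
  next
    assume P: "posdef_on I A \<and> A k k + (\<Sum>a\<in>I. A k a * y a) > 0"
    have QI: "Q I v \<ge> 0" for v
    proof (cases "\<exists>i\<in>I. v i \<noteq> 0")
      case True
      then show ?thesis using P unfolding posdef_on_def Q_def by (intro less_imp_le) blast
    qed (auto simp: Q_def)
    show "posdef_on (insert k I) A"
      unfolding posdef_on_def
    proof (intro allI impI)
      fix v :: "'a \<Rightarrow> real" assume v: "\<exists>i\<in>insert k I. v i \<noteq> 0"
      have "Q (insert k I) v > 0"
      proof (cases "v k = 0")
        case True
        then have "\<exists>i\<in>I. v i \<noteq> 0" using v by auto
        then have "Q I v > 0" using P unfolding posdef_on_def Q_def by blast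
        then show ?thesis by (simp add: Q_insert True)
      next
        case False
        then have "v k ^ 2 * x > 0" using P by (simp add: x_def)
        then show ?thesis using QI[of "\<lambda>i. v i - v k * y i"] by (simp add: Q_shift)
      qed
      then show "(\<Sum>i\<in>insert k I. \<Sum>j\<in>insert k I. v i * A i j * v j) > 0" by (simp add: Q_def)
    qed
  qed
qed

lemma posdef_on_subset:
  assumes "posdef_on J A" "I \<subseteq> J" "finite J"
  shows "posdef_on I A"
  unfolding posdef_on_def
proof (intro allI impI)
  fix v :: "'a \<Rightarrow> real" assume "\<exists>i\<in>I. v i \<noteq> 0"
  define u where "u i = (if i \<in> I then v i else 0)" for i
  have "\<exists>i\<in>J. u i \<noteq> 0" using assms(2) \<open>\<exists>i\<in>I. v i \<noteq> 0\<close> by (auto simp: u_def)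
  then have "(\<Sum>i\<in>J. \<Sum>j\<in>J. u i * A i j * u j) > 0"
    using assms(1) unfolding posdef_on_def by blast
  also have "(\<Sum>i\<in>J. \<Sum>j\<in>J. u i * A i j * u j) = (\<Sum>i\<in>I. \<Sum>j\<in>I. u i * A i j * u j)"
    using assms by (intro sum.mono_neutral_cong_right sum.mono_neutral_right)
      (auto simp: u_def intro!: sum.mono_neutral_right)
  also have "\<dots> = (\<Sum>i\<in>I. \<Sum>j\<in>I. v i * A i j * v j)"
    by (intro sum.cong) (auto simp: u_def)
  finally show "(\<Sum>i\<in>I. \<Sum>j\<in>I. v i * A i j * v j) > 0" .
qed

text \<open>The pivots replace the leading minors of Sylvester's criterion. In this form positive
  definiteness is accessible to induction and to measurability arguments.\<close>

lemma posdef_on_iff_pos_pivots: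
  assumes sym: "\<And>i j. A i j = A j i" and "distinct ks"
  shows "posdef_on (set ks) A \<longleftrightarrow> pos_pivots ks A"
  using \<open>distinct ks\<close>
proof (induction ks)
  case Nil
  then show ?case by (simp add: posdef_on_def)
next
  case (Cons k ks)
  show ?case
  proof (cases "pos_pivots ks A")
    case True
    obtain y where y: "\<And>i. elim ks A i k = A i k + (\<Sum>a\<in>set ks. A i a * y a)"
      and y0: "\<And>i. i \<in> set ks \<Longrightarrow> elim ks A i k = 0"
      using elim_solution[of ks A k] Cons.prems True by auto
    have "A i k + (\<Sum>a\<in>set ks. A i a * y a) = 0" if "i \<in> set ks" for i
      using y0[OF that] y[of i] by simp
    from posdef_on_insert[of A "set ks" k y, OF sym _ _ this] show ?thesis
      using Cons y[of k] by simp
  next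
    case False
    then show ?thesis
      using Cons posdef_on_subset[of "set (k # ks)" A "set ks"] by auto
  qed
qed

text \<open>Adding the rows of \<open>I\<close> with weights \<open>y\<close> to row k turns it into
  \<open>R\<close>, which vanishes on \<open>I\<close>; then only permutations fixing k contribute.
  The added rows change nothing because a determinant with a repeated row is 0.\<close>

lemma det_on_insert:
  assumes sym: "\<And>i j. A i j = A j i" and fin: "finite I" and k: "k \<notin> I"
    and y: "\<And>i. i \<in> I \<Longrightarrow> A i k + (\<Sum>a\<in>I. A i a * y a) = 0"
  shows "det_on (insert k I) A = (A k k + (\<Sum>a\<in>I. A k a * y a)) * det_on I A"
proof -
  define S where "S = {p. p permutes insert k I}"
  have finS: "finite S" unfolding S_def using fin by (simp add: finite_permutations)
  define R where "R j = A k j + (\<Sum>a\<in>I. y a * A a j)" for j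
  have R0: "R j = 0" if "j \<in> I" for j
    using y[OF that] unfolding R_def by (subst (asm) (1 2) sym) (simp add: mult.commute)
  have Rk: "R k = A k k + (\<Sum>a\<in>I. A k a * y a)"
    unfolding R_def by (subst sym[of _ k]) (simp add: mult.commute)
  define P where "P p = (\<Prod>i\<in>I. A i (p i))" for p
  \<comment> \<open>Row k replaced by row a: composing with the transposition of a and k keeps the
    product and flips the sign, so the sum equals its own negative.\<close>
  have swap0: "(\<Sum>p\<in>S. of_int (sign p) * (A a (p k) * P p)) = 0" if a: "a \<in> I" for a
  proof -
    have ak: "a \<noteq> k" using a k by auto
    have t: "Transposition.transpose a k permutes insert k I" using a by (intro permutes_swap_id) auto
    define g where "g p = of_int (sign p) * (A a (p k) * P p)" for p
    have "g (p \<circ> Transposition.transpose a k) = - g p" if "p \<in> S" for p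
    proof -
      have p: "p permutes insert k I" using that by (simp add: S_def)
      have "sign (p \<circ> Transposition.transpose a k) = - sign p"
        using p t fin ak by (simp add: sign_compose permutes_imp_permutation[of "insert k I"] permutation_swap_id sign_swap_id)
      moreover have "A a ((p \<circ> Transposition.transpose a k) k) * P (p \<circ> Transposition.transpose a k) = A a (p k) * P p"
      proof -
        have "P p = A a (p a) * (\<Prod>i\<in>I-{a}. A i (p i))"
          unfolding P_def using a fin by (simp add: prod.remove)
        moreover have "P (p \<circ> Transposition.transpose a k) = A a (p k) * (\<Prod>i\<in>I-{a}. A i ((p \<circ> Transposition.transpose a k) i))"
          unfolding P_def using a fin by (simp add: prod.remove)
        moreover have "(\<Prod>i\<in>I-{a}. A i ((p \<circ> Transposition.transpose a k) i)) = (\<Prod>i\<in>I-{a}. A i (p i))"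
          using k by (intro prod.cong) (auto simp: Transposition.transpose_def)
        ultimately show ?thesis by (simp add: ac_simps)
      qed
      ultimately show ?thesis by (simp add: g_def)
    qed
    then have "(\<Sum>p\<in>S. g (p \<circ> Transposition.transpose a k)) = - (\<Sum>p\<in>S. g p)"
      by (simp add: sum_negf)
    moreover have "(\<Sum>p\<in>S. g (p \<circ> Transposition.transpose a k)) = (\<Sum>p\<in>S. g p)"
      using sum_permutations_compose_right[OF t, of g] unfolding S_def by simp
    ultimately show ?thesis by (simp add: g_def)
  qed
  have "(\<Sum>p\<in>S. of_int (sign p) * (R (p k) * P p)) =
      (\<Sum>p\<in>S. of_int (sign p) * (A k (p k) * P p)) +
      (\<Sum>p\<in>S. \<Sum>a\<in>I. y a * (of_int (sign p) * (A a (p k) * P p)))"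
    by (simp add: R_def algebra_simps sum.distrib sum_distrib_left)
  also have "(\<Sum>p\<in>S. \<Sum>a\<in>I. y a * (of_int (sign p) * (A a (p k) * P p))) =
      (\<Sum>a\<in>I. y a * (\<Sum>p\<in>S. of_int (sign p) * (A a (p k) * P p)))"
    by (subst sum.swap) (simp add: sum_distrib_left)
  also have "\<dots> = 0" using swap0 by simp
  also have "(\<Sum>p\<in>S. of_int (sign p) * (A k (p k) * P p)) = det_on (insert k I) A"
    unfolding det_on_def S_def P_def using fin k by (intro sum.cong) auto
  finally have "det_on (insert k I) A = (\<Sum>p\<in>S. of_int (sign p) * (R (p k) * P p))" by simp
  also have "\<dots> = (\<Sum>p\<in>{p. p permutes I}. of_int (sign p) * (R (p k) * P p))"
  proof (rule sum.mono_neutral_right[OF finS])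
    show "{p. p permutes I} \<subseteq> S" unfolding S_def using permutes_subset by blast
    show "\<forall>p\<in>S - {p. p permutes I}. real_of_int (sign p) * (R (p k) * P p) = 0"
    proof
      fix p assume p: "p \<in> S - {p. p permutes I}"
      then have "p permutes insert k I" by (auto simp: S_def)
      moreover have "p k \<noteq> k"
      proof
        assume "p k = k"
        then have "p permutes I"
          by (intro permutes_superset[OF \<open>p permutes insert k I\<close>]) auto
        with p show False by auto
      qed
      ultimately have "p k \<in> I" by (metis insertE insertI1 permutes_in_image)
      then show "real_of_int (sign p) * (R (p k) * P p) = 0" by (simp add: R0)
    qed
  qed
  also have "\<dots> = (\<Sum>p\<in>{p. p permutes I}. R k * (of_int (sign p) * P p))"
    using k by (intro sum.cong) (auto simp: permutes_not_in)
  also have "\<dots> = R k * det_on I A" by (simp add: det_on_def P_def sum_distrib_left)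
  finally show ?thesis by (simp add: Rk)
qed

primrec pivot_prod :: "'x list \<Rightarrow> ('x \<Rightarrow> 'x \<Rightarrow> real) \<Rightarrow> real" where
  "pivot_prod [] A = 1"
| "pivot_prod (k # ks) A = elim ks A k k * pivot_prod ks A"

lemma det_on_eq_pivot_prod:
  assumes sym: "\<And>i j. A i j = A j i" and "distinct ks" "pos_pivots ks A"
  shows "det_on (set ks) A = pivot_prod ks A"
  using assms(2,3)
proof (induction ks)
  case Nil
  have "{p. p permutes ({}::'a set)} = {id}" by (auto simp: permutes_empty)
  then show ?case by (simp add: det_on_def)
next
  case (Cons k ks)
  obtain y where y: "\<And>i. elim ks A i k = A i k + (\<Sum>a\<in>set ks. A i a * y a)"
    and y0: "\<And>i. i \<in> set ks \<Longrightarrow> elim ks A i k = 0"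
    using elim_solution[of ks A k] Cons.prems by auto
  have "A i k + (\<Sum>a\<in>set ks. A i a * y a) = 0" if "i \<in> set ks" for i
    using y0[OF that] y[of i] by simp
  from det_on_insert[of A "set ks" k y, OF sym _ _ this] show ?case
    using Cons y[of k] by simp
qed

lemma posdef_on_kernel:
  assumes "posdef_on I A" "\<And>i. i \<in> I \<Longrightarrow> (\<Sum>j\<in>I. A i j * v j) = 0" "i \<in> I"
  shows "v i = 0"
proof (rule ccontr)
  assume "v i \<noteq> 0"
  then have "(\<Sum>i\<in>I. \<Sum>j\<in>I. v i * A i j * v j) > 0"
    using assms unfolding posdef_on_def by blast
  moreover have "(\<Sum>i\<in>I. \<Sum>j\<in>I. v i * A i j * v j) = (\<Sum>i\<in>I. v i * (\<Sum>j\<in>I. A i j * v j))"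
    by (simp add: sum_distrib_left mult.assoc)
  ultimately show False using assms(2) by simp
qed

text \<open>The \<open>THE\<close> in \<open>inv_on\<close> requires existence, from solving one
  system per unit vector, and uniqueness, from the trivial kernel of a positive definite block; the
  extension by 0 makes the whole function unique.\<close>

lemma inv_on_right_inverse:
  assumes sym: "\<And>i j. A i j = A j i" and "distinct ks" "pos_pivots ks A"
    and "i \<in> set ks" "k \<in> set ks"
  shows "(\<Sum>j\<in>set ks. A i j * inv_on (set ks) A j k) = (if i = k then 1 else 0)"
proof -
  define I where "I = set ks"
  have pd: "posdef_on I A" using assms posdef_on_iff_pos_pivots[of A ks] by (simp add: I_def)
  define is_inv where "is_inv B \<longleftrightarrow>
    (\<forall>i\<in>I. \<forall>k\<in>I. (\<Sum>j\<in>I. A i j * B j k) = (if i = k then 1 else 0)) \<and>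
      (\<forall>i k. i \<notin> I \<or> k \<notin> I \<longrightarrow> B i k = 0)" for B
  have "\<exists>z. \<forall>i\<in>I. (\<Sum>a\<in>I. A i a * z a) = (if i = k then 1 else 0)" for k
    unfolding I_def by (rule linear_system_solvable[OF assms(2,3), of "\<lambda>i. if i = k then 1 else 0"]) blast
  then obtain Z where Z: "\<And>k i. i \<in> I \<Longrightarrow> (\<Sum>a\<in>I. A i a * Z k a) = (if i = k then 1 else 0)"
    by metis
  define B where "B a k = (if a \<in> I \<and> k \<in> I then Z k a else 0)" for a k
  have B: "is_inv B" unfolding is_inv_def B_def using Z by (auto intro!: sum.cong)
  have "B' = B" if B': "is_inv B'" for B'
  proof (intro ext)
    fix a k
    show "B' a k = B a k"
    proof (cases "a \<in> I \<and> k \<in> I")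
      case True
      have "B' a k - B a k = 0"
      proof (rule posdef_on_kernel[OF pd, of "\<lambda>a. B' a k - B a k"])
        fix i assume "i \<in> I"
        then show "(\<Sum>j\<in>I. A i j * (B' j k - B j k)) = 0"
          using B B' True by (simp add: is_inv_def right_diff_distrib sum_subtractf)
      qed (use True in auto)
      then show ?thesis by simp
    next
      case False
      then show ?thesis using B B' by (auto simp: is_inv_def)
    qed
  qed
  then have "is_inv (THE B. is_inv B)" using B by (metis theI)
  then show ?thesis using assms(4,5) unfolding is_inv_def inv_on_def I_def by blast
qed

text \<open>The coefficients of \<open>elim_solution\<close> and minus the inverse applied to column
  j solve the same system on a block with trivial kernel. This is the passage from elimination to
  effective weights.\<close>

lemma elim_eq_inv_on:
  assumes sym: "\<And>i j. A i j = A j i" and "distinct ks" "pos_pivots ks A"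
  shows "elim ks A i j =
    A i j - (\<Sum>a\<in>set ks. \<Sum>c\<in>set ks. A i a * inv_on (set ks) A a c * A c j)"
proof -
  define I where "I = set ks"
  define B where "B = inv_on I A"
  have pd: "posdef_on I A" using assms posdef_on_iff_pos_pivots[of A ks] by (simp add: I_def)
  obtain y where y: "\<And>i. elim ks A i j = A i j + (\<Sum>a\<in>I. A i a * y a)"
    and y0: "\<And>i. i \<in> I \<Longrightarrow> elim ks A i j = 0"
    using elim_solution[OF assms(2,3), of j] unfolding I_def by blast
  have yB: "y a = - (\<Sum>c\<in>I. B a c * A c j)" if "a \<in> I" for a
  proof -
    have "y a + (\<Sum>c\<in>I. B a c * A c j) = 0"
    proof (rule posdef_on_kernel[OF pd, of "\<lambda>a. y a + (\<Sum>c\<in>I. B a c * A c j)"])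
      fix i assume i: "i \<in> I"
      have "(\<Sum>a\<in>I. A i a * (\<Sum>c\<in>I. B a c * A c j)) = (\<Sum>c\<in>I. (\<Sum>a\<in>I. A i a * B a c) * A c j)"
        unfolding sum_distrib_left sum_distrib_right by (subst sum.swap) (simp add: mult.assoc)
      also have "\<dots> = (\<Sum>c\<in>I. (if i = c then 1 else 0) * A c j)"
        using inv_on_right_inverse[OF assms] i unfolding B_def I_def by (intro sum.cong) auto
      also have "\<dots> = A i j" using i by (simp add: I_def if_distrib[of "\<lambda>x. x * _"] cong: if_cong)
      finally show "(\<Sum>a\<in>I. A i a * (y a + (\<Sum>c\<in>I. B a c * A c j))) = 0"
        using y[of i] y0[OF i] by (simp add: distrib_left sum.distrib)
    qed fact
    then show ?thesis by simp
  qed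
  have "elim ks A i j = A i j + (\<Sum>a\<in>I. A i a * y a)" by (rule y)
  also have "(\<Sum>a\<in>I. A i a * y a) = - (\<Sum>a\<in>I. \<Sum>c\<in>I. A i a * B a c * A c j)"
    by (simp add: yB sum_negf sum_distrib_left mult.assoc)
  finally show ?thesis by (simp add: B_def I_def)
qed

section \<open>The reciprocal inverse Gaussian density\<close>

text \<open>The value 0 for x \<le> 0 carries the indicator of positive definiteness: a nonpositive
  pivot annihilates the density.\<close>

definition rig_density :: "real \<Rightarrow> real \<Rightarrow> real" where
  "rig_density s x = (if x > 0 then exp (- (x - s)\<^sup>2 / (2 * x)) / sqrt (2 * pi * x) else 0)"

lemma rig_density_nonneg [simp]: "rig_density s x \<ge> 0"
  by (simp add: rig_density_def)

lemma measurable_rig_density [measurable (raw)]: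
  assumes [measurable]: "f \<in> borel_measurable M" "g \<in> borel_measurable M"
  shows "(\<lambda>x. rig_density (f x) (g x)) \<in> borel_measurable M"
  unfolding rig_density_def by measurable

lemma nn_integral_FTC_pos:
  fixes f F :: "real \<Rightarrow> real"
  assumes F: "\<And>x. x > 0 \<Longrightarrow> (F has_real_derivative f x) (at x)"
    and cont: "\<And>x. x > 0 \<Longrightarrow> isCont f x"
    and nonneg: "\<And>x. x > 0 \<Longrightarrow> f x \<ge> 0"
    and A: "(F \<longlongrightarrow> A) (at_right 0)" and B: "(F \<longlongrightarrow> B) at_top"
  shows "(\<integral>\<^sup>+x. ennreal (f x) * indicator {0<..} x \<partial>lborel) = ennreal (B - A)"
proof -
  have A': "((F \<circ> real_of_ereal) \<longlongrightarrow> A) (at_right 0)"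
    using A by (simp add: zero_ereal_def ereal_tendsto_simps)
  have B': "((F \<circ> real_of_ereal) \<longlongrightarrow> B) (at_left \<infinity>)"
    using B by (simp add: ereal_tendsto_simps)
  have *: "set_integrable lborel (einterval 0 \<infinity>) f" "(LBINT x=0..\<infinity>. f x) = B - A"
    using interval_integral_FTC_nonneg[OF _ _ _ _ A' B', of f] F cont nonneg
    by (auto simp: zero_ereal_def)
  have e: "einterval 0 \<infinity> = {0<..}" by (auto simp: einterval_def zero_ereal_def)
  have "(\<integral>\<^sup>+x. ennreal (f x) * indicator {0<..} x \<partial>lborel) =
      (\<integral>\<^sup>+x. ennreal (indicator {0<..} x *\<^sub>R f x) \<partial>lborel)"
    by (intro nn_integral_cong) (auto simp: indicator_def)
  also have "\<dots> = ennreal (LINT x|lborel. indicator {0<..} x *\<^sub>R f x)"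
    using *(1) nonneg unfolding set_integrable_def e
    by (intro nn_integral_eq_integral) (auto simp: indicator_def)
  also have "(LINT x|lborel. indicator {0<..} x *\<^sub>R f x) = B - A"
    using *(2) by (simp add: interval_lebesgue_integral_def set_lebesgue_integral_def e)
  finally show ?thesis .
qed

section \<open>Standard normal distribution function and antiderivatives\<close>

text \<open>Taken as the \<open>cdf\<close> of the normal law, so that both limits are instances of
  general facts and only the derivative remains to be proved.\<close>

definition std_normal_cdf :: "real \<Rightarrow> real" where
  "std_normal_cdf = cdf (density lborel std_normal_density)"

lemma real_distribution_std_normal: "real_distribution (density lborel std_normal_density)"
  by (intro real_distribution.intro prob_space_normal_density) (auto simp: real_distribution_axioms_def)

lemma std_normal_cdf_at_top: "(std_normal_cdf \<longlongrightarrow> 1) at_top"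
  unfolding std_normal_cdf_def
  by (rule real_distribution.cdf_lim_at_top_prob[OF real_distribution_std_normal])

lemma std_normal_cdf_at_bot: "(std_normal_cdf \<longlongrightarrow> 0) at_bot"
  unfolding std_normal_cdf_def
  by (rule finite_borel_measure.cdf_lim_at_bot)
     (rule real_distribution.finite_borel_measure_M[OF real_distribution_std_normal])

lemma continuous_std_normal_density: "continuous_on S std_normal_density"
  unfolding std_normal_density_def by (intro continuous_intros) auto

lemma std_normal_cdf_eq_integral:
  assumes "a \<le> v"
  shows "std_normal_cdf v = std_normal_cdf a + integral {a..v} std_normal_density"
proof -
  interpret real_distribution "density lborel std_normal_density"
    by (rule real_distribution_std_normal)
  have int: "set_integrable lborel {a<..v} std_normal_density"
    using integrable_normal_density[of 1 0] unfolding set_integrable_def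
    by (intro integrable_mult_indicator) auto
  show ?thesis
  proof (cases "a = v")
    case False
    then have "std_normal_cdf v - std_normal_cdf a = measure (density lborel std_normal_density) {a<..v}"
      unfolding std_normal_cdf_def using assms by (intro cdf_diff_eq) auto
    also have "\<dots> = enn2real (\<integral>\<^sup>+x. ennreal (indicator {a<..v} x *\<^sub>R std_normal_density x) \<partial>lborel)"
      unfolding measure_def
      by (subst emeasure_density) (auto intro!: arg_cong[of _ _ enn2real] nn_integral_cong simp: indicator_def)
    also have "\<dots> = (LINT x:{a<..v}|lborel. std_normal_density x)"
      using int unfolding set_integrable_def set_lebesgue_integral_def
      by (subst nn_integral_eq_integral) (auto intro!: integral_nonneg_AE)
    also have "\<dots> = integral {a<..v} std_normal_density"
      using int by (rule set_borel_integral_eq_integral)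
    also have "\<dots> = integral {a..v} std_normal_density"
      by (rule integral_spike_set; rule negligible_subset[of "{a}"]) auto
    finally show ?thesis by simp
  qed auto
qed

lemma DERIV_std_normal_cdf: "(std_normal_cdf has_real_derivative std_normal_density x) (at x)"
proof -
  have "((\<lambda>v. integral {x-1..v} std_normal_density) has_real_derivative std_normal_density x)
      (at x within {x-1..x+1})"
    by (rule integral_has_real_derivative) (auto intro: continuous_std_normal_density)
  then have "((\<lambda>v. std_normal_cdf (x-1) + integral {x-1..v} std_normal_density) has_real_derivative
      std_normal_density x) (at x within {x-1..x+1})"
    by (auto intro!: derivative_eq_intros)
  then have "(std_normal_cdf has_real_derivative std_normal_density x) (at x within {x-1..x+1})"
    by (rule has_field_derivative_transform_within[where d = 1])
       (auto simp: std_normal_cdf_eq_integral[of "x - 1", symmetric])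
  moreover have "at x within {x-1..x+1} = at x"
    by (rule at_within_interior) (simp add: interior_atLeastAtMost_real)
  ultimately show ?thesis by simp
qed

lemma DERIV_std_normal_cdf_chain [derivative_intros]:
  "(f has_real_derivative f') (at x within S) \<Longrightarrow>
   ((\<lambda>x. std_normal_cdf (f x)) has_real_derivative std_normal_density (f x) * f') (at x within S)"
  by (rule DERIV_chain2[OF DERIV_std_normal_cdf])

text \<open>The arguments have derivatives 1 / (2 r) plus or minus s / (2 r^3), with r the root of
  x, and the factor exp (2 s) makes both normal densities equal to the same \<open>g\<close>. The
  sum then keeps the first part and the difference the second.\<close>

lemma rig_antiderivatives:
  fixes s x :: real
  assumes "x > 0"
  shows "((\<lambda>x. std_normal_cdf (sqrt x - s / sqrt x) + exp (2 * s) * std_normal_cdf (sqrt x + s / sqrt x))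
      has_real_derivative rig_density s x) (at x)"
    and "((\<lambda>x. std_normal_cdf (sqrt x - s / sqrt x) - exp (2 * s) * std_normal_cdf (sqrt x + s / sqrt x))
      has_real_derivative s / x * rig_density s x) (at x)"
proof -
  define r where "r = sqrt x"
  have r: "r > 0" "x = r^2" using assms by (auto simp: r_def)
  define g where "g = exp (- (x - s)\<^sup>2 / (2 * x)) / sqrt (2 * pi)"
  have e1: "std_normal_density (sqrt x - s / sqrt x) = g"
    unfolding std_normal_density_def g_def r_def[symmetric] using r
    by (simp add: field_simps power2_eq_square)
  have e2: "exp (2 * s) * std_normal_density (sqrt x + s / sqrt x) = g"
  proof -
    \<comment> \<open>Equivalent to (r + s / r)^2 = (r - s / r)^2 + 4 s.\<close>
    have "2 * s + - (r + s / r)\<^sup>2 / 2 = - (r^2 - s)\<^sup>2 / (2 * r^2)"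
      using r by (simp add: field_simps power2_eq_square)
    then show ?thesis
      unfolding std_normal_density_def g_def r_def[symmetric] unfolding r(2)
      by (simp add: exp_add[symmetric])
  qed
  have q: "rig_density s x = g / r"
    using assms by (simp add: rig_density_def g_def r_def real_sqrt_mult)
  have d: "((\<lambda>x. sqrt x - s / sqrt x) has_real_derivative (1 / (2 * r) + s / (2 * r^3))) (at x)"
    "((\<lambda>x. sqrt x + s / sqrt x) has_real_derivative (1 / (2 * r) - s / (2 * r^3))) (at x)"
    using assms r
    by (auto intro!: derivative_eq_intros simp: r_def[symmetric] field_simps power2_eq_square power3_eq_cube)
  note D = DERIV_std_normal_cdf_chain[OF d(1), unfolded e1]
    DERIV_cmult[OF DERIV_std_normal_cdf_chain[OF d(2)], of "exp (2 * s)", unfolded mult.assoc[symmetric] e2]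
  have "g * (1 / (2 * r) + s / (2 * r^3)) + g * (1 / (2 * r) - s / (2 * r^3)) = rig_density s x"
    unfolding q by (simp add: algebra_simps)
  then show "((\<lambda>x. std_normal_cdf (sqrt x - s / sqrt x) + exp (2 * s) * std_normal_cdf (sqrt x + s / sqrt x))
      has_real_derivative rig_density s x) (at x)"
    using DERIV_add[OF D] by simp
  have "g * (1 / (2 * r) + s / (2 * r^3)) - g * (1 / (2 * r) - s / (2 * r^3)) = s / x * rig_density s x"
    unfolding q using r by (simp add: field_simps power3_eq_cube power2_eq_square)
  then show "((\<lambda>x. std_normal_cdf (sqrt x - s / sqrt x) - exp (2 * s) * std_normal_cdf (sqrt x + s / sqrt x))
      has_real_derivative s / x * rig_density s x) (at x)"
    using DERIV_diff[OF D] by simp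
qed

lemma isCont_rig_density: "x > 0 \<Longrightarrow> isCont (rig_density s) x"
proof -
  assume x: "x > 0"
  have "isCont (\<lambda>x. exp (- (x - s)\<^sup>2 / (2 * x)) / sqrt (2 * pi * x)) x"
    using x by (intro continuous_intros) auto
  moreover have "eventually (\<lambda>y. exp (- (y - s)\<^sup>2 / (2 * y)) / sqrt (2 * pi * y) = rig_density s y) (nhds x)"
    using eventually_nhds_in_open[of "{0<..}" x] x by (auto elim!: eventually_mono simp: rig_density_def)
  ultimately show ?thesis by (simp add: isCont_cong)
qed

text \<open>For s > 0 the term s / sqrt x drives the two arguments to opposite infinities at 0. For
  s = 0 this fails, and the total mass comes from the Gamma integral instead.\<close>

lemma rig_limits:
  fixes s :: real
  assumes "s > 0"
  shows "((\<lambda>x. std_normal_cdf (sqrt x - s / sqrt x)) \<longlongrightarrow> 0) (at_right 0)"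
    and "((\<lambda>x. std_normal_cdf (sqrt x + s / sqrt x)) \<longlongrightarrow> 1) (at_right 0)"
    and "((\<lambda>x. std_normal_cdf (sqrt x - s / sqrt x)) \<longlongrightarrow> 1) at_top"
    and "((\<lambda>x. std_normal_cdf (sqrt x + s / sqrt x)) \<longlongrightarrow> 1) at_top"
proof -
  have "filterlim (\<lambda>x. sqrt x - s / sqrt x) at_bot (at_right 0)"
    "filterlim (\<lambda>x. sqrt x + s / sqrt x) at_top (at_right 0)"
    "filterlim (\<lambda>x. sqrt x - s / sqrt x) at_top at_top"
    "filterlim (\<lambda>x. sqrt x + s / sqrt x) at_top at_top"
    using assms by real_asymp+
  then show "((\<lambda>x. std_normal_cdf (sqrt x - s / sqrt x)) \<longlongrightarrow> 0) (at_right 0)"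
    "((\<lambda>x. std_normal_cdf (sqrt x + s / sqrt x)) \<longlongrightarrow> 1) (at_right 0)"
    "((\<lambda>x. std_normal_cdf (sqrt x - s / sqrt x)) \<longlongrightarrow> 1) at_top"
    "((\<lambda>x. std_normal_cdf (sqrt x + s / sqrt x)) \<longlongrightarrow> 1) at_top"
    using filterlim_compose[OF std_normal_cdf_at_bot] filterlim_compose[OF std_normal_cdf_at_top]
    by auto
qed

lemma nn_integral_rig_density_over:
  assumes "s > 0"
  shows "(\<integral>\<^sup>+x. ennreal (s / x * rig_density s x) \<partial>lborel) = 1"
proof -
  \<comment> \<open>The terms with exp (2 s) agree at both ends and cancel, leaving 1.\<close>
  have "(\<integral>\<^sup>+x. ennreal (s / x * rig_density s x) * indicator {0<..} x \<partial>lborel) =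
      ennreal ((1 - exp (2 * s) * 1) - (0 - exp (2 * s) * 1))"
  proof (rule nn_integral_FTC_pos[OF rig_antiderivatives(2)])
    show "isCont (\<lambda>x. s / x * rig_density s x) x" if "x > 0" for x
      using that by (intro continuous_intros isCont_rig_density) auto
  qed (use assms in \<open>(simp; fail | intro tendsto_intros rig_limits)+\<close>)
  moreover have "(\<integral>\<^sup>+x. ennreal (s / x * rig_density s x) * indicator {0<..} x \<partial>lborel) =
      (\<integral>\<^sup>+x. ennreal (s / x * rig_density s x) \<partial>lborel)"
    by (intro nn_integral_cong) (auto simp: indicator_def rig_density_def)
  ultimately show ?thesis by simp
qed

section \<open>Negative moments and logarithmic mean of the pivot density\<close>

text \<open>Substituting x = 2 t turns the density for s = 0 into t^(-1/2) exp (- t) up to a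
  constant, so the moment is a Gamma integral, which converges for \<alpha> < 1/2. This is the
  origin of \<open>C_const\<close>.\<close>

lemma Gamma_integral_rig_density_zero:
  assumes "0 \<le> \<alpha>" "\<alpha> < 1/2"
  shows "(\<integral>\<^sup>+x. ennreal (x powr - \<alpha> * rig_density 0 x) \<partial>lborel) = ennreal (C_const \<alpha>)"
proof -
  have "(\<integral>\<^sup>+x. ennreal (x powr - \<alpha> * rig_density 0 x) \<partial>lborel) =
      2 * (\<integral>\<^sup>+x. ennreal ((2 * x) powr - \<alpha> * rig_density 0 (2 * x)) \<partial>lborel)"
    using nn_integral_real_affine[of "\<lambda>x. ennreal (x powr - \<alpha> * rig_density 0 x)" 2 0] by simp
  also have "\<dots> = (\<integral>\<^sup>+x. 2 * ennreal ((2 * x) powr - \<alpha> * rig_density 0 (2 * x)) \<partial>lborel)"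
    by (subst nn_integral_cmult) auto
  also have "\<dots> = (\<integral>\<^sup>+x. ennreal (2 powr - \<alpha> / sqrt pi) *
      ennreal (indicator {0..} x * x powr (1/2 - \<alpha> - 1) / exp x) \<partial>lborel)"
  proof (intro nn_integral_cong)
    fix x :: real
    consider "x < 0" | "x = 0" | "x > 0" by linarith
    then show "2 * ennreal ((2 * x) powr - \<alpha> * rig_density 0 (2 * x)) = ennreal (2 powr - \<alpha> / sqrt pi) *
      ennreal (indicator {0..} x * x powr (1/2 - \<alpha> - 1) / exp x)"
    proof cases
      case 3
      have p: "x powr (1/2 - \<alpha> - 1) = x powr - \<alpha> / sqrt x"
      proof -
        have "x powr (1/2 - \<alpha> - 1) = x powr (- \<alpha> + - (1/2))"
          by (rule arg_cong[of _ _ "\<lambda>c. x powr c"]) simp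
        also have "\<dots> = x powr - \<alpha> * x powr - (1/2)" by (rule powr_add)
        finally show ?thesis using 3 by (simp add: powr_minus_divide powr_half_sqrt)
      qed
      have "2 * ((2 * x) powr - \<alpha> * rig_density 0 (2 * x)) =
          (2 powr - \<alpha> / sqrt pi) * (x powr (1/2 - \<alpha> - 1) / exp x)"
        using 3 unfolding p
        by (simp add: rig_density_def powr_mult exp_minus real_sqrt_mult field_simps power2_eq_square)
      then show ?thesis using 3
        by (simp add: ennreal_mult'[symmetric] flip: ennreal_numeral)
    qed (auto simp: rig_density_def)
  qed
  also have "\<dots> = ennreal (2 powr - \<alpha> / sqrt pi) * ennreal (Gamma (1/2 - \<alpha>))"
    by (subst nn_integral_cmult) (use assms in \<open>auto simp: Gamma_conv_nn_integral_real\<close>)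
  also have "\<dots> = ennreal (C_const \<alpha>)"
    by (simp add: C_const_def ennreal_mult'[symmetric])
  finally show ?thesis .
qed

lemma C_const_zero: "C_const 0 = 1"
  by (simp add: C_const_def Gamma_one_half_real)

lemma nn_integral_rig_density:
  assumes "s \<ge> 0"
  shows "(\<integral>\<^sup>+x. ennreal (rig_density s x) \<partial>lborel) = 1"
proof (cases "s = 0")
  case True
  have "(\<integral>\<^sup>+x. ennreal (rig_density 0 x) \<partial>lborel) = (\<integral>\<^sup>+x. ennreal (x powr - 0 * rig_density 0 x) \<partial>lborel)"
    by (intro nn_integral_cong) (auto simp: rig_density_def)
  then show ?thesis
    using True Gamma_integral_rig_density_zero[of 0] by (simp add: C_const_zero)
next
  case False
  with assms have s: "s > 0" by simp
  have "(\<integral>\<^sup>+x. ennreal (rig_density s x) * indicator {0<..} x \<partial>lborel) =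
      ennreal ((1 + exp (2 * s) * 1) - (0 + exp (2 * s) * 1))"
    by (rule nn_integral_FTC_pos[OF rig_antiderivatives(1)])
       (use s in \<open>(simp add: isCont_rig_density; fail | intro tendsto_intros rig_limits)+\<close>)
  moreover have "(\<integral>\<^sup>+x. ennreal (rig_density s x) * indicator {0<..} x \<partial>lborel) =
      (\<integral>\<^sup>+x. ennreal (rig_density s x) \<partial>lborel)"
    by (intro nn_integral_cong) (auto simp: indicator_def rig_density_def)
  ultimately show ?thesis by simp
qed

text \<open>The densities with parameters s and 0 cross once, at x = s / 2, while x^(-\<alpha>) is
  nonincreasing with value \<open>c\<close> there; hence the product of the two differences is
  nonpositive. Both densities have mass 1, so the terms with \<open>c\<close> cancel after
  integration.\<close>

lemma rig_powr_bound:
  assumes "s > 0" "0 \<le> \<alpha>" "\<alpha> < 1/2"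
  shows "(\<integral>\<^sup>+x. ennreal (x powr - \<alpha> * rig_density s x) \<partial>lborel) \<le> ennreal (C_const \<alpha>)"
proof -
  define c where "c = (s / 2) powr - \<alpha>"
  have pt: "x powr - \<alpha> * rig_density s x + c * rig_density 0 x \<le>
      x powr - \<alpha> * rig_density 0 x + c * rig_density s x" for x
  proof (cases "x > 0")
    case True
    have mono: "rig_density t x \<le> rig_density u x" if "(x - u)\<^sup>2 \<le> (x - t)\<^sup>2" for t u
      unfolding rig_density_def using that True by (auto intro!: divide_right_mono)
    have "(x powr - \<alpha> - c) * (rig_density s x - rig_density 0 x) \<le> 0"
    proof (cases "x \<ge> s / 2")
      case T: True
      have "x powr - \<alpha> \<le> c" unfolding c_def using T assms by (intro powr_mono2') auto
      moreover have "s * (2 * x - s) \<ge> 0" using T assms by simp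
      then have "rig_density 0 x \<le> rig_density s x"
        by (intro mono) (simp add: power2_eq_square algebra_simps)
      ultimately show ?thesis by (intro mult_nonpos_nonneg) auto
    next
      case F: False
      have "x powr - \<alpha> \<ge> c" unfolding c_def using F assms True by (intro powr_mono2') auto
      moreover have "s * (s - 2 * x) \<ge> 0" using F assms by simp
      then have "rig_density 0 x \<ge> rig_density s x"
        by (intro mono) (simp add: power2_eq_square algebra_simps)
      ultimately show ?thesis by (intro mult_nonneg_nonpos) auto
    qed
    then show ?thesis by (simp add: algebra_simps)
  qed (simp add: rig_density_def)
  have c: "c \<ge> 0" by (simp add: c_def)
  have one: "(\<integral>\<^sup>+x. ennreal (c * rig_density t x) \<partial>lborel) = ennreal c" if "t \<ge> 0" for t
    using that by (simp add: ennreal_mult c nn_integral_cmult nn_integral_rig_density)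
  have "(\<integral>\<^sup>+x. ennreal (x powr - \<alpha> * rig_density s x) \<partial>lborel) + ennreal c =
     (\<integral>\<^sup>+x. ennreal (x powr - \<alpha> * rig_density s x + c * rig_density 0 x) \<partial>lborel)"
    using c by (simp add: ennreal_plus nn_integral_add one)
  also have "\<dots> \<le> (\<integral>\<^sup>+x. ennreal (x powr - \<alpha> * rig_density 0 x + c * rig_density s x) \<partial>lborel)"
    by (intro nn_integral_mono ennreal_leI pt)
  also have "\<dots> = ennreal (C_const \<alpha>) + ennreal c"
    using c assms by (simp add: ennreal_plus nn_integral_add one Gamma_integral_rig_density_zero)
  finally show ?thesis by (simp add: add.commute[of _ "ennreal c"] ennreal_add_left_cancel_le)
qed

text \<open>\<open>C_const\<close> is the moment of order -\<alpha> for s = 0, so its derivative at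
  0 is the mean of -ln X. The value uses that Digamma at 1/2 is minus Euler's constant minus 2 ln
  2.\<close>

lemma DERIV_C_const_zero: "(C_const has_real_derivative c2_const) (at 0)"
proof -
  have "((\<lambda>\<alpha>. 2 powr - \<alpha> * Gamma (1/2 - \<alpha>)) has_real_derivative
     (- ln 2) * Gamma (1/2) + (- (Gamma (1/2) * Digamma (1/2)))) (at 0)"
    by (auto intro!: derivative_eq_intros simp: field_simps)
  from DERIV_cdivide[OF this, of "sqrt pi"]
  have "(C_const has_real_derivative
     ((- ln 2) * Gamma (1/2) + (- (Gamma (1/2) * Digamma (1/2)))) / sqrt pi) (at 0)"
    unfolding C_const_def[abs_def] .
  also have "((- ln 2) * Gamma (1/2) + (- (Gamma (1/2) * Digamma (1/2)))) / sqrt pi = c2_const"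
    by (simp add: Gamma_one_half_real Digamma_one_half c2_const_def field_simps)
  finally show ?thesis .
qed

text \<open>-ln x is at most (x^(-\<alpha>) - 1) / \<alpha>, whose integral is bounded by the
  difference quotient of \<open>C_const\<close> at 0; letting \<alpha> tend to 0 gives
  \<open>c2_const\<close>. Positive and negative parts stand on different sides to avoid infinite
  differences, and the second claim supplies finiteness of the part on the left.\<close>

lemma rig_ln_bound:
  assumes "s > 0"
  shows "(\<integral>\<^sup>+x. ennreal (- ln x) * ennreal (rig_density s x) \<partial>lborel) \<le>
      ennreal c2_const + (\<integral>\<^sup>+x. ennreal (ln x) * ennreal (rig_density s x) \<partial>lborel)"
    and "(\<integral>\<^sup>+x. ennreal (- ln x) * ennreal (rig_density s x) \<partial>lborel) \<le> ennreal (4 * C_const (1/4))"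
proof -
  define P where "P = (\<integral>\<^sup>+x. ennreal (- ln x) * ennreal (rig_density s x) \<partial>lborel)"
  define N where "N = (\<integral>\<^sup>+x. ennreal (ln x) * ennreal (rig_density s x) \<partial>lborel)"
  have pt: "- ln x \<le> (x powr - \<alpha> - 1) / \<alpha>" if "x > 0" "\<alpha> > 0" for x \<alpha> :: real
  proof -
    have "ln (x powr - \<alpha>) \<le> x powr - \<alpha> - 1" using that by (intro ln_le_minus_one) simp
    then show ?thesis using that by (simp add: ln_powr field_simps)
  qed
  have PN: "P + ennreal (1 / \<alpha>) \<le> ennreal (C_const \<alpha> / \<alpha>) + N" if a: "0 < \<alpha>" "\<alpha> < 1/2" for \<alpha>
  proof -
    have "P + ennreal (1 / \<alpha>) =
       (\<integral>\<^sup>+x. ennreal (- ln x) * ennreal (rig_density s x) + ennreal (1 / \<alpha>) * ennreal (rig_density s x) \<partial>lborel)"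
      unfolding P_def using assms by (simp add: nn_integral_add nn_integral_cmult nn_integral_rig_density)
    also have "\<dots> \<le> (\<integral>\<^sup>+x. ennreal (1 / \<alpha>) * ennreal (x powr - \<alpha> * rig_density s x)
        + ennreal (ln x) * ennreal (rig_density s x) \<partial>lborel)"
    proof (intro nn_integral_mono)
      fix x :: real
      show "ennreal (- ln x) * ennreal (rig_density s x) + ennreal (1 / \<alpha>) * ennreal (rig_density s x) \<le>
        ennreal (1 / \<alpha>) * ennreal (x powr - \<alpha> * rig_density s x) + ennreal (ln x) * ennreal (rig_density s x)"
      proof (cases "x > 0")
        case True
        have "max 0 (- ln x) + 1 / \<alpha> \<le> x powr - \<alpha> / \<alpha> + max 0 (ln x)"
          using pt[OF True a(1)] a by (auto simp: max_def diff_divide_distrib)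
        then have "ennreal (max 0 (- ln x) + 1 / \<alpha>) * ennreal (rig_density s x) \<le>
            ennreal (x powr - \<alpha> / \<alpha> + max 0 (ln x)) * ennreal (rig_density s x)"
          by (intro mult_right_mono ennreal_leI) auto
        moreover have "ennreal (max 0 (- ln x)) = ennreal (- ln x)" "ennreal (max 0 (ln x)) = ennreal (ln x)"
          by (auto simp: max_def ennreal_neg)
        moreover have "ennreal (1 / \<alpha>) * ennreal (x powr - \<alpha> * rig_density s x) =
            ennreal (x powr - \<alpha> / \<alpha>) * ennreal (rig_density s x)"
          using a by (simp add: ennreal_mult'[symmetric])
        ultimately show ?thesis using a by (simp add: ennreal_plus distrib_right)
      qed (simp add: rig_density_def)
    qed
    also have "\<dots> = ennreal (1 / \<alpha>) * (\<integral>\<^sup>+x. ennreal (x powr - \<alpha> * rig_density s x) \<partial>lborel) + N"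
      unfolding N_def by (simp add: nn_integral_add nn_integral_cmult)
    also have "\<dots> \<le> ennreal (1 / \<alpha>) * ennreal (C_const \<alpha>) + N"
      using rig_powr_bound[OF assms, of \<alpha>] a by (intro add_right_mono mult_left_mono) auto
    finally show ?thesis using a by (simp add: ennreal_mult'[symmetric])
  qed
  \<comment> \<open>A fixed order strictly between 0 and 1/2 suffices for finiteness; 1/4 gives the
    factor 4.\<close>
  have "P \<le> (\<integral>\<^sup>+x. ennreal 4 * ennreal (x powr - (1/4) * rig_density s x) \<partial>lborel)"
    unfolding P_def
  proof (intro nn_integral_mono)
    fix x :: real
    show "ennreal (- ln x) * ennreal (rig_density s x) \<le> ennreal 4 * ennreal (x powr - (1/4) * rig_density s x)"
    proof (cases "x > 0")
      case True
      have "- ln x \<le> 4 * x powr - (1/4)" using pt[OF True, of "1/4"] by simp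
      then have "ennreal (- ln x) * ennreal (rig_density s x) \<le> ennreal (4 * x powr - (1/4)) * ennreal (rig_density s x)"
        by (intro mult_right_mono ennreal_leI) auto
      then show ?thesis by (simp add: ennreal_mult mult.assoc del: ennreal_numeral)
    qed (simp add: rig_density_def)
  qed
  also have "\<dots> = ennreal 4 * (\<integral>\<^sup>+x. ennreal (x powr - (1/4) * rig_density s x) \<partial>lborel)"
    by (rule nn_integral_cmult) auto
  also have "\<dots> \<le> ennreal 4 * ennreal (C_const (1/4))"
    by (intro mult_left_mono rig_powr_bound) (use assms in auto)
  finally have P4: "P \<le> ennreal (4 * C_const (1/4))"
    by (simp add: ennreal_mult' del: ennreal_numeral)
  then show "(\<integral>\<^sup>+x. ennreal (- ln x) * ennreal (rig_density s x) \<partial>lborel) \<le> ennreal (4 * C_const (1/4))"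
    by (simp add: P_def)
  have "P \<le> ennreal c2_const + N"
  proof (cases N)
    case (real n)
    obtain p where p: "P = ennreal p" "p \<ge> 0"
      using P4 by (cases P) (auto simp: top_unique)
    \<comment> \<open>Since \<open>C_const 0 = 1\<close>, moving 1 / \<alpha> to the right in
      \<open>PN\<close> produces the difference quotient at 0.\<close>
    have ev: "eventually (\<lambda>\<alpha>. p \<le> (C_const \<alpha> - C_const 0) / (\<alpha> - 0) + n) (at_right 0)"
      unfolding eventually_at_right_field
    proof (intro exI[of _ "1/2"] conjI allI impI)
      fix \<alpha> :: real assume a: "\<alpha> > 0" "\<alpha> < 1/2"
      have C: "C_const \<alpha> \<ge> 0" using a by (auto simp: C_const_def intro!: mult_nonneg_nonneg divide_nonneg_nonneg Gamma_real_nonneg)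
      have "ennreal (p + 1 / \<alpha>) \<le> ennreal (C_const \<alpha> / \<alpha> + n)"
        using PN[OF a] real p a C by (simp add: ennreal_plus)
      then have "p + 1 / \<alpha> \<le> C_const \<alpha> / \<alpha> + n"
        using real a C by (subst (asm) ennreal_le_iff) auto
      then show "p \<le> (C_const \<alpha> - C_const 0) / (\<alpha> - 0) + n"
        by (simp add: C_const_zero diff_divide_distrib)
    qed auto
    have "((\<lambda>\<alpha>. (C_const \<alpha> - C_const 0) / (\<alpha> - 0) + n) \<longlongrightarrow> c2_const + n) (at_right 0)"
      using DERIV_C_const_zero unfolding has_field_derivative_iff
      by (intro tendsto_intros) (rule tendsto_mono[OF at_le], auto)
    then have "p \<le> c2_const + n"
      by (rule tendsto_lowerbound[OF _ ev]) simp
    moreover have "c2_const \<ge> 0" by (simp add: c2_const_def euler_mascheroni_pos less_imp_le)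
    ultimately show ?thesis using real p by (simp add: ennreal_plus[symmetric] ennreal_leI del: ennreal_plus)
  qed simp
  then show "(\<integral>\<^sup>+x. ennreal (- ln x) * ennreal (rig_density s x) \<partial>lborel) \<le>
      ennreal c2_const + (\<integral>\<^sup>+x. ennreal (ln x) * ennreal (rig_density s x) \<partial>lborel)"
    by (simp add: P_def N_def)
qed

section \<open>Merging two independent edge weights\<close>

lemma ext_expectation_mono_AE:
  assumes "AE x in M. f x \<le> g x"
  shows "ext_expectation M f \<le> ext_expectation M g"
  unfolding ext_expectation_def
proof (rule ereal_minus_mono)
  show "enn2ereal (\<integral>\<^sup>+x. ennreal (f x) \<partial>M) \<le> enn2ereal (\<integral>\<^sup>+x. ennreal (g x) \<partial>M)"
    using assms by (simp flip: less_eq_ennreal.rep_eq) (auto intro!: nn_integral_mono_AE ennreal_leI elim!: eventually_mono)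
  show "enn2ereal (\<integral>\<^sup>+x. ennreal (- g x) \<partial>M) \<le> enn2ereal (\<integral>\<^sup>+x. ennreal (- f x) \<partial>M)"
    using assms by (simp flip: less_eq_ennreal.rep_eq) (auto intro!: nn_integral_mono_AE ennreal_leI elim!: eventually_mono)
qed

text \<open>Only an inequality, since infinity minus infinity counts as infinity: an infinite
  positive part makes the right-hand side infinite. Otherwise the balance of the six integrals
  decides, also if a negative part is infinite.\<close>

lemma ext_expectation_add_le:
  assumes [measurable]: "f \<in> borel_measurable M" "g \<in> borel_measurable M"
  shows "ext_expectation M (\<lambda>x. f x + g x) \<le> ext_expectation M f + ext_expectation M g"
proof -
  define A where "A = (\<integral>\<^sup>+x. ennreal (f x) \<partial>M)"
  define B where "B = (\<integral>\<^sup>+x. ennreal (- f x) \<partial>M)"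
  define C where "C = (\<integral>\<^sup>+x. ennreal (g x) \<partial>M)"
  define D where "D = (\<integral>\<^sup>+x. ennreal (- g x) \<partial>M)"
  define S where "S = (\<integral>\<^sup>+x. ennreal (f x + g x) \<partial>M)"
  define R where "R = (\<integral>\<^sup>+x. ennreal (- (f x + g x)) \<partial>M)"
  have pt: "ennreal (u + v) + (ennreal (- u) + ennreal (- v)) =
      ennreal (- (u + v)) + (ennreal u + ennreal v)" for u v :: real
  proof -
    have e: "ennreal w = ennreal (max 0 w)" for w by (auto simp: max_def ennreal_neg)
    show ?thesis
      unfolding e[of u] e[of v] e[of "- u"] e[of "- v"] e[of "u + v"] e[of "- (u + v)"]
      by (simp del: ennreal_max_0 ennreal_max_0' flip: ennreal_plus)
  qed
  \<comment> \<open>The pointwise identity between positive and negative parts, arranged without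
    subtraction, can be integrated whether or not the integrals are finite.\<close>
  have bal: "S + (B + D) = R + (A + C)"
    unfolding A_def B_def C_def D_def S_def R_def
    by (simp flip: nn_integral_add add: pt del: minus_add_distrib)
  have le1: "ennreal (u + v) \<le> ennreal u + ennreal v" for u v :: real
  proof -
    have e: "ennreal w = ennreal (max 0 w)" for w by (auto simp: max_def ennreal_neg)
    show ?thesis
      unfolding e[of u] e[of v] e[of "u + v"]
      by (simp del: ennreal_max_0 ennreal_max_0' flip: ennreal_plus)
  qed
  have SAC: "S \<le> A + C"
    unfolding A_def C_def S_def by (simp flip: nn_integral_add) (intro nn_integral_mono le1)
  have RBD: "R \<le> B + D"
  proof -
    have "R \<le> (\<integral>\<^sup>+x. ennreal (- f x) + ennreal (- g x) \<partial>M)"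
      unfolding R_def using le1 by (intro nn_integral_mono) (metis minus_add_distrib)
    then show ?thesis by (simp add: B_def D_def nn_integral_add)
  qed
  show ?thesis
  proof (cases "A = \<infinity> \<or> C = \<infinity>")
    case True
    then have *: "ext_expectation M f + ext_expectation M g = \<infinity>"
      unfolding ext_expectation_def A_def[symmetric] B_def[symmetric] C_def[symmetric] D_def[symmetric]
      by (auto simp: enn2ereal_top top_ereal_def infinity_ennreal_def)
    show ?thesis unfolding * by simp
  next
    case AC: False
    then have S: "S \<noteq> \<infinity>" using SAC by (auto simp: top_unique)
    show ?thesis
    proof (cases "B = \<infinity> \<or> D = \<infinity>")
      case True
      then have "S + (B + D) = \<infinity>" by auto
      then have "R = \<infinity>" using AC unfolding bal by auto
      then have "ext_expectation M (\<lambda>x. f x + g x) = - \<infinity>"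
        using S unfolding ext_expectation_def S_def[symmetric] R_def[symmetric]
        by (cases S) (auto simp: enn2ereal_top top_ereal_def infinity_ennreal_def)
      then show ?thesis by simp
    next
      case False
      then have "R \<noteq> \<infinity>" using RBD by (auto simp: top_unique)
      with AC S False obtain a b c d s r where *: "A = ennreal a" "a \<ge> 0" "B = ennreal b" "b \<ge> 0"
        "C = ennreal c" "c \<ge> 0" "D = ennreal d" "d \<ge> 0" "S = ennreal s" "s \<ge> 0" "R = ennreal r" "r \<ge> 0"
        by (metis ennreal_cases infinity_ennreal_def)
      have "s + (b + d) = r + (a + c)"
        using bal * by (simp flip: ennreal_plus)
      then show ?thesis
        unfolding ext_expectation_def S_def[symmetric] R_def[symmetric] A_def[symmetric]
          B_def[symmetric] C_def[symmetric] D_def[symmetric] using *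
        by (simp add: enn2ereal_ennreal)
    qed
  qed
qed

lemma ext_expectation_cmult:
  assumes [measurable]: "f \<in> borel_measurable M" and c: "c > 0"
  shows "ext_expectation M (\<lambda>x. c * f x) = ereal c * ext_expectation M f"
proof -
  have "ext_expectation M (\<lambda>x. c * f x) =
    enn2ereal (ennreal c * (\<integral>\<^sup>+x. ennreal (f x) \<partial>M)) - enn2ereal (ennreal c * (\<integral>\<^sup>+x. ennreal (- f x) \<partial>M))"
    unfolding ext_expectation_def using c
    by (subst (1 2) nn_integral_cmult[symmetric]) (auto simp flip: ennreal_mult')
  also have "\<dots> = ereal c * enn2ereal (\<integral>\<^sup>+x. ennreal (f x) \<partial>M) - ereal c * enn2ereal (\<integral>\<^sup>+x. ennreal (- f x) \<partial>M)"
    using c by (simp add: times_ennreal.rep_eq enn2ereal_ennreal)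
  also have "\<dots> = ereal c * ext_expectation M f"
  proof -
    have "ereal c * enn2ereal P - ereal c * enn2ereal N = ereal c * (enn2ereal P - enn2ereal N)" for P N
      using c by (cases P; cases N) (auto simp: right_diff_distrib top_ereal_def)
    then show ?thesis by (simp add: ext_expectation_def)
  qed
  finally show ?thesis .
qed

lemma ext_expectation_distr:
  assumes [measurable]: "X \<in> M \<rightarrow>\<^sub>M N" "f \<in> borel_measurable N"
  shows "ext_expectation (distr M N X) f = ext_expectation M (\<lambda>x. f (X x))"
  unfolding ext_expectation_def by (simp add: nn_integral_distr)

lemma (in prob_space) ext_expectation_const: "ext_expectation M (\<lambda>_. c) = ereal c"
  unfolding ext_expectation_def
  by (cases "c \<ge> 0") (auto simp: ennreal_neg emeasure_space_1 enn2ereal_ennreal zero_ennreal.rep_eq)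

section \<open>One merging step\<close>

abbreviation moment :: "real \<Rightarrow> real measure \<Rightarrow> ennreal" where
  "moment \<alpha> \<mu> \<equiv> \<integral>\<^sup>+y. ennreal (y powr \<alpha>) \<partial>\<mu>"

definition pos_law :: "real measure \<Rightarrow> bool" where
  "pos_law \<mu> \<longleftrightarrow> prob_space \<mu> \<and> sets \<mu> = sets borel \<and> (AE a in \<mu>. a > 0)"

text \<open>Joint law of the two half-edge weights and of the Schur complement at their common
  vertex; the weight after removal of the vertex is \<open>a * b / x\<close>.\<close>
definition split_law :: "real measure \<Rightarrow> (real \<times> real \<times> real) measure" where
  "split_law \<mu> = density (\<mu> \<Otimes>\<^sub>M (\<mu> \<Otimes>\<^sub>M lborel)) (\<lambda>(a, b, x). ennreal (rig_density (a + b) x))"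

definition merge_law :: "real measure \<Rightarrow> real measure" where
  "merge_law \<mu> = distr (split_law \<mu>) borel (\<lambda>(a, b, x). a * b / x)"

context
  fixes \<mu> :: "real measure"
  assumes pos_law: "pos_law \<mu>"
begin

interpretation prob_space \<mu>
  using pos_law by (simp add: pos_law_def)

lemma sets_pos_law [measurable_cong]: "sets \<mu> = sets borel"
  using pos_law by (simp add: pos_law_def)

lemma AE_pos_law: "AE a in \<mu>. a > 0"
  using pos_law by (simp add: pos_law_def)

lemma sets_split_law [measurable_cong]: "sets (split_law \<mu>) = sets (borel \<Otimes>\<^sub>M (borel \<Otimes>\<^sub>M borel))"
  unfolding split_law_def sets_density by (intro sets_pair_measure_cong sets_pos_law sets_lborel)

lemma nn_integral_split_law:
  assumes [measurable]: "f \<in> borel_measurable (borel \<Otimes>\<^sub>M (borel \<Otimes>\<^sub>M borel))"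
  shows "(\<integral>\<^sup>+z. f z \<partial>split_law \<mu>) =
    (\<integral>\<^sup>+a. \<integral>\<^sup>+b. \<integral>\<^sup>+x. f (a, b, x) * ennreal (rig_density (a + b) x) \<partial>lborel \<partial>\<mu> \<partial>\<mu>)"
proof -
  interpret P: pair_sigma_finite \<mu> lborel
    by unfold_locales
  have "(\<integral>\<^sup>+z. f z \<partial>split_law \<mu>) =
    (\<integral>\<^sup>+z. ennreal (rig_density (fst z + fst (snd z)) (snd (snd z))) * f z \<partial>(\<mu> \<Otimes>\<^sub>M (\<mu> \<Otimes>\<^sub>M lborel)))"
    unfolding split_law_def by (subst nn_integral_density) (auto simp: case_prod_beta)
  also have "\<dots> = (\<integral>\<^sup>+a. \<integral>\<^sup>+y. ennreal (rig_density (a + fst y) (snd y)) * f (a, y) \<partial>(\<mu> \<Otimes>\<^sub>M lborel) \<partial>\<mu>)"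
    by (subst P.P.nn_integral_fst[symmetric]) auto
  also have "\<dots> = (\<integral>\<^sup>+a. \<integral>\<^sup>+b. \<integral>\<^sup>+x. ennreal (rig_density (a + b) x) * f (a, b, x) \<partial>lborel \<partial>\<mu> \<partial>\<mu>)"
    by (intro nn_integral_cong) (subst lborel.nn_integral_fst[symmetric], auto)
  finally show ?thesis by (simp add: mult.commute)
qed

lemma nn_integral_merge_law:
  assumes [measurable]: "f \<in> borel_measurable borel"
  shows "(\<integral>\<^sup>+y. f y \<partial>merge_law \<mu>) =
    (\<integral>\<^sup>+a. \<integral>\<^sup>+b. \<integral>\<^sup>+x. f (a * b / x) * ennreal (rig_density (a + b) x) \<partial>lborel \<partial>\<mu> \<partial>\<mu>)"
proof -
  have "(\<integral>\<^sup>+y. f y \<partial>merge_law \<mu>) = (\<integral>\<^sup>+z. f (case z of (a, b, x) \<Rightarrow> a * b / x) \<partial>split_law \<mu>)"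
    unfolding merge_law_def by (rule nn_integral_distr) measurable
  also have "\<dots> = (\<integral>\<^sup>+a. \<integral>\<^sup>+b. \<integral>\<^sup>+x. f (case (a, b, x) of (a, b, x) \<Rightarrow> a * b / x)
      * ennreal (rig_density (a + b) x) \<partial>lborel \<partial>\<mu> \<partial>\<mu>)"
    by (rule nn_integral_split_law) measurable
  finally show ?thesis by simp
qed

lemma nn_integral_pair_mono:
  assumes "\<And>a b. a > 0 \<Longrightarrow> b > 0 \<Longrightarrow> f a b \<le> g a b"
  shows "(\<integral>\<^sup>+a. \<integral>\<^sup>+b. f a b \<partial>\<mu> \<partial>\<mu>) \<le> (\<integral>\<^sup>+a. \<integral>\<^sup>+b. g a b \<partial>\<mu> \<partial>\<mu>)"
proof (rule nn_integral_mono_AE)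
  show "AE a in \<mu>. (\<integral>\<^sup>+b. f a b \<partial>\<mu>) \<le> (\<integral>\<^sup>+b. g a b \<partial>\<mu>)"
    using AE_pos_law
  proof eventually_elim
    case (elim a)
    show ?case
      by (rule nn_integral_mono_AE) (use AE_pos_law assms elim in \<open>auto elim!: eventually_mono\<close>)
  qed
qed

lemma nn_integral_pair_cong:
  assumes "\<And>a b. a > 0 \<Longrightarrow> b > 0 \<Longrightarrow> f a b = g a b"
  shows "(\<integral>\<^sup>+a. \<integral>\<^sup>+b. f a b \<partial>\<mu> \<partial>\<mu>) = (\<integral>\<^sup>+a. \<integral>\<^sup>+b. g a b \<partial>\<mu> \<partial>\<mu>)"
  by (intro antisym nn_integral_pair_mono) (simp_all add: assms)

text \<open>The density in x has mass 1 for all positive a and b, so weighting by it does not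
  disturb the law of the two weights.\<close>

lemma nn_integral_split_law_fst:
  assumes [measurable]: "f \<in> borel_measurable borel"
  shows "(\<integral>\<^sup>+z. f (fst z) \<partial>split_law \<mu>) = (\<integral>\<^sup>+a. f a \<partial>\<mu>)"
proof -
  have "(\<integral>\<^sup>+z. f (fst z) \<partial>split_law \<mu>) = (\<integral>\<^sup>+a. \<integral>\<^sup>+b. f a \<partial>\<mu> \<partial>\<mu>)"
    by (subst nn_integral_split_law, measurable, rule nn_integral_pair_cong)
       (simp add: nn_integral_cmult nn_integral_rig_density)
  then show ?thesis by (simp add: emeasure_space_1)
qed

lemma nn_integral_split_law_fst_snd:
  assumes [measurable]: "f \<in> borel_measurable borel"
  shows "(\<integral>\<^sup>+z. f (fst (snd z)) \<partial>split_law \<mu>) = (\<integral>\<^sup>+a. f a \<partial>\<mu>)"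
proof -
  have "(\<integral>\<^sup>+z. f (fst (snd z)) \<partial>split_law \<mu>) = (\<integral>\<^sup>+a. \<integral>\<^sup>+b. f b \<partial>\<mu> \<partial>\<mu>)"
    by (subst nn_integral_split_law, measurable, rule nn_integral_pair_cong)
       (simp add: nn_integral_cmult nn_integral_rig_density)
  then show ?thesis by (simp add: emeasure_space_1)
qed

lemma prob_space_split_law: "prob_space (split_law \<mu>)"
proof
  have "emeasure (split_law \<mu>) (space (split_law \<mu>)) = (\<integral>\<^sup>+z. 1 \<partial>split_law \<mu>)" by simp
  also have "\<dots> = 1" using nn_integral_split_law_fst[of "\<lambda>_. 1"] by (simp add: emeasure_space_1)
  finally show "emeasure (split_law \<mu>) (space (split_law \<mu>)) = 1" .
qed

lemma AE_split_law: "AE z in split_law \<mu>. fst z > 0 \<and> fst (snd z) > 0 \<and> snd (snd z) > 0"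
proof -
  have "(\<integral>\<^sup>+z. indicator {z. \<not> (fst z > 0 \<and> fst (snd z) > 0 \<and> snd (snd z) > 0)} z \<partial>split_law \<mu>) =
    (\<integral>\<^sup>+a. \<integral>\<^sup>+b. (0::ennreal) \<partial>\<mu> \<partial>\<mu>)"
    by (subst nn_integral_split_law, measurable, rule nn_integral_pair_cong, rule nn_integral_zero')
       (auto simp: indicator_def rig_density_def)
  then have "(\<integral>\<^sup>+z. indicator {z. \<not> (fst z > 0 \<and> fst (snd z) > 0 \<and> snd (snd z) > 0)} z \<partial>split_law \<mu>) = 0"
    by simp
  then have "AE z in split_law \<mu>. indicator {z. \<not> (fst z > 0 \<and> fst (snd z) > 0 \<and> snd (snd z) > 0)} z = (0::ennreal)"
    by (rule nn_integral_0_iff_AE[THEN iffD1, rotated]) measurable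
  then show ?thesis by (auto elim!: eventually_mono simp: indicator_def split: if_splits)
qed

lemma pos_law_merge_law: "pos_law (merge_law \<mu>)"
  unfolding pos_law_def
proof (intro conjI)
  interpret S: prob_space "split_law \<mu>" by (rule prob_space_split_law)
  show "prob_space (merge_law \<mu>)"
    unfolding merge_law_def by (rule S.prob_space_distr) measurable
  show "sets (merge_law \<mu>) = sets borel" by (simp add: merge_law_def)
  show "AE a in merge_law \<mu>. a > 0"
    unfolding merge_law_def
    by (subst AE_distr_iff) (measurable, rule eventually_mono[OF AE_split_law], simp add: case_prod_beta)
qed

text \<open>Write a b / x as (a b / s) (s / x) with s = a + b. Concavity bounds (s / x)^\<alpha> by
  an affine function of s / x of mean 1; a b / s is at most half the geometric mean, and the power
  of the latter is at most the arithmetic mean of a^\<alpha> and b^\<alpha>.\<close>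

lemma powr_merge_law_le_first:
  assumes \<alpha>: "0 \<le> \<alpha>" "\<alpha> \<le> 1"
  shows "moment \<alpha> (merge_law \<mu>) \<le>
    ennreal (2 powr - \<alpha>) * moment \<alpha> \<mu>"
proof -
  define A where "A = moment \<alpha> \<mu>"
  \<comment> \<open>Half of 2^(-\<alpha>), one share for each of the summands a^\<alpha> and
    b^\<alpha>.\<close>
  define k where "k = 2 powr - \<alpha> / 2"
  have k: "k \<ge> 0" by (simp add: k_def)
  have "moment \<alpha> (merge_law \<mu>) \<le>
     (\<integral>\<^sup>+a. \<integral>\<^sup>+b. ennreal k * (ennreal (a powr \<alpha>) + ennreal (b powr \<alpha>)) \<partial>\<mu> \<partial>\<mu>)"
  proof (subst nn_integral_merge_law, measurable, rule nn_integral_pair_mono)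
    fix a b :: real assume ab: "a > 0" "b > 0"
    define s where "s = a + b"
    have s: "s > 0" using ab by (simp add: s_def)
    define h where "h = (a * b / s) powr \<alpha>"
    have "(a * b / s) powr \<alpha> \<le> (sqrt a * sqrt b / 2) powr \<alpha>"
    proof (rule powr_mono2)
      define p where "p = sqrt (a * b)"
      have "2 * p \<le> s"
        using ab sum_squares_bound[of "sqrt a" "sqrt b"] by (simp add: p_def s_def real_sqrt_mult)
      then have "2 * p * p \<le> s * p"
        using ab by (intro mult_right_mono) (auto simp: p_def)
      moreover have "a * b = p * p" using ab by (simp add: p_def)
      ultimately have "a * b / s \<le> p / 2" using s by (simp add: field_simps)
      then show "a * b / s \<le> sqrt a * sqrt b / 2" by (simp add: p_def real_sqrt_mult)
    qed (use \<alpha> ab s in auto)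
    also have "\<dots> = 2 powr - \<alpha> * (sqrt a powr \<alpha> * sqrt b powr \<alpha>)"
      using ab by (simp add: powr_divide powr_mult powr_minus_divide)
    also have "\<dots> \<le> 2 powr - \<alpha> * (((sqrt a powr \<alpha>)\<^sup>2 + (sqrt b powr \<alpha>)\<^sup>2) / 2)"
      using sum_squares_bound[of "sqrt a powr \<alpha>" "sqrt b powr \<alpha>"] by (intro mult_left_mono) auto
    also have "\<dots> = k * (a powr \<alpha> + b powr \<alpha>)"
      using ab by (simp add: k_def power2_eq_square flip: powr_mult)
    finally have h: "h \<le> k * (a powr \<alpha> + b powr \<alpha>)" by (simp add: h_def)
    have pt: "(a * b / x) powr \<alpha> \<le> h * (\<alpha> * (s / x) + (1 - \<alpha>))" if "x > 0" for x
    proof -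
      have "(a * b / x) powr \<alpha> = h * (s / x) powr \<alpha>"
        using ab s that by (simp add: h_def flip: powr_mult)
      \<comment> \<open>Young's inequality with second factor 1 is the tangent bound at 1 for a
        concave power.\<close>
      also have "(s / x) powr \<alpha> \<le> \<alpha> * (s / x) + (1 - \<alpha>)"
        using Youngs_inequality_0[of \<alpha> "1 - \<alpha>" "s / x" 1] \<alpha> s that by simp
      finally show ?thesis by (simp add: h_def mult_left_mono)
    qed
    have lin: "ennreal (u * p + v * q) = ennreal u * ennreal p + ennreal v * ennreal q"
      if "u \<ge> 0" "v \<ge> 0" "p \<ge> 0" "q \<ge> 0" for u v p q :: real
      using that by (simp add: ennreal_plus ennreal_mult')
    have "(\<integral>\<^sup>+x. ennreal ((a * b / x) powr \<alpha>) * ennreal (rig_density (a + b) x) \<partial>lborel) \<le>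
      (\<integral>\<^sup>+x. ennreal (h * \<alpha>) * ennreal (s / x * rig_density s x)
        + ennreal (h * (1 - \<alpha>)) * ennreal (rig_density s x) \<partial>lborel)"
    proof (intro nn_integral_mono)
      fix x :: real
      show "ennreal ((a * b / x) powr \<alpha>) * ennreal (rig_density (a + b) x) \<le>
        ennreal (h * \<alpha>) * ennreal (s / x * rig_density s x) + ennreal (h * (1 - \<alpha>)) * ennreal (rig_density s x)"
      proof (cases "x > 0")
        case True
        have "ennreal ((a * b / x) powr \<alpha> * rig_density (a + b) x) \<le>
          ennreal (h * (\<alpha> * (s / x) + (1 - \<alpha>)) * rig_density s x)"
          using pt[OF True] by (intro ennreal_leI) (simp add: s_def mult_right_mono)
        also have "h * (\<alpha> * (s / x) + (1 - \<alpha>)) * rig_density s x =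
          (h * \<alpha>) * (s / x * rig_density s x) + (h * (1 - \<alpha>)) * rig_density s x"
          by (simp add: algebra_simps)
        also have "ennreal \<dots> = ennreal (h * \<alpha>) * ennreal (s / x * rig_density s x)
            + ennreal (h * (1 - \<alpha>)) * ennreal (rig_density s x)"
          by (rule lin) (use \<alpha> s True in \<open>auto simp: h_def\<close>)
        finally show ?thesis by (simp add: ennreal_mult')
      qed (simp add: rig_density_def)
    qed
    also have "\<dots> = ennreal (h * \<alpha>) + ennreal (h * (1 - \<alpha>))"
      using s by (simp add: nn_integral_add nn_integral_cmult nn_integral_rig_density nn_integral_rig_density_over
          del: times_divide_eq_left)
    also have "\<dots> = ennreal h"
    proof -
      have "h * \<alpha> + h * (1 - \<alpha>) = h" by (simp add: algebra_simps)
      then show ?thesis using \<alpha> by (subst ennreal_plus[symmetric]) (auto simp: h_def)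
    qed
    also have "\<dots> \<le> ennreal (k * (a powr \<alpha> + b powr \<alpha>))" using h by (rule ennreal_leI)
    finally show "(\<integral>\<^sup>+x. ennreal ((a * b / x) powr \<alpha>) * ennreal (rig_density (a + b) x) \<partial>lborel) \<le>
      ennreal k * (ennreal (a powr \<alpha>) + ennreal (b powr \<alpha>))"
      using k by (simp add: ennreal_mult' ennreal_plus)
  qed
  also have "\<dots> = ennreal k * (A + A)"
    unfolding A_def by (simp add: nn_integral_cmult nn_integral_add emeasure_space_1)
  also have "\<dots> = ennreal (2 powr - \<alpha>) * A"
  proof -
    have "ennreal k * (A + A) = ennreal k * ennreal 2 * A" by (simp add: mult.assoc mult_2)
    also have "ennreal k * ennreal 2 = ennreal (2 powr - \<alpha>)"
      by (subst ennreal_mult'[symmetric]) (simp_all add: k_def)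
    finally show ?thesis .
  qed
  finally show ?thesis by (simp add: A_def)
qed

text \<open>The bound on the moment of order -\<alpha> of X is uniform in a + b, so the integral
  over the two independent weights factorizes into a square.\<close>

lemma powr_merge_law_le_second:
  assumes \<alpha>: "0 \<le> \<alpha>" "\<alpha> < 1/2"
  shows "moment \<alpha> (merge_law \<mu>) \<le>
    ennreal (C_const \<alpha>) * (moment \<alpha> \<mu>)\<^sup>2"
proof -
  define A where "A = moment \<alpha> \<mu>"
  have "moment \<alpha> (merge_law \<mu>) \<le>
     (\<integral>\<^sup>+a. \<integral>\<^sup>+b. ennreal (C_const \<alpha>) * ennreal (a powr \<alpha>) * ennreal (b powr \<alpha>) \<partial>\<mu> \<partial>\<mu>)"
  proof (subst nn_integral_merge_law, measurable, rule nn_integral_pair_mono)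
    fix a b :: real assume ab: "a > 0" "b > 0"
    have "(\<integral>\<^sup>+x. ennreal ((a * b / x) powr \<alpha>) * ennreal (rig_density (a + b) x) \<partial>lborel) =
      (\<integral>\<^sup>+x. ennreal ((a * b) powr \<alpha>) * ennreal (x powr - \<alpha> * rig_density (a + b) x) \<partial>lborel)"
    proof (intro nn_integral_cong)
      fix x :: real
      show "ennreal ((a * b / x) powr \<alpha>) * ennreal (rig_density (a + b) x) =
        ennreal ((a * b) powr \<alpha>) * ennreal (x powr - \<alpha> * rig_density (a + b) x)"
        using ab
        by (cases "x > 0") (simp_all add: rig_density_def powr_divide powr_minus_divide flip: ennreal_mult')
    qed
    also have "\<dots> = ennreal ((a * b) powr \<alpha>) * (\<integral>\<^sup>+x. ennreal (x powr - \<alpha> * rig_density (a + b) x) \<partial>lborel)"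
      by (rule nn_integral_cmult) simp
    also have "\<dots> \<le> ennreal ((a * b) powr \<alpha>) * ennreal (C_const \<alpha>)"
      using ab \<alpha> by (intro mult_left_mono rig_powr_bound) auto
    also have "\<dots> = ennreal (C_const \<alpha>) * ennreal (a powr \<alpha>) * ennreal (b powr \<alpha>)"
      using ab by (simp add: powr_mult ennreal_mult mult_ac)
    finally show "(\<integral>\<^sup>+x. ennreal ((a * b / x) powr \<alpha>) * ennreal (rig_density (a + b) x) \<partial>lborel) \<le> \<dots>" .
  qed
  also have "\<dots> = ennreal (C_const \<alpha>) * A * A"
    unfolding A_def by (simp add: nn_integral_cmult nn_integral_multc)
  finally show ?thesis by (simp add: A_def power2_eq_square mult.assoc)
qed

text \<open>\<open>rig_ln_bound\<close> holds uniformly in the weights and can be integrated over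
  them. Its second claim makes \<open>P\<close> finite, so that the difference of \<open>P\<close>
  and \<open>N\<close> can be formed.\<close>

lemma ext_expectation_split_law_ln_le: "ext_expectation (split_law \<mu>) (\<lambda>z. - ln (snd (snd z))) \<le> ereal c2_const"
proof -
  define P where "P = (\<integral>\<^sup>+z. ennreal (- ln (snd (snd z))) \<partial>split_law \<mu>)"
  define N where "N = (\<integral>\<^sup>+z. ennreal (ln (snd (snd z))) \<partial>split_law \<mu>)"
  have P: "P = (\<integral>\<^sup>+a. \<integral>\<^sup>+b. \<integral>\<^sup>+x. ennreal (- ln x) * ennreal (rig_density (a + b) x) \<partial>lborel \<partial>\<mu> \<partial>\<mu>)"
    unfolding P_def by (subst nn_integral_split_law) auto
  have N: "N = (\<integral>\<^sup>+a. \<integral>\<^sup>+b. \<integral>\<^sup>+x. ennreal (ln x) * ennreal (rig_density (a + b) x) \<partial>lborel \<partial>\<mu> \<partial>\<mu>)"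
    unfolding N_def by (subst nn_integral_split_law) auto
  have "P \<le> (\<integral>\<^sup>+a. \<integral>\<^sup>+b. ennreal c2_const + (\<integral>\<^sup>+x. ennreal (ln x) * ennreal (rig_density (a + b) x) \<partial>lborel) \<partial>\<mu> \<partial>\<mu>)"
    unfolding P by (intro nn_integral_pair_mono rig_ln_bound) simp
  also have "\<dots> = ennreal c2_const + N"
    unfolding N by (simp add: nn_integral_add emeasure_space_1)
  finally have PN: "P \<le> ennreal c2_const + N" .
  have "P \<le> (\<integral>\<^sup>+a. \<integral>\<^sup>+b. ennreal (4 * C_const (1/4)) \<partial>\<mu> \<partial>\<mu>)"
    unfolding P by (intro nn_integral_pair_mono rig_ln_bound) simp
  also have "\<dots> = ennreal (4 * C_const (1/4))" by (simp add: emeasure_space_1)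
  finally obtain p where p: "P = ennreal p" "p \<ge> 0" by (cases P) (auto simp: top_unique)
  have c2: "c2_const \<ge> 0" by (simp add: c2_const_def euler_mascheroni_pos less_imp_le)
  have "enn2ereal P - enn2ereal N \<le> ereal c2_const"
  proof (cases N)
    case (real n)
    then have "p \<le> c2_const + n" using PN p c2 by (simp flip: ennreal_plus)
    then show ?thesis using real p by (simp add: enn2ereal_ennreal)
  qed (use p in \<open>simp add: enn2ereal_ennreal enn2ereal_top top_ereal_def\<close>)
  then show ?thesis by (simp add: ext_expectation_def P_def N_def)
qed

lemma ext_expectation_merge_law_ln:
  "ext_expectation (merge_law \<mu>) ln =
    ext_expectation (split_law \<mu>) (\<lambda>z. ln (fst z * fst (snd z) / snd (snd z)))"
  unfolding merge_law_def by (subst ext_expectation_distr) (auto simp: case_prod_beta)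

lemma ext_expectation_split_law_fst:
  "ext_expectation (split_law \<mu>) (\<lambda>z. ln (fst z)) = ext_expectation \<mu> ln"
  unfolding ext_expectation_def
  by (subst (1 2) nn_integral_split_law_fst[symmetric]) auto

lemma ext_expectation_split_law_fst_snd:
  "ext_expectation (split_law \<mu>) (\<lambda>z. ln (fst (snd z))) = ext_expectation \<mu> ln"
  unfolding ext_expectation_def
  by (subst (1 2) nn_integral_split_law_fst_snd[symmetric]) auto

text \<open>With t = s / x one has ln (a b / x) = ln (a b / s) + ln t. Here ln t is at most t - 1,
  of mean 0, and the first term is at most the average of ln a and ln b minus ln 2.\<close>

lemma ln_merge_law_le_first:
  "ext_expectation (merge_law \<mu>) ln \<le> ext_expectation \<mu> ln - ereal (ln 2)"
proof -
  let ?S = "split_law \<mu>"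
  interpret S: prob_space ?S by (rule prob_space_split_law)
  define g where "g z = (fst z + fst (snd z)) / snd (snd z)" for z :: "real \<times> real \<times> real"
  have [measurable]: "g \<in> borel_measurable (borel \<Otimes>\<^sub>M (borel \<Otimes>\<^sub>M borel))"
    unfolding g_def[abs_def] by measurable
  have g1: "ext_expectation ?S g = 1"
  proof -
    have "(\<integral>\<^sup>+z. ennreal (g z) \<partial>?S) = (\<integral>\<^sup>+a. \<integral>\<^sup>+b. 1 \<partial>\<mu> \<partial>\<mu>)"
    proof (subst nn_integral_split_law, measurable, rule nn_integral_pair_cong)
      fix a b :: real assume ab: "a > 0" "b > 0"
      have "(\<integral>\<^sup>+x. ennreal (g (a, b, x)) * ennreal (rig_density (a + b) x) \<partial>lborel) =
        (\<integral>\<^sup>+x. ennreal ((a + b) / x * rig_density (a + b) x) \<partial>lborel)"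
        by (intro nn_integral_cong) (simp add: g_def flip: ennreal_mult'')
      then show "(\<integral>\<^sup>+x. ennreal (g (a, b, x)) * ennreal (rig_density (a + b) x) \<partial>lborel) = 1"
        using ab nn_integral_rig_density_over[of "a + b"] by simp
    qed
    moreover have "(\<integral>\<^sup>+z. ennreal (- g z) \<partial>?S) = 0"
      by (rule nn_integral_zero', rule eventually_mono[OF AE_split_law]) (auto simp: g_def intro!: ennreal_neg)
    ultimately show ?thesis
      by (simp add: ext_expectation_def emeasure_space_1 one_ennreal.rep_eq zero_ennreal.rep_eq)
  qed
  have "ext_expectation (merge_law \<mu>) ln \<le>
    ext_expectation ?S (\<lambda>z. 1/2 * ln (fst z) + (1/2 * ln (fst (snd z)) + (g z + (- 1 - ln 2))))"
    unfolding ext_expectation_merge_law_ln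
  proof (rule ext_expectation_mono_AE)
    show "AE z in ?S. ln (fst z * fst (snd z) / snd (snd z)) \<le>
      1/2 * ln (fst z) + (1/2 * ln (fst (snd z)) + (g z + (- 1 - ln 2)))"
      using AE_split_law
    proof eventually_elim
      case (elim z)
      obtain a b x where z: "z = (a, b, x)" by (cases z) auto
      have ab: "a > 0" "b > 0" "x > 0" using elim by (auto simp: z)
      define t where "t = (a + b) / x"
      have "ln t \<le> t - 1" using ab by (intro ln_le_minus_one) (auto simp: t_def)
      moreover have "ln (a * b / x) = ln (a * b) - ln (a + b) + ln t"
        using ab by (simp add: ln_div t_def)
      moreover have "ln (2 * sqrt (a * b)) \<le> ln (a + b)"
      proof (subst ln_le_cancel_iff)
        show "2 * sqrt (a * b) \<le> a + b"
          using ab sum_squares_bound[of "sqrt a" "sqrt b"] by (simp add: real_sqrt_mult)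
      qed (use ab in auto)
      moreover have "ln (2 * sqrt (a * b)) = ln 2 + (ln a + ln b) / 2"
        using ab by (simp add: ln_mult ln_sqrt)
      moreover have "ln (a * b) = ln a + ln b" using ab by (simp add: ln_mult)
      ultimately have "ln (a * b / x) \<le> 1/2 * ln a + (1/2 * ln b + (t + (- 1 - ln 2)))"
        by argo
      then show ?case by (simp add: z g_def t_def)
    qed
  qed
  also have "\<dots> \<le> ext_expectation ?S (\<lambda>z. 1/2 * ln (fst z)) + (ext_expectation ?S (\<lambda>z. 1/2 * ln (fst (snd z)))
      + (ext_expectation ?S g + ext_expectation ?S (\<lambda>z. - 1 - ln 2)))"
    by (intro order_trans[OF ext_expectation_add_le] add_left_mono order_refl; measurable)
  also have "\<dots> = ereal (1/2) * ext_expectation \<mu> ln + (ereal (1/2) * ext_expectation \<mu> ln + (1 + ereal (- 1 - ln 2)))"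
    by (subst (1 2) ext_expectation_cmult)
       (auto simp: ext_expectation_split_law_fst ext_expectation_split_law_fst_snd g1 S.ext_expectation_const)
  \<comment> \<open>The mean 1 of \<open>g\<close> cancels the summand -1.\<close>
  also have "\<dots> = ext_expectation \<mu> ln - ereal (ln 2)"
    by (cases "ext_expectation \<mu> ln") (auto simp: one_ereal_def)
  finally show ?thesis .
qed

text \<open>ln (a b / x) is the sum of ln a, ln b and -ln x, the last of mean at most
  \<open>c2_const\<close>. Adding the constant on both sides turns the affine recursion into
  doubling.\<close>

lemma ln_merge_law_le_second:
  "ext_expectation (merge_law \<mu>) ln + ereal c2_const \<le> 2 * (ext_expectation \<mu> ln + ereal c2_const)"
proof -
  let ?S = "split_law \<mu>"
  have "ext_expectation (merge_law \<mu>) ln \<le>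
    ext_expectation ?S (\<lambda>z. ln (fst z) + (ln (fst (snd z)) + - ln (snd (snd z))))"
    unfolding ext_expectation_merge_law_ln
    by (rule ext_expectation_mono_AE)
       (rule eventually_mono[OF AE_split_law], auto simp: ln_div ln_mult)
  also have "\<dots> \<le> ext_expectation ?S (\<lambda>z. ln (fst z)) + (ext_expectation ?S (\<lambda>z. ln (fst (snd z)))
      + ext_expectation ?S (\<lambda>z. - ln (snd (snd z))))"
    by (intro order_trans[OF ext_expectation_add_le] add_left_mono order_refl; measurable)
  also have "\<dots> \<le> ext_expectation \<mu> ln + (ext_expectation \<mu> ln + ereal c2_const)"
    unfolding ext_expectation_split_law_fst ext_expectation_split_law_fst_snd
    by (intro add_left_mono ext_expectation_split_law_ln_le)
  finally have "ext_expectation (merge_law \<mu>) ln + ereal c2_const \<le>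
      ext_expectation \<mu> ln + (ext_expectation \<mu> ln + ereal c2_const) + ereal c2_const"
    by (rule add_right_mono)
  also have "\<dots> = 2 * (ext_expectation \<mu> ln + ereal c2_const)"
    by (cases "ext_expectation \<mu> ln") auto
  finally show ?thesis .
qed

end

section \<open>Iterated merging\<close>

lemma C_const_pos: "\<alpha> < 1/2 \<Longrightarrow> C_const \<alpha> > 0"
  by (simp add: C_const_def Gamma_real_pos)

lemma pos_law_iterate: "pos_law \<mu> \<Longrightarrow> pos_law ((merge_law ^^ n) \<mu>)"
  by (induction n) (simp_all add: pos_law_merge_law)

lemma powr_iterate_le_first:
  assumes "pos_law \<mu>" "0 \<le> \<alpha>" "\<alpha> \<le> 1"
  shows "moment \<alpha> ((merge_law ^^ n) \<mu>) \<le>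
    ennreal ((2 powr - \<alpha>) ^ n) * moment \<alpha> \<mu>"
proof (induction n)
  case (Suc n)
  have "moment \<alpha> ((merge_law ^^ Suc n) \<mu>) \<le>
     ennreal (2 powr - \<alpha>) * moment \<alpha> ((merge_law ^^ n) \<mu>)"
    using powr_merge_law_le_first[OF pos_law_iterate[OF assms(1)] assms(2,3)] by simp
  also have "\<dots> \<le> ennreal (2 powr - \<alpha>) * (ennreal ((2 powr - \<alpha>) ^ n) * moment \<alpha> \<mu>)"
    by (intro mult_left_mono Suc) auto
  finally show ?case by (simp add: ennreal_mult' mult.assoc)
qed simp

text \<open>The factor \<open>C_const\<close> turns the recursion from A to C A^2 into plain
  squaring.\<close>

lemma powr_iterate_le_second:
  assumes "pos_law \<mu>" "0 \<le> \<alpha>" "\<alpha> < 1/2"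
  shows "ennreal (C_const \<alpha>) * moment \<alpha> ((merge_law ^^ n) \<mu>) \<le>
    (ennreal (C_const \<alpha>) * moment \<alpha> \<mu>) ^ (2 ^ n)"
proof (induction n)
  case (Suc n)
  let ?A = "\<integral>\<^sup>+y. ennreal (y powr \<alpha>) \<partial>(merge_law ^^ n) \<mu>"
  have "ennreal (C_const \<alpha>) * moment \<alpha> ((merge_law ^^ Suc n) \<mu>) \<le>
     ennreal (C_const \<alpha>) * (ennreal (C_const \<alpha>) * ?A\<^sup>2)"
    using powr_merge_law_le_second[OF pos_law_iterate[OF assms(1)] assms(2,3)]
    by (intro mult_left_mono) auto
  also have "\<dots> = (ennreal (C_const \<alpha>) * ?A)\<^sup>2"
    by (simp add: power2_eq_square mult_ac)
  also have "\<dots> \<le> ((ennreal (C_const \<alpha>) * moment \<alpha> \<mu>) ^ (2 ^ n))\<^sup>2"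
    by (intro power_mono Suc) auto
  finally show ?case by (simp add: power_mult[symmetric] mult.commute)
qed simp

lemma powr_iterate_le_pow_bound:
  assumes "pos_law \<mu>" "0 \<le> \<alpha>" "\<alpha> < 1/2" "l \<le> m" "m \<le> r"
  shows "moment \<alpha> ((merge_law ^^ (r - l)) \<mu>) \<le>
    pow_bound \<alpha> (moment \<alpha> \<mu>) l r m"
proof -
  let ?C = "C_const \<alpha>" and ?\<nu> = "(merge_law ^^ (r - m)) \<mu>"
  have C: "?C > 0" using assms by (intro C_const_pos)
  have "r - l = (m - l) + (r - m)" using assms by simp
  then have it: "(merge_law ^^ (r - l)) \<mu> = (merge_law ^^ (m - l)) ?\<nu>"
    by (simp only: funpow_add comp_apply)
  have "moment \<alpha> ((merge_law ^^ (r - l)) \<mu>) =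
      ennreal (1 / ?C) * (ennreal ?C * moment \<alpha> ((merge_law ^^ (m - l)) ?\<nu>))"
    using C by (simp add: it mult.assoc[symmetric] flip: ennreal_mult')
  also have "\<dots> \<le> ennreal (1 / ?C) * (ennreal ?C * (\<integral>\<^sup>+y. ennreal (y powr \<alpha>) \<partial>?\<nu>)) ^ (2 ^ (m - l))"
    by (intro mult_left_mono powr_iterate_le_second pos_law_iterate assms) auto
  also have "\<dots> \<le> ennreal (1 / ?C) * (ennreal ?C * (ennreal ((2 powr - \<alpha>) ^ (r - m)) *
      moment \<alpha> \<mu>)) ^ (2 ^ (m - l))"
    using assms by (intro mult_left_mono power_mono powr_iterate_le_first) auto
  also have "\<dots> = pow_bound \<alpha> (moment \<alpha> \<mu>) l r m"
    using C by (simp add: pow_bound_def ennreal_mult' mult.assoc)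
  finally show ?thesis .
qed

lemma ln_iterate_le_first:
  assumes "pos_law \<mu>"
  shows "ext_expectation ((merge_law ^^ n) \<mu>) ln \<le> ext_expectation \<mu> ln - ereal (real n * ln 2)"
proof (induction n)
  case (Suc n)
  have "ext_expectation ((merge_law ^^ Suc n) \<mu>) ln \<le> ext_expectation ((merge_law ^^ n) \<mu>) ln - ereal (ln 2)"
    using ln_merge_law_le_first[OF pos_law_iterate[OF assms]] by simp
  also have "\<dots> \<le> (ext_expectation \<mu> ln - ereal (real n * ln 2)) - ereal (ln 2)"
    by (intro ereal_minus_mono Suc order_refl)
  also have "\<dots> = ext_expectation \<mu> ln - ereal (real (Suc n) * ln 2)"
    by (cases "ext_expectation \<mu> ln") (auto simp: algebra_simps)
  finally show ?case .
qed (simp add: zero_ereal_def[symmetric])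

lemma ln_iterate_le_second:
  assumes "pos_law \<mu>"
  shows "ext_expectation ((merge_law ^^ n) \<mu>) ln + ereal c2_const \<le>
    ereal (2 ^ n) * (ext_expectation \<mu> ln + ereal c2_const)"
proof (induction n)
  case (Suc n)
  have "ext_expectation ((merge_law ^^ Suc n) \<mu>) ln + ereal c2_const \<le>
      2 * (ext_expectation ((merge_law ^^ n) \<mu>) ln + ereal c2_const)"
    using ln_merge_law_le_second[OF pos_law_iterate[OF assms]] by simp
  also have "\<dots> \<le> 2 * (ereal (2 ^ n) * (ext_expectation \<mu> ln + ereal c2_const))"
    by (intro ereal_mult_left_mono Suc) auto
  also have "\<dots> = ereal (2 ^ Suc n) * (ext_expectation \<mu> ln + ereal c2_const)"
    by (cases "ext_expectation \<mu> ln") auto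
  finally show ?case .
qed (simp add: one_ereal_def[symmetric])

lemma ln_iterate_le_log_bound:
  assumes "pos_law \<mu>" "l \<le> m" "m \<le> r"
  shows "ext_expectation ((merge_law ^^ (r - l)) \<mu>) ln \<le> log_bound (ext_expectation \<mu> ln) l r m"
proof -
  let ?\<nu> = "(merge_law ^^ (r - m)) \<mu>"
  have "r - l = (m - l) + (r - m)" using assms by simp
  then have it: "(merge_law ^^ (r - l)) \<mu> = (merge_law ^^ (m - l)) ?\<nu>"
    by (simp only: funpow_add comp_apply)
  have "ext_expectation ((merge_law ^^ (r - l)) \<mu>) ln =
      ext_expectation ((merge_law ^^ (r - l)) \<mu>) ln + ereal c2_const - ereal c2_const"
    by (cases "ext_expectation ((merge_law ^^ (r - l)) \<mu>) ln") auto
  also have "\<dots> \<le> ereal (2 ^ (m - l)) * (ext_expectation ?\<nu> ln + ereal c2_const) - ereal c2_const"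
    unfolding it by (intro ereal_minus_mono ln_iterate_le_second pos_law_iterate assms order_refl)
  also have "\<dots> \<le> ereal (2 ^ (m - l)) *
      (ext_expectation \<mu> ln - ereal (real (r - m) * ln 2) + ereal c2_const) - ereal c2_const"
    by (intro ereal_minus_mono order_refl ereal_mult_left_mono add_right_mono ln_iterate_le_first assms) auto
  finally show ?thesis by (simp add: log_bound_def)
qed

section \<open>Location of the minimizers\<close>

text \<open>The disjunctions say that x is m0 clamped to the range from l to r, so the cases of m0
  inside, below and above the range are treated together. From x the monotonicity of
  \<open>h\<close> on either side carries over to every m.\<close>

lemma clamped_minimizer:
  fixes h :: "nat \<Rightarrow> real" and m\<^sub>0 :: int
  assumes up: "\<And>m. l \<le> m \<Longrightarrow> m < r \<Longrightarrow> m\<^sub>0 \<le> int m \<Longrightarrow> h m \<le> h (Suc m)"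
    and down: "\<And>m. l \<le> m \<Longrightarrow> m < r \<Longrightarrow> int m < m\<^sub>0 \<Longrightarrow> h (Suc m) \<le> h m"
    and x: "l \<le> x" "x \<le> r" "x = l \<or> int x \<le> m\<^sub>0" "x = r \<or> m\<^sub>0 \<le> int x"
    and m: "l \<le> m" "m \<le> r"
  shows "h x \<le> h m"
proof (cases "x \<le> m")
  case True
  then show ?thesis using m(2)
  proof (induction m rule: dec_induct)
    case (step m)
    then have "h x \<le> h m" by simp
    also have "\<dots> \<le> h (Suc m)" using step x by (intro up) auto
    finally show ?case .
  qed simp
next
  case False
  then have "m \<le> x" by simp
  then show ?thesis using m(1)
  proof (induction rule: inc_induct)
    case (step n)
    then have "h x \<le> h (Suc n)" by simp
    also have "\<dots> \<le> h n" using step x by (intro down) auto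
    finally show ?case .
  qed simp
qed

text \<open>The increment from m to m + 1 is 2^(m - l) (k - r + m + 2). It is nonnegative exactly
  for m >= r - 2 - k, and r - 2 - floor k is the first integer of this kind.\<close>

lemma dyadic_minimizer:
  fixes k :: real and r :: nat
  defines "m\<^sub>0 \<equiv> int r - 2 - \<lfloor>k\<rfloor>"
  assumes x: "l \<le> x" "x \<le> r" "x = l \<or> int x \<le> m\<^sub>0" "x = r \<or> m\<^sub>0 \<le> int x"
    and m: "l \<le> m" "m \<le> r"
  shows "2 ^ (x - l) * (k - real (r - x)) \<le> 2 ^ (m - l) * (k - real (r - m))"
proof -
  define h where "h m = 2 ^ (m - l) * (k - real (r - m))" for m
  have step: "h (Suc m) - h m = 2 ^ (m - l) * (k - real r + real m + 2)" if "l \<le> m" "m < r" for m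
    using that by (simp add: h_def Suc_diff_le of_nat_diff algebra_simps)
  have "h x \<le> h m"
  proof (rule clamped_minimizer[OF _ _ x m])
    fix m assume lm: "l \<le> m" "m < r" and "m\<^sub>0 \<le> int m"
    then have "real_of_int (int r - 2 - int m) \<le> real_of_int \<lfloor>k\<rfloor>" by (simp add: m\<^sub>0_def)
    also have "\<dots> \<le> k" by simp
    finally have "k - real r + real m + 2 \<ge> 0" by simp
    then have "2 ^ (m - l) * (k - real r + real m + 2) \<ge> 0" by (intro mult_nonneg_nonneg) auto
    then show "h m \<le> h (Suc m)" using step[OF lm] by simp
  next
    fix m assume lm: "l \<le> m" "m < r" and "int m < m\<^sub>0"
    then have "\<lfloor>k\<rfloor> < int r - 2 - int m" by (simp add: m\<^sub>0_def)
    then have "k < real_of_int (int r - 2 - int m)" by (simp add: floor_less_iff)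
    then have "k - real r + real m + 2 \<le> 0" by simp
    then have "2 ^ (m - l) * (k - real r + real m + 2) \<le> 0" by (intro mult_nonneg_nonpos) auto
    then show "h (Suc m) \<le> h m" using step[OF lm] by simp
  qed
  then show ?thesis by (simp add: h_def)
qed

text \<open>With w the moment and k = log2 (C w) / \<alpha>, the bound is a constant times 2 to the
  power \<alpha> 2^(m - l) (k - (r - m)), hence increasing in the expression minimized in
  \<open>dyadic_minimizer\<close>.\<close>

lemma pow_bound_minimizer:
  assumes \<alpha>: "0 < \<alpha>" "\<alpha> < 1/2" and EW: "EW \<noteq> 0" "EW < \<infinity>"
    and m\<^sub>0: "m\<^sub>0 = int r - 2 - \<lfloor>log 2 (C_const \<alpha> * enn2real EW) / \<alpha>\<rfloor>"
    and x: "l \<le> x" "x \<le> r" "x = l \<or> int x \<le> m\<^sub>0" "x = r \<or> m\<^sub>0 \<le> int x"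
  shows "is_arg_min (pow_bound \<alpha> EW l r) (\<lambda>m. m \<in> {l..r}) x"
proof -
  obtain w where w: "EW = ennreal w" "w > 0"
    using EW by (cases EW) (auto simp: less_le)
  have C: "C_const \<alpha> > 0" using \<alpha> by (intro C_const_pos)
  define k where "k = log 2 (C_const \<alpha> * w) / \<alpha>"
  have pb: "pow_bound \<alpha> EW l r m =
      ennreal (1 / C_const \<alpha> * 2 powr (\<alpha> * (2 ^ (m - l) * (k - real (r - m)))))" for m
  proof -
    have "2 powr (\<alpha> * k) = C_const \<alpha> * w"
      using w C \<alpha> by (simp add: k_def powr_log_cancel)
    moreover have "(2 powr - \<alpha>) ^ (r - m) = 2 powr (- \<alpha> * real (r - m))"
      by (simp add: powr_powr flip: powr_realpow)
    ultimately have "C_const \<alpha> * (2 powr - \<alpha>) ^ (r - m) * w = 2 powr (\<alpha> * k) * 2 powr (- \<alpha> * real (r - m))"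
      by simp
    also have "\<dots> = 2 powr (\<alpha> * (k - real (r - m)))"
      by (simp add: right_diff_distrib flip: powr_add)
    finally have 1: "C_const \<alpha> * (2 powr - \<alpha>) ^ (r - m) * w = 2 powr (\<alpha> * (k - real (r - m)))" .
    have "(2 powr (\<alpha> * (k - real (r - m)))) ^ (2 ^ (m - l)) = 2 powr (\<alpha> * (k - real (r - m)) * 2 ^ (m - l))"
      by (simp add: powr_powr flip: powr_realpow)
    then have 2: "(C_const \<alpha> * (2 powr - \<alpha>) ^ (r - m) * w) ^ (2 ^ (m - l)) =
        2 powr (\<alpha> * (2 ^ (m - l) * (k - real (r - m))))"
      unfolding 1 by (simp add: mult_ac)
    have "pow_bound \<alpha> EW l r m =
        ennreal (1 / C_const \<alpha>) * ennreal ((C_const \<alpha> * (2 powr - \<alpha>) ^ (r - m) * w) ^ (2 ^ (m - l)))"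
      unfolding pow_bound_def w(1) using C w
      by (subst ennreal_mult[symmetric]) (auto simp: ennreal_power)
    also have "\<dots> = ennreal (1 / C_const \<alpha> * 2 powr (\<alpha> * (2 ^ (m - l) * (k - real (r - m)))))"
      unfolding 2 using C by (intro ennreal_mult[symmetric]) auto
    finally show ?thesis .
  qed
  have "pow_bound \<alpha> EW l r x \<le> pow_bound \<alpha> EW l r m" if "m \<in> {l..r}" for m
  proof -
    have "2 ^ (x - l) * (k - real (r - x)) \<le> 2 ^ (m - l) * (k - real (r - m))"
      by (rule dyadic_minimizer) (use x m\<^sub>0 w that in \<open>auto simp: k_def\<close>)
    then show ?thesis unfolding pb using \<alpha> C
      by (intro ennreal_leI mult_left_mono powr_mono) auto
  qed
  then show ?thesis using x by (auto simp: is_arg_min_def not_less)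
qed

text \<open>With k = (y + c2) / ln 2 the bound is an increasing affine function of the expression in
  \<open>dyadic_minimizer\<close>.\<close>

lemma log_bound_minimizer:
  assumes m\<^sub>0: "m\<^sub>0 = int r - 2 - \<lfloor>(y + c2_const) / ln 2\<rfloor>"
    and x: "l \<le> x" "x \<le> r" "x = l \<or> int x \<le> m\<^sub>0" "x = r \<or> m\<^sub>0 \<le> int x"
  shows "is_arg_min (log_bound (ereal y) l r) (\<lambda>m. m \<in> {l..r}) x"
proof -
  define k where "k = (y + c2_const) / ln 2"
  have lb: "log_bound (ereal y) l r m = ereal (ln 2 * (2 ^ (m - l) * (k - real (r - m))) - c2_const)" for m
    by (simp add: log_bound_def k_def field_simps)
  have "log_bound (ereal y) l r x \<le> log_bound (ereal y) l r m" if "m \<in> {l..r}" for m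
  proof -
    have "2 ^ (x - l) * (k - real (r - x)) \<le> 2 ^ (m - l) * (k - real (r - m))"
      by (rule dyadic_minimizer) (use x m\<^sub>0 that in \<open>auto simp: k_def\<close>)
    then show ?thesis unfolding lb by simp
  qed
  then show ?thesis using x by (auto simp: is_arg_min_def not_less)
qed

section \<open>Marginals of the random field\<close>

text \<open>Marginal density of the field on \<open>ks\<close>, as a product of conditional densities of the pivots;
  the factor 2 is the Jacobian of the diagonal entry \<open>2 * \<beta>\<close>.\<close>
primrec elim_density :: "'x set \<Rightarrow> 'x list \<Rightarrow> ('x \<Rightarrow> 'x \<Rightarrow> real) \<Rightarrow> real" where
  "elim_density L [] A = 1"
| "elim_density L (k # ks) A =
    2 * rig_density (- (\<Sum>i\<in>L - {k}. elim ks A i k)) (elim ks A k k) * elim_density L ks A"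

lemma elim_density_nonneg [simp]: "elim_density L ks A \<ge> 0"
  by (induction ks) auto

lemma elim_density_append:
  "elim_density L (ks @ ks') A = elim_density L ks (elim ks' A) * elim_density L ks' A"
  by (induction ks) (simp_all add: elim_append mult.assoc)

lemma elim_density_eq_0:
  assumes "\<not> pos_pivots ks A"
  shows "elim_density L ks A = 0"
  using assms by (induction ks) (auto simp: rig_density_def)

lemma elim_density_add:
  assumes "\<And>i j. i \<in> set ks \<or> j \<in> set ks \<Longrightarrow> D i j = 0"
  shows "elim_density L ks (\<lambda>i j. A i j + D i j) = elim_density L ks A"
  using assms
proof (induction ks)
  case (Cons k ks)
  have "elim ks (\<lambda>i j. A i j + D i j) i k = elim ks A i k + D i k" for i
    by (rule elim_add) (use Cons.prems in auto)
  then have "elim ks (\<lambda>i j. A i j + D i j) i k = elim ks A i k" for i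
    using Cons.prems by simp
  moreover have "elim_density L ks (\<lambda>i j. A i j + D i j) = elim_density L ks A"
    by (rule Cons.IH) (use Cons.prems in auto)
  ultimately show ?case by simp
qed simp

text \<open>The exponent telescopes: eliminating k lowers the sum of all matrix entries by the squared
  column sum of k divided by its pivot.\<close>
lemma elim_density_eq:
  assumes sym: "\<And>i j. A i j = A j i" and "finite L" "set ks \<subseteq> L" "distinct ks" "pos_pivots ks A"
  shows "elim_density L ks A = (2 / pi) powr (real (length ks) / 2) *
    exp (- (1/2) * (\<Sum>i\<in>L. \<Sum>j\<in>L. A i j - elim ks A i j)) * pivot_prod ks A powr (- 1 / 2)"
  using assms(3-5)
proof (induction ks)
  case (Cons k ks)
  define S where "S = elim ks A"
  define x where "x = S k k"
  define c where "c = (\<Sum>i\<in>L. S i k)"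
  define P where "P = pivot_prod ks A"
  have x: "x > 0" using Cons.prems by (simp add: x_def S_def)
  have P: "P > 0"
  proof -
    have "pos_pivots ks A \<Longrightarrow> pivot_prod ks A > 0" for ks by (induction ks) auto
    then show ?thesis using Cons.prems by (simp add: P_def)
  qed
  have Ssym: "S i j = S j i" for i j unfolding S_def by (rule elim_sym) (rule sym)
  \<comment> \<open>The parameter of the density is minus the off-diagonal column sum, so the full
    column sum is the pivot minus the parameter, and its square is the one in the exponent of
    \<open>rig_density\<close>.\<close>
  have c: "c = x + (\<Sum>i\<in>L - {k}. S i k)"
    using Cons.prems \<open>finite L\<close> by (simp add: c_def x_def sum.remove[of L k])
  have "(\<Sum>i\<in>L. \<Sum>j\<in>L. S i k * S k j / x) = (\<Sum>i\<in>L. S i k) * (\<Sum>j\<in>L. S j k) / x"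
    by (simp add: sum_product sum_divide_distrib Ssym[of k])
  then have ex: "(\<Sum>i\<in>L. \<Sum>j\<in>L. A i j - elim (k # ks) A i j) =
      (\<Sum>i\<in>L. \<Sum>j\<in>L. A i j - S i j) + c\<^sup>2 / x"
    by (simp add: S_def[symmetric] x_def[symmetric] c_def sum_subtractf sum.distrib power2_eq_square)
  have rd: "2 * rig_density (- (\<Sum>i\<in>L - {k}. S i k)) x = (2 / pi) powr (1/2) * exp (- (1/2) * (c\<^sup>2 / x)) * x powr (- 1 / 2)"
  proof -
    have "2 * rig_density (- (\<Sum>i\<in>L - {k}. S i k)) x = 2 / sqrt (2 * pi * x) * exp (- (1/2) * (c\<^sup>2 / x))"
      using x by (simp add: rig_density_def c add.commute)
    also have "2 / sqrt (2 * pi * x) = (2 / pi) powr (1/2) * x powr (- 1 / 2)"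
    proof -
      have "(2 / pi) powr (1/2) * x powr (- 1 / 2) = sqrt (2 / pi) / sqrt x"
        using x by (simp add: powr_half_sqrt powr_minus_divide)
      also have "\<dots> = 2 / sqrt (2 * pi * x)"
        using x by (simp add: real_sqrt_mult real_sqrt_divide field_simps)
      finally show ?thesis by simp
    qed
    finally show ?thesis by (simp only: mult_ac)
  qed
  have "elim_density L (k # ks) A = 2 * rig_density (- (\<Sum>i\<in>L - {k}. S i k)) x * elim_density L ks A"
    by (simp add: S_def x_def)
  also have "elim_density L ks A = (2 / pi) powr (real (length ks) / 2) *
    exp (- (1/2) * (\<Sum>i\<in>L. \<Sum>j\<in>L. A i j - S i j)) * P powr (- 1 / 2)"
    unfolding S_def P_def by (rule Cons.IH) (use Cons.prems in auto)
  also have "2 * rig_density (- (\<Sum>i\<in>L - {k}. S i k)) x * \<dots> =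
     ((2 / pi) powr (1/2) * (2 / pi) powr (real (length ks) / 2)) *
     (exp (- (1/2) * (c\<^sup>2 / x)) * exp (- (1/2) * (\<Sum>i\<in>L. \<Sum>j\<in>L. A i j - S i j))) *
     (x powr (- 1 / 2) * P powr (- 1 / 2))"
    unfolding rd by (simp add: mult_ac)
  also have "(2 / pi) powr (1/2) * (2 / pi) powr (real (length ks) / 2) = (2 / pi) powr (real (length (k # ks)) / 2)"
    by (simp add: add_divide_distrib flip: powr_add)
  also have "exp (- (1/2) * (c\<^sup>2 / x)) * exp (- (1/2) * (\<Sum>i\<in>L. \<Sum>j\<in>L. A i j - S i j)) =
      exp (- (1/2) * (\<Sum>i\<in>L. \<Sum>j\<in>L. A i j - elim (k # ks) A i j))"
    unfolding ex by (simp only: exp_add[symmetric] distrib_left add.commute)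
  also have "x powr (- 1 / 2) * P powr (- 1 / 2) = pivot_prod (k # ks) A powr (- 1 / 2)"
    using x P by (simp add: powr_mult P_def x_def S_def)
  finally show ?case .
qed simp

lemma Hmat_sym: "(\<And>i j. W i j = W j i) \<Longrightarrow> Hmat W b i j = Hmat W b j i"
  by (simp add: Hmat_def)

text \<open>After eliminating all of \<open>L\<close> nothing remains, so the exponents add up to
  the full sum and the pivots multiply to the determinant. The order of the list is arbitrary, which
  later allows any chosen segment to come first.\<close>

lemma nu_density_eq_elim_density:
  assumes "\<And>i j. W i j = W j i" "distinct ks" "set ks = L"
  shows "nu_density L W b = elim_density L ks (Hmat W b)"
proof -
  let ?A = "Hmat W b"
  have sym: "?A i j = ?A j i" for i j using assms(1) by (rule Hmat_sym)
  have pd: "posdef_on L ?A \<longleftrightarrow> pos_pivots ks ?A"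
    using posdef_on_iff_pos_pivots[of ?A ks] sym assms by simp
  show ?thesis
  proof (cases "pos_pivots ks ?A")
    case True
    have "(\<Sum>i\<in>L. \<Sum>j\<in>L. ?A i j - elim ks ?A i j) = (\<Sum>i\<in>L. \<Sum>j\<in>L. ?A i j)"
      using elim_zero_row[OF assms(2) True] assms(3) by (intro sum.cong) auto
    moreover have "card L = length ks" using assms distinct_card by metis
    moreover have "det_on L ?A = pivot_prod ks ?A"
      using det_on_eq_pivot_prod[of ?A ks] sym assms True by simp
    moreover have "elim_density L ks ?A = (2 / pi) powr (real (length ks) / 2) *
      exp (- (1/2) * (\<Sum>i\<in>L. \<Sum>j\<in>L. ?A i j - elim ks ?A i j)) * pivot_prod ks ?A powr (- 1 / 2)"
      by (rule elim_density_eq) (use sym assms True in auto)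
    ultimately show ?thesis using True by (simp add: nu_density_def pd)
  qed (simp add: nu_density_def pd elim_density_eq_0)
qed

section \<open>Integrating out the field vertex by vertex\<close>

lemma measurable_elim:
  assumes "\<And>i j. (\<lambda>x. A x i j) \<in> borel_measurable N"
  shows "(\<lambda>x. elim ks (A x) i j) \<in> borel_measurable N"
  by (induction ks arbitrary: i j) (simp_all add: assms)

lemma measurable_elim_density:
  assumes "\<And>i j. (\<lambda>x. A x i j) \<in> borel_measurable N"
  shows "(\<lambda>x. elim_density L ks (A x)) \<in> borel_measurable N"
proof (induction ks)
  case (Cons k ks)
  note [measurable] = Cons measurable_elim[OF assms]
  show ?case by simp
qed simp

lemma pred_pos_pivots:
  assumes "\<And>i j. (\<lambda>x. A x i j) \<in> borel_measurable N"
  shows "Measurable.pred N (\<lambda>x. pos_pivots ks (A x))"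
proof (induction ks)
  case (Cons k ks)
  note [measurable] = Cons measurable_elim[OF assms]
  show ?case by simp
qed simp

text \<open>A change of the field at one vertex is a diagonal perturbation, written in the shape
  required by \<open>elim_add\<close>.\<close>

lemma Hmat_fun_upd:
  "Hmat W (b(k := y)) = (\<lambda>i j. Hmat W b i j + (if i = k \<and> j = k then 2 * (y - b k) else 0))"
  by (auto simp: Hmat_def fun_eq_iff)

lemma nn_integral_affine_2:
  fixes c :: real
  assumes [measurable]: "g \<in> borel_measurable borel"
  shows "(\<integral>\<^sup>+y. 2 * g (c + 2 * y) \<partial>lborel) = (\<integral>\<^sup>+x. g x \<partial>lborel)"
proof -
  have "(\<integral>\<^sup>+y. 2 * g (c + 2 * y) \<partial>lborel) = 2 * (\<integral>\<^sup>+y. g (c + 2 * y) \<partial>lborel)"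
    by (rule nn_integral_cmult) simp
  then show ?thesis using nn_integral_real_affine[of g 2 c] by simp
qed

abbreviation RPi :: "'x set \<Rightarrow> ('x \<Rightarrow> real) measure" where
  "RPi I \<equiv> PiM I (\<lambda>_. lborel)"

text \<open>Among the factors only the last pivot depends on the field at k, and it is affine with
  slope 2; the substitution leaves the mass of \<open>rig_density\<close>.\<close>

lemma elim_density_marginal_step:
  assumes sym: "\<And>i j. W i j = W j i" and nonneg: "\<And>i j. W i j \<ge> 0"
    and "distinct (k # ks)"
  shows "(\<integral>\<^sup>+y. ennreal (elim_density L (k # ks) (Hmat W (b(k := y)))) \<partial>lborel) =
    ennreal (elim_density L ks (Hmat W b))"
proof -
  define A where "A = Hmat W b"
  define D where "D y i j = (if i = k \<and> j = k then 2 * (y - b k) else 0)" for y i j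
  have H: "Hmat W (b(k := y)) = (\<lambda>i j. A i j + D y i j)" for y
    by (simp add: Hmat_fun_upd A_def D_def)
  have k: "k \<notin> set ks" "distinct ks" using assms by auto
  have e: "elim ks (Hmat W (b(k := y))) i j = elim ks A i j + D y i j" for y i j
    unfolding H by (rule elim_add) (use k in \<open>auto simp: D_def\<close>)
  have d: "elim_density L ks (Hmat W (b(k := y))) = elim_density L ks A" for y
    unfolding H by (rule elim_density_add) (use k in \<open>auto simp: D_def\<close>)
  define s where "s = - (\<Sum>i\<in>L - {k}. elim ks A i k)"
  define c where "c = elim ks A k k - 2 * b k"
  have "ennreal (elim_density L (k # ks) (Hmat W (b(k := y)))) =
      2 * ennreal (rig_density s (c + 2 * y)) * ennreal (elim_density L ks A)" for y
  proof -
    have "(\<Sum>i\<in>L - {k}. elim ks (Hmat W (b(k := y))) i k) = (\<Sum>i\<in>L - {k}. elim ks A i k)"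
      unfolding e by (intro sum.cong) (auto simp: D_def)
    moreover have "elim ks (Hmat W (b(k := y))) k k = c + 2 * y"
      unfolding e by (simp add: D_def c_def)
    ultimately have "elim_density L (k # ks) (Hmat W (b(k := y))) =
        2 * rig_density s (c + 2 * y) * elim_density L ks A"
      by (simp only: elim_density.simps d s_def)
    then show ?thesis by (simp add: ennreal_mult' del: elim_density.simps)
  qed
  then have "(\<integral>\<^sup>+y. ennreal (elim_density L (k # ks) (Hmat W (b(k := y)))) \<partial>lborel) =
     (\<integral>\<^sup>+y. 2 * ennreal (rig_density s (c + 2 * y)) * ennreal (elim_density L ks A) \<partial>lborel)"
    by (intro nn_integral_cong)
  also have "\<dots> = (\<integral>\<^sup>+y. 2 * ennreal (rig_density s (c + 2 * y)) \<partial>lborel) * ennreal (elim_density L ks A)"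
    by (rule nn_integral_multc) simp
  also have "(\<integral>\<^sup>+y. 2 * ennreal (rig_density s (c + 2 * y)) \<partial>lborel) = (\<integral>\<^sup>+x. ennreal (rig_density s x) \<partial>lborel)"
    by (rule nn_integral_affine_2) simp
  \<comment> \<open>Mass 1 is available for nonnegative parameters, which positive earlier pivots
    guarantee; if one of these fails to be positive, the remaining factor is 0.\<close>
  also have "\<dots> * ennreal (elim_density L ks A) = ennreal (elim_density L ks A)"
  proof (cases "pos_pivots ks A")
    case True
    have "elim ks A i k \<le> 0" if "i \<in> L - {k}" for i
    proof (cases "i \<in> set ks")
      case i: True
      show ?thesis using elim_zero_row[OF k(2) True i] by simp
    next
      case False
      show ?thesis
        by (rule elim_offdiag_nonpos) (use k True False that nonneg in \<open>auto simp: A_def Hmat_def\<close>)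
    qed
    then have "(\<Sum>i\<in>L - {k}. elim ks A i k) \<le> 0" by (rule sum_nonpos)
    then have "s \<ge> 0" by (simp add: s_def)
    then show ?thesis by (simp add: nn_integral_rig_density)
  qed (simp add: elim_density_eq_0)
  finally show ?thesis unfolding A_def .
qed

text \<open>Coordinates outside \<open>I\<close> are constantly \<open>undefined\<close> on the
  product space, so every index can be treated alike; the matrices here are indexed by a whole
  type.\<close>

lemma measurable_PiM_any_component:
  assumes W: "W \<in> N \<rightarrow>\<^sub>M PiM I (\<lambda>_. M)" and M: "sets M = sets (borel :: real measure)"
  shows "(\<lambda>x. W x i) \<in> borel_measurable N"
proof (cases "i \<in> I")
  case True
  then have "(\<lambda>x. W x i) \<in> N \<rightarrow>\<^sub>M M"
    using measurable_compose[OF W measurable_component_singleton] by simp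
  then show ?thesis using M by (simp cong: measurable_cong_sets)
next
  case False
  then have "W x i = undefined" if "x \<in> space N" for x
    using measurable_space[OF W that] by (auto simp: space_PiM PiE_def extensional_def)
  then show ?thesis by (subst measurable_cong[where g = "\<lambda>_. undefined"]) auto
qed

lemma measurable_Hmat:
  assumes "\<And>i j. (\<lambda>x. W x i j) \<in> borel_measurable N" "\<And>i. (\<lambda>x. b x i) \<in> borel_measurable N"
  shows "(\<lambda>x. Hmat (W x) (b x) i j) \<in> borel_measurable N"
  using assms unfolding Hmat_def by measurable

text \<open>The head of the list is eliminated last, so its field value occurs in a single factor
  and is integrated out by \<open>elim_density_marginal_step\<close>; the induction peels off
  \<open>ks\<close> from the front.\<close>

lemma elim_density_marginal:
  assumes sym: "\<And>i j. W i j = W j i" and nonneg: "\<And>i j. W i j \<ge> 0"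
    and "distinct (ks @ ks')"
    and f [measurable]: "f \<in> borel_measurable (RPi (set ks'))"
  shows "(\<integral>\<^sup>+b. f (restrict b (set ks')) * ennreal (elim_density L (ks @ ks') (Hmat W b))
      \<partial>RPi (set (ks @ ks'))) =
    (\<integral>\<^sup>+b. f b * ennreal (elim_density L ks' (Hmat W b)) \<partial>RPi (set ks'))"
  using assms(3)
proof (induction ks)
  case Nil
  show ?case unfolding append_Nil
  proof (rule nn_integral_cong, goal_cases)
    case (1 b)
    then have "restrict b (set ks') = b" unfolding space_PiM by (rule PiE_restrict)
    then show ?case by (simp only:)
  qed
next
  case (Cons k ks)
  interpret product_sigma_finite "\<lambda>_. lborel :: real measure" by standard
  define I where "I = set (ks @ ks')"
  have k: "k \<notin> I" "finite I" using Cons.prems by (auto simp: I_def)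
  have comp: "(\<lambda>b. b i) \<in> borel_measurable (RPi J)" for J and i :: 'a
    by (rule measurable_PiM_any_component[where W = "\<lambda>b. b", OF measurable_ident_sets[OF refl]]) simp
  have dm: "(\<lambda>b. elim_density L ks (Hmat W b)) \<in> borel_measurable (RPi J)" for J ks
    by (intro measurable_elim_density measurable_Hmat comp) auto
  note [measurable] = dm
  have [measurable]: "(\<lambda>b. restrict b (set ks')) \<in> RPi J \<rightarrow>\<^sub>M RPi (set ks')"
    if "set ks' \<subseteq> J" for J
    using that by (intro measurable_restrict_subset)
  have "(\<integral>\<^sup>+b. f (restrict b (set ks')) * ennreal (elim_density L ((k # ks) @ ks') (Hmat W b))
      \<partial>PiM (set ((k # ks) @ ks')) (\<lambda>_. lborel)) =
     (\<integral>\<^sup>+b. f (restrict b (set ks')) * ennreal (elim_density L (k # ks @ ks') (Hmat W b))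
      \<partial>RPi (insert k I))"
    by (simp add: I_def)
  also have "\<dots> = (\<integral>\<^sup>+b. \<integral>\<^sup>+y. f (restrict (b(k := y)) (set ks')) *
      ennreal (elim_density L (k # ks @ ks') (Hmat W (b(k := y)))) \<partial>lborel \<partial>RPi I)"
  proof (rule product_nn_integral_insert[OF k(2,1)])
    have "(\<lambda>b. f (restrict b (set ks'))) \<in> borel_measurable (RPi (insert k I))"
      by (rule measurable_compose[OF measurable_restrict_subset f]) (auto simp: I_def)
    then show "(\<lambda>b. f (restrict b (set ks')) * ennreal (elim_density L (k # ks @ ks') (Hmat W b)))
      \<in> borel_measurable (RPi (insert k I))"
      using dm by measurable
  qed
  also have "\<dots> = (\<integral>\<^sup>+b. f (restrict b (set ks')) *
      ennreal (elim_density L (ks @ ks') (Hmat W b)) \<partial>RPi I)"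
  proof (rule nn_integral_cong, goal_cases)
    case (1 b)
    have "restrict (b(k := y)) (set ks') = restrict b (set ks')" for y
      using k by (auto simp: I_def restrict_def)
    then have "(\<integral>\<^sup>+y. f (restrict (b(k := y)) (set ks')) *
        ennreal (elim_density L (k # ks @ ks') (Hmat W (b(k := y)))) \<partial>lborel) =
       (\<integral>\<^sup>+y. f (restrict b (set ks')) *
        ennreal (elim_density L (k # ks @ ks') (Hmat W (b(k := y)))) \<partial>lborel)" by simp
    also have "\<dots> = f (restrict b (set ks')) *
        (\<integral>\<^sup>+y. ennreal (elim_density L (k # ks @ ks') (Hmat W (b(k := y)))) \<partial>lborel)"
      by (rule nn_integral_cmult)
         (intro measurable_compose[OF _ measurable_ennreal] measurable_elim_density measurable_Hmat, auto)
    also have "(\<integral>\<^sup>+y. ennreal (elim_density L (k # ks @ ks') (Hmat W (b(k := y)))) \<partial>lborel) =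
        ennreal (elim_density L (ks @ ks') (Hmat W b))"
      by (rule elim_density_marginal_step[OF sym nonneg]) (use Cons.prems in auto)
    finally show ?case .
  qed
  also have "\<dots> = (\<integral>\<^sup>+b. f b * ennreal (elim_density L ks' (Hmat W b)) \<partial>RPi (set ks'))"
    unfolding I_def by (rule Cons.IH) (use Cons.prems in auto)
  finally show ?case .
qed

section \<open>Effective weights of dyadic segments\<close>

text \<open>Bisection order: as the tail of a list is eliminated first, the midpoint at the head
  comes after both halves.\<close>

primrec seg :: "nat \<Rightarrow> nat \<Rightarrow> nat list" where
  "seg p 0 = []"
| "seg p (Suc n) = (p + 2 ^ n) # seg p n @ seg (p + 2 ^ n) n"

lemma set_seg: "set (seg p n) = {p<..<p + 2 ^ n}"
proof (induction n arbitrary: p)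
  case (Suc n)
  have "(0::nat) < 2 ^ n" by simp
  then show ?case using Suc by auto
qed auto

lemma distinct_seg: "distinct (seg p n)"
  by (induction n arbitrary: p) (auto simp: set_seg)

lemma wmat_sym: "wmat Es w i j = wmat Es w j i"
  by (simp add: wmat_def insert_commute)

text \<open>Models one subdivided edge inside the whole graph: interior vertices of the path have no
  neighbours off the path, while the two ends may have any. \<open>chordless\<close> also excludes
  an edge joining the two ends of a longer path.\<close>

locale path_graph =
  fixes L :: "'x set" and Es :: "'x set set" and \<phi> :: "nat \<Rightarrow> 'x" and R :: nat
  assumes finite_L: "finite L" and finite_Es: "finite Es"
    and no_loop: "\<And>x. {x} \<notin> Es"
    and inj: "inj_on \<phi> {..R}" and range_L: "\<phi> ` {..R} \<subseteq> L"
    and path_edge: "\<And>i. i < R \<Longrightarrow> {\<phi> i, \<phi> (Suc i)} \<in> Es"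
    and path_nbr: "\<And>i x. 0 < i \<Longrightarrow> i < R \<Longrightarrow> {\<phi> i, x} \<in> Es \<Longrightarrow> x = \<phi> (i - 1) \<or> x = \<phi> (i + 1)"
    and chordless: "\<And>i j. i \<le> R \<Longrightarrow> j \<le> R \<Longrightarrow> {\<phi> i, \<phi> j} \<in> Es \<Longrightarrow> j = Suc i \<or> i = Suc j"
begin

definition seg_list :: "nat \<Rightarrow> nat \<Rightarrow> 'x list" where
  "seg_list p n = map \<phi> (seg p n)"

definition seg_vertices :: "nat \<Rightarrow> nat \<Rightarrow> 'x set" where
  "seg_vertices p n = \<phi> ` {p<..<p + 2 ^ n}"

definition seg_edges :: "nat \<Rightarrow> nat \<Rightarrow> 'x set set" where
  "seg_edges p n = (\<lambda>i. {\<phi> i, \<phi> (Suc i)}) ` {p..<p + 2 ^ n}"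

definition Hpath :: "('x set \<Rightarrow> real) \<Rightarrow> ('x \<Rightarrow> real) \<Rightarrow> 'x \<Rightarrow> 'x \<Rightarrow> real" where
  "Hpath w b = Hmat (wmat Es w) b"

definition schur :: "nat \<Rightarrow> nat \<Rightarrow> ('x set \<Rightarrow> real) \<Rightarrow> ('x \<Rightarrow> real) \<Rightarrow> 'x \<Rightarrow> 'x \<Rightarrow> real" where
  "schur p n w b = elim (seg_list p n) (Hpath w b)"

text \<open>The sign undoes the one in \<open>Hmat\<close>, whose off-diagonal entries are minus the
  weights.\<close>

definition eff_edge :: "nat \<Rightarrow> nat \<Rightarrow> ('x set \<Rightarrow> real) \<Rightarrow> ('x \<Rightarrow> real) \<Rightarrow> real" where
  "eff_edge p n w b = - schur p n w b (\<phi> p) (\<phi> (p + 2 ^ n))"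

definition seg_density :: "nat \<Rightarrow> nat \<Rightarrow> ('x set \<Rightarrow> real) \<Rightarrow> ('x \<Rightarrow> real) \<Rightarrow> real" where
  "seg_density p n w b = elim_density L (seg_list p n) (Hpath w b)"

lemma Hpath_sym: "Hpath w b i j = Hpath w b j i"
  unfolding Hpath_def by (rule Hmat_sym) (rule wmat_sym)

lemma phi_eq_iff: "i \<le> R \<Longrightarrow> j \<le> R \<Longrightarrow> \<phi> i = \<phi> j \<longleftrightarrow> i = j"
  using inj by (auto simp: inj_on_def)

lemma set_seg_list: "set (seg_list p n) = seg_vertices p n"
  by (simp add: seg_list_def set_seg seg_vertices_def)

lemma seg_list_Suc: "seg_list p (Suc n) = \<phi> (p + 2 ^ n) # seg_list p n @ seg_list (p + 2 ^ n) n"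
  by (simp add: seg_list_def)

lemma distinct_seg_list: "p + 2 ^ n \<le> R \<Longrightarrow> distinct (seg_list p n)"
  unfolding seg_list_def distinct_map
  by (intro conjI distinct_seg inj_on_subset[OF inj]) (auto simp: set_seg)

lemma Hpath_inner_eq_0:
  assumes "0 < i" "i < R" "x \<noteq> \<phi> i" "x \<noteq> \<phi> (i - 1)" "x \<noteq> \<phi> (i + 1)"
  shows "Hpath w b (\<phi> i) x = 0" "Hpath w b x (\<phi> i) = 0"
proof -
  show 1: "Hpath w b (\<phi> i) x = 0"
    using path_nbr[of i x] assms by (auto simp: Hpath_def Hmat_def wmat_def)
  then show "Hpath w b x (\<phi> i) = 0" using Hpath_sym by metis
qed

text \<open>Interior vertices of a segment are adjacent only to points of the closed segment, so a
  row or column outside it has zeros at all eliminated indices.\<close>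

lemma schur_outside:
  assumes "p + 2 ^ n \<le> R" "x \<notin> \<phi> ` {p..p + 2 ^ n}"
  shows "schur p n w b x y = Hpath w b x y" "schur p n w b y x = Hpath w b y x"
proof -
  have *: "Hpath w b x a = 0 \<and> Hpath w b a x = 0" if a: "a \<in> set (seg_list p n)" for a
  proof -
    obtain q where q: "a = \<phi> q" "p < q" "q < p + 2 ^ n" using a by (auto simp: set_seg_list seg_vertices_def)
    then have "q \<in> {p..p + 2 ^ n}" "q - 1 \<in> {p..p + 2 ^ n}" "q + 1 \<in> {p..p + 2 ^ n}" by auto
    then have "x \<noteq> \<phi> q" "x \<noteq> \<phi> (q - 1)" "x \<noteq> \<phi> (q + 1)" using assms(2) by blast+
    then show ?thesis using q assms(1) Hpath_inner_eq_0[of q x w b] by simp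
  qed
  show "schur p n w b x y = Hpath w b x y"
    unfolding schur_def by (rule elim_eq_nonadjacent) (use * in blast)
  show "schur p n w b y x = Hpath w b y x"
    unfolding schur_def by (rule elim_eq_nonadjacent') (use * in blast)
qed

section \<open>Two adjacent segments and their common vertex\<close>

context
  fixes p n q :: nat
  assumes q: "q = p + 2 ^ n" and qR: "q + 2 ^ n \<le> R"
begin

lemma pow_pos: "(0::nat) < 2 ^ n" by simp

lemma not_in_right:
  assumes "x \<in> seg_vertices p n \<or> x = \<phi> p"
  shows "x \<notin> \<phi> ` {q..q + 2 ^ n}"
proof
  assume "x \<in> \<phi> ` {q..q + 2 ^ n}"
  then obtain j where j: "x = \<phi> j" "q \<le> j" "j \<le> q + 2 ^ n" by auto
  obtain i where i: "x = \<phi> i" "p \<le> i" "i < q" using assms pow_pos by (auto simp: seg_vertices_def q)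
  have "i \<le> R" "j \<le> R" using i j qR by auto
  then have "i = j" using phi_eq_iff[of i j] i j by simp
  then show False using i j by simp
qed

lemma not_in_left:
  assumes "x \<in> seg_vertices q n \<or> x = \<phi> (q + 2 ^ n)"
  shows "x \<notin> \<phi> ` {p..q}"
proof
  assume "x \<in> \<phi> ` {p..q}"
  then obtain j where j: "x = \<phi> j" "p \<le> j" "j \<le> q" by auto
  obtain i where i: "x = \<phi> i" "q < i" "i \<le> q + 2 ^ n" using assms pow_pos by (auto simp: seg_vertices_def)
  have "i \<le> R" "j \<le> R" using i j qR by auto
  then have "i = j" using phi_eq_iff[of i j] i j by simp
  then show False using i j by simp
qed

text \<open>The change caused by eliminating the right half. It vanishes on the interior of the left
  half, so the left elimination can be carried out as if the right one had not taken place.\<close>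

definition right_shift :: "('x set \<Rightarrow> real) \<Rightarrow> ('x \<Rightarrow> real) \<Rightarrow> 'x \<Rightarrow> 'x \<Rightarrow> real" where
  "right_shift w b i j = schur q n w b i j - Hpath w b i j"

lemma right_shift_zero: "i \<in> set (seg_list p n) \<or> j \<in> set (seg_list p n) \<Longrightarrow> right_shift w b i j = 0"
  using schur_outside[of q n i w b j] schur_outside[of q n j w b i] not_in_right[of i] not_in_right[of j] qR
  by (auto simp: right_shift_def set_seg_list)

lemma elim_right: "elim (seg_list q n) (Hpath w b) = (\<lambda>i j. Hpath w b i j + right_shift w b i j)"
  by (simp add: right_shift_def schur_def)

lemma elim_both: "elim (seg_list p n @ seg_list q n) (Hpath w b) i j = schur p n w b i j + schur q n w b i j - Hpath w b i j"
proof -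
  have "elim (seg_list p n @ seg_list q n) (Hpath w b) i j = schur p n w b i j + right_shift w b i j"
    unfolding elim_append elim_right schur_def by (rule elim_add) (rule right_shift_zero)
  then show ?thesis by (simp add: right_shift_def)
qed

lemma density_both:
  "elim_density L (seg_list p n @ seg_list q n) (Hpath w b) = seg_density p n w b * seg_density q n w b"
proof -
  have "elim_density L (seg_list p n) (elim (seg_list q n) (Hpath w b)) = seg_density p n w b"
    unfolding elim_right seg_density_def by (rule elim_density_add) (rule right_shift_zero)
  then show ?thesis by (simp add: elim_density_append seg_density_def)
qed

lemma distinct_both: "distinct (seg_list p n @ seg_list q n)"
proof -
  have "set (seg_list p n) \<inter> set (seg_list q n) = {}"
    using not_in_left unfolding set_seg_list by (fastforce simp: seg_vertices_def q)
  then show ?thesis using distinct_seg_list[of p n] distinct_seg_list[of q n] qR q by simp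
qed

definition mid_pivot :: "('x set \<Rightarrow> real) \<Rightarrow> ('x \<Rightarrow> real) \<Rightarrow> real" where
  "mid_pivot w b = elim (seg_list p n @ seg_list q n) (Hpath w b) (\<phi> q) (\<phi> q)"

lemma elim_both_left: "elim (seg_list p n @ seg_list q n) (Hpath w b) (\<phi> p) (\<phi> q) = - eff_edge p n w b"
  using schur_outside(1)[of q n "\<phi> p" w b "\<phi> q"] not_in_right[of "\<phi> p"] qR
  unfolding elim_both eff_edge_def q[symmetric] by simp

lemma elim_both_right: "elim (seg_list p n @ seg_list q n) (Hpath w b) (\<phi> q) (\<phi> (q + 2 ^ n)) = - eff_edge q n w b"
  using schur_outside(2)[of p n "\<phi> (q + 2 ^ n)" w b "\<phi> q"] not_in_left[of "\<phi> (q + 2 ^ n)"] qR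
  unfolding elim_both eff_edge_def q[symmetric] by simp

text \<open>The far ends are neither adjacent nor joined through one half alone, so their entry
  before the last step is 0; eliminating the midpoint then produces the quotient.\<close>

lemma eff_edge_Suc: "eff_edge p (Suc n) w b = eff_edge p n w b * eff_edge q n w b / mid_pivot w b"
proof -
  have e: "p + 2 ^ Suc n = q + 2 ^ n" by (simp add: q)
  have "schur q n w b (\<phi> p) (\<phi> (q + 2 ^ n)) = Hpath w b (\<phi> p) (\<phi> (q + 2 ^ n))"
    by (rule schur_outside(1)) (use qR not_in_right in auto)
  moreover have "schur p n w b (\<phi> p) (\<phi> (q + 2 ^ n)) = Hpath w b (\<phi> p) (\<phi> (q + 2 ^ n))"
    by (rule schur_outside(2)) (use qR not_in_left q in auto)
  moreover have "Hpath w b (\<phi> p) (\<phi> (q + 2 ^ n)) = 0"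
  proof -
    have "{\<phi> p, \<phi> (q + 2 ^ n)} \<notin> Es"
      using chordless[of p "q + 2 ^ n"] qR pow_pos by (auto simp: q)
    moreover have "\<phi> p \<noteq> \<phi> (q + 2 ^ n)" using phi_eq_iff[of p "q + 2 ^ n"] qR pow_pos by (auto simp: q)
    ultimately show ?thesis by (simp add: Hpath_def Hmat_def wmat_def)
  qed
  ultimately have "elim (seg_list p n @ seg_list q n) (Hpath w b) (\<phi> p) (\<phi> (q + 2 ^ n)) = 0"
    by (simp add: elim_both)
  then show ?thesis
    unfolding eff_edge_def[of p "Suc n"] schur_def[of p "Suc n"] seg_list_Suc q[symmetric] e
    by (simp add: elim_both_left elim_both_right mid_pivot_def)
qed

text \<open>In the column of the midpoint the eliminated rows are 0, and apart from the two far ends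
  no other vertex is adjacent to it, so the off-diagonal sum is -(a + b). If an earlier pivot fails
  to be positive, both sides vanish.\<close>

lemma seg_density_Suc:
  "seg_density p (Suc n) w b = 2 * rig_density (eff_edge p n w b + eff_edge q n w b) (mid_pivot w b) * (seg_density p n w b * seg_density q n w b)"
proof -
  let ?E = "elim (seg_list p n @ seg_list q n) (Hpath w b)"
  have d: "seg_density p (Suc n) w b = 2 * rig_density (- (\<Sum>i\<in>L - {\<phi> q}. ?E i (\<phi> q))) (mid_pivot w b) * (seg_density p n w b * seg_density q n w b)"
    unfolding seg_density_def[of p "Suc n"] seg_list_Suc q[symmetric] density_both[symmetric]
    by (simp add: mid_pivot_def)
  show ?thesis
  proof (cases "pos_pivots (seg_list p n @ seg_list q n) (Hpath w b)")
    case False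
    then have "seg_density p n w b * seg_density q n w b = 0"
      unfolding density_both[symmetric] by (rule elim_density_eq_0)
    then show ?thesis by (simp add: d)
  next
    case True
    have ne: "\<phi> p \<noteq> \<phi> (q + 2 ^ n)" "\<phi> p \<noteq> \<phi> q" "\<phi> (q + 2 ^ n) \<noteq> \<phi> q"
      using phi_eq_iff[of p "q + 2 ^ n"] phi_eq_iff[of p q] phi_eq_iff[of "q + 2 ^ n" q] qR pow_pos
      by (auto simp: q)
    have inL: "\<phi> p \<in> L" "\<phi> (q + 2 ^ n) \<in> L" using range_L qR by (auto simp: q image_subset_iff)
    have zero: "?E i (\<phi> q) = 0" if "i \<in> L - {\<phi> q}" "i \<noteq> \<phi> p" "i \<noteq> \<phi> (q + 2 ^ n)" for i
    proof (cases "i \<in> set (seg_list p n @ seg_list q n)")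
      case i: True
      show ?thesis by (rule elim_zero_row[OF distinct_both True i])
    next
      case False
      have iv: "i \<noteq> \<phi> j" if pj: "p \<le> j" and jq: "j \<le> q + 2 ^ n" for j
      proof -
        consider "j = p" | "p < j" "j < q" | "j = q" | "q < j" "j < q + 2 ^ n" | "j = q + 2 ^ n"
          using pj jq by linarith
        then show ?thesis
          using \<open>i \<in> L - {\<phi> q}\<close> \<open>i \<noteq> \<phi> p\<close> \<open>i \<noteq> \<phi> (q + 2 ^ n)\<close> False
          by cases (auto simp: set_seg_list seg_vertices_def q)
      qed
      have "i \<notin> \<phi> ` {p..q + 2 ^ n}"
      proof
        assume "i \<in> \<phi> ` {p..q + 2 ^ n}"
        then obtain j where "i = \<phi> j" "p \<le> j" "j \<le> q + 2 ^ n" by auto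
        with iv[of j] show False by simp
      qed
      moreover have "{p..q} \<subseteq> {p..q + 2 ^ n}" "{q..q + 2 ^ n} \<subseteq> {p..q + 2 ^ n}" by (auto simp: q)
      ultimately have "i \<notin> \<phi> ` {p..q}" "i \<notin> \<phi> ` {q..q + 2 ^ n}" by blast+
      then have "?E i (\<phi> q) = Hpath w b i (\<phi> q)"
        using schur_outside(1)[of p n i w b, folded q] schur_outside(1)[of q n i w b] qR by (simp add: elim_both)
      also have "\<dots> = 0"
      proof (rule Hpath_inner_eq_0)
        have *: "p < q" "q < q + 2 ^ n" using pow_pos by (auto simp: q)
        then show "0 < q" "q < R" using qR by linarith+
        show "i \<noteq> \<phi> q" "i \<noteq> \<phi> (q - 1)" "i \<noteq> \<phi> (q + 1)" by (rule iv; use * in linarith)+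
      qed
      finally show ?thesis .
    qed
    have "(\<Sum>i\<in>L - {\<phi> q}. ?E i (\<phi> q)) = (\<Sum>i\<in>{\<phi> p, \<phi> (q + 2 ^ n)}. ?E i (\<phi> q))"
      by (rule sum.mono_neutral_right) (use finite_L inL ne zero in auto)
    also have "\<dots> = - eff_edge p n w b + ?E (\<phi> (q + 2 ^ n)) (\<phi> q)"
      using ne by (simp add: elim_both_left)
    also have "?E (\<phi> (q + 2 ^ n)) (\<phi> q) = ?E (\<phi> q) (\<phi> (q + 2 ^ n))"
      by (rule elim_sym) (rule Hpath_sym)
    finally show ?thesis unfolding d by (simp add: elim_both_right add.commute)
  qed
qed

lemma mid_pivot_fun_upd: "mid_pivot w (b(\<phi> q := y)) = (mid_pivot w b - 2 * b (\<phi> q)) + 2 * y"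
proof -
  have "\<phi> q \<notin> set (seg_list p n @ seg_list q n)"
  proof -
    have "\<phi> q \<noteq> \<phi> j" if "j \<in> {p<..<q} \<union> {q<..<q + 2 ^ n}" for j
      using that phi_eq_iff[of q j] qR by auto
    then show ?thesis unfolding set_append set_seg_list seg_vertices_def q[symmetric] by blast
  qed
  then have "mid_pivot w (b(\<phi> q := y)) = mid_pivot w b + (if \<phi> q = \<phi> q \<and> \<phi> q = \<phi> q then 2 * (y - b (\<phi> q)) else 0)"
    unfolding mid_pivot_def Hpath_def Hmat_fun_upd by (intro elim_add) auto
  then show ?thesis by simp
qed

end

text \<open>Changing weights and field elsewhere alters the matrix by a \<open>D\<close> that
  vanishes on the interior of the segment, so \<open>elim_add\<close> applies. Independence of
  different segments enters the proof in this form, through quantities that are functions of their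
  own coordinates.\<close>

lemma locality:
  assumes "p + 2 ^ n \<le> R" and w: "\<And>e. e \<in> seg_edges p n \<Longrightarrow> w' e = w e" and b: "\<And>v. v \<in> seg_vertices p n \<Longrightarrow> b' v = b v"
  shows "eff_edge p n w' b' = eff_edge p n w b" "seg_density p n w' b' = seg_density p n w b"
proof -
  define D where "D i j = Hpath w' b' i j - Hpath w b i j" for i j
  have H: "Hpath w' b' = (\<lambda>i j. Hpath w b i j + D i j)" by (simp add: D_def fun_eq_iff)
  have Dsym: "D i j = D j i" for i j by (simp add: D_def Hpath_sym[of _ _ i j])
  have D1: "D i j = 0" if i: "i \<in> seg_vertices p n" for i j
  proof -
    obtain s where s: "i = \<phi> s" "p < s" "s < p + 2 ^ n" using i by (auto simp: seg_vertices_def)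
    have "wmat Es w' i j = wmat Es w i j"
    proof (cases "{i, j} \<in> Es")
      case True
      then have "j = \<phi> (s - 1) \<or> j = \<phi> (s + 1)" using path_nbr[of s j] s assms(1) by auto
      then have "{i, j} \<in> seg_edges p n"
      proof
        assume j: "j = \<phi> (s - 1)"
        have "{i, j} = {\<phi> (s - 1), \<phi> (Suc (s - 1))}" using s j by auto
        moreover have "s - 1 \<in> {p..<p + 2 ^ n}" using s by auto
        ultimately show ?thesis unfolding seg_edges_def by blast
      next
        assume j: "j = \<phi> (s + 1)"
        have "{i, j} = {\<phi> s, \<phi> (Suc s)}" using s j by auto
        moreover have "s \<in> {p..<p + 2 ^ n}" using s by auto
        ultimately show ?thesis unfolding seg_edges_def by blast
      qed
      then show ?thesis using w by (simp add: wmat_def)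
    qed (simp add: wmat_def)
    then show ?thesis using b[OF i] by (auto simp: D_def Hpath_def Hmat_def)
  qed
  have D0: "D i j = 0" if "i \<in> set (seg_list p n) \<or> j \<in> set (seg_list p n)" for i j
    using that D1[of i j] D1[of j i] Dsym[of i j] by (auto simp: set_seg_list)
  show "seg_density p n w' b' = seg_density p n w b"
    unfolding seg_density_def H by (rule elim_density_add) (rule D0)
  \<comment> \<open>If the ends are adjacent, \<open>chordless\<close> forces 2^n = 1 and their edge
    belongs to the segment; otherwise the entry is 0 for both weight functions.\<close>
  have "D (\<phi> p) (\<phi> (p + 2 ^ n)) = 0"
  proof -
    have ne: "\<phi> p \<noteq> \<phi> (p + 2 ^ n)" using phi_eq_iff[of p "p + 2 ^ n"] assms(1) by auto
    have "wmat Es w' (\<phi> p) (\<phi> (p + 2 ^ n)) = wmat Es w (\<phi> p) (\<phi> (p + 2 ^ n))"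
    proof (cases "{\<phi> p, \<phi> (p + 2 ^ n)} \<in> Es")
      case True
      then have "p + 2 ^ n = Suc p" using chordless[of p "p + 2 ^ n"] assms(1) by auto
      then have "{\<phi> p, \<phi> (p + 2 ^ n)} \<in> seg_edges p n" by (auto simp: seg_edges_def)
      then show ?thesis using w by (simp add: wmat_def)
    qed (simp add: wmat_def)
    then show ?thesis using ne by (simp add: D_def Hpath_def Hmat_def)
  qed
  moreover have "schur p n w' b' i j = schur p n w b i j + D i j" for i j
    unfolding schur_def H by (rule elim_add) (rule D0)
  ultimately show "eff_edge p n w' b' = eff_edge p n w b" by (simp add: eff_edge_def)
qed

lemma measurable_Hpath:
  assumes "\<And>e. (\<lambda>x. W x e) \<in> borel_measurable N" "\<And>i. (\<lambda>x. B x i) \<in> borel_measurable N"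
  shows "(\<lambda>x. Hpath (W x) (B x) i j) \<in> borel_measurable N"
  unfolding Hpath_def by (rule measurable_Hmat) (use assms in \<open>auto simp: wmat_def\<close>)

lemma measurable_eff_edge:
  assumes "\<And>e. (\<lambda>x. W x e) \<in> borel_measurable N" "\<And>i. (\<lambda>x. B x i) \<in> borel_measurable N"
  shows "(\<lambda>x. eff_edge p n (W x) (B x)) \<in> borel_measurable N" "(\<lambda>x. seg_density p n (W x) (B x)) \<in> borel_measurable N"
  unfolding eff_edge_def schur_def seg_density_def
  by (intro borel_measurable_uminus measurable_elim measurable_elim_density measurable_Hpath assms)+

end

section \<open>Law of the effective weight of one segment\<close>

text \<open>Conditional mean of f (a b / X) given the two half weights.\<close>

definition rig_kernel :: "(real \<Rightarrow> ennreal) \<Rightarrow> real \<Rightarrow> real \<Rightarrow> ennreal" where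
  "rig_kernel f a b = (\<integral>\<^sup>+x. f (a * b / x) * ennreal (rig_density (a + b) x) \<partial>lborel)"

lemma measurable_rig_kernel:
  assumes [measurable]: "f \<in> borel_measurable borel" "g \<in> borel_measurable N" "h \<in> borel_measurable N"
  shows "(\<lambda>x. rig_kernel f (g x) (h x)) \<in> borel_measurable N"
proof -
  have [measurable]: "snd \<in> borel_measurable (N \<Otimes>\<^sub>M (lborel :: real measure))"
    using measurable_snd[of N "lborel :: real measure"] by simp
  have "(\<lambda>z. f (g (fst z) * h (fst z) / snd z) * ennreal (rig_density (g (fst z) + h (fst z)) (snd z)))
      \<in> borel_measurable (N \<Otimes>\<^sub>M lborel)"
    by measurable
  then show ?thesis
    unfolding rig_kernel_def
    using lborel.borel_measurable_nn_integral[of "\<lambda>x y. f (g x * h x / y) * ennreal (rig_density (g x + h x) y)" N]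
    by (simp add: case_prod_beta)
qed

lemma nn_integral_merge_law_kernel:
  assumes "pos_law \<mu>" "f \<in> borel_measurable borel"
  shows "(\<integral>\<^sup>+y. f y \<partial>merge_law \<mu>) = (\<integral>\<^sup>+a. \<integral>\<^sup>+b. rig_kernel f a b \<partial>\<mu> \<partial>\<mu>)"
  using nn_integral_merge_law[OF assms] by (simp add: rig_kernel_def)

context path_graph
begin

lemma finite_seg_vertices [simp]: "finite (seg_vertices p n)" and finite_seg_edges [simp]: "finite (seg_edges p n)"
  by (simp_all add: seg_vertices_def seg_edges_def)

lemma path_edge_eq_iff:
  assumes "i < R" "j < R"
  shows "{\<phi> i, \<phi> (Suc i)} = {\<phi> j, \<phi> (Suc j)} \<longleftrightarrow> i = j"
  using assms phi_eq_iff[of i j] phi_eq_iff[of i "Suc j"] phi_eq_iff[of "Suc i" j] phi_eq_iff[of "Suc i" "Suc j"]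
  by (auto simp: doubleton_eq_iff)

lemma seg_edges_Suc: "seg_edges p (Suc n) = seg_edges p n \<union> seg_edges (p + 2 ^ n) n"
proof -
  have "{p..<p + 2 ^ Suc n} = {p..<p + 2 ^ n} \<union> {p + 2 ^ n..<p + 2 ^ n + 2 ^ n}" by auto
  then show ?thesis by (simp add: seg_edges_def image_Un)
qed

lemma seg_edges_disjoint:
  assumes "p + 2 ^ n + 2 ^ n \<le> R"
  shows "seg_edges p n \<inter> seg_edges (p + 2 ^ n) n = {}"
proof -
  have "{\<phi> i, \<phi> (Suc i)} \<noteq> {\<phi> j, \<phi> (Suc j)}" if "i \<in> {p..<p + 2 ^ n}" "j \<in> {p + 2 ^ n..<p + 2 ^ n + 2 ^ n}" for i j
    using path_edge_eq_iff[of i j] that assms by auto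
  then show ?thesis unfolding seg_edges_def by blast
qed

lemma seg_vertices_Suc: "seg_vertices p (Suc n) = insert (\<phi> (p + 2 ^ n)) (seg_vertices p n \<union> seg_vertices (p + 2 ^ n) n)"
  using seg_list_Suc[of p n] by (simp flip: set_seg_list)

lemma seg_vertices_disjoint:
  assumes "p + 2 ^ n + 2 ^ n \<le> R"
  shows "\<phi> (p + 2 ^ n) \<notin> seg_vertices p n \<union> seg_vertices (p + 2 ^ n) n" "seg_vertices p n \<inter> seg_vertices (p + 2 ^ n) n = {}"
proof -
  have "distinct (seg_list p (Suc n))" by (rule distinct_seg_list) (use assms in simp)
  then show "\<phi> (p + 2 ^ n) \<notin> seg_vertices p n \<union> seg_vertices (p + 2 ^ n) n" "seg_vertices p n \<inter> seg_vertices (p + 2 ^ n) n = {}"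
    by (auto simp: seg_list_Suc set_seg_list)
qed

text \<open>By \<open>locality\<close> the field at the midpoint does not enter the quantities of
  the halves. The pivot is c + 2 y, and the substitution absorbs the factor 2 of the
  density.\<close>

lemma midpoint_integral:
  assumes qR: "p + 2 ^ n + 2 ^ n \<le> R" and f [measurable]: "f \<in> borel_measurable borel"
  shows "(\<integral>\<^sup>+y. f (eff_edge p (Suc n) w (b(\<phi> (p + 2 ^ n) := y))) * ennreal (seg_density p (Suc n) w (b(\<phi> (p + 2 ^ n) := y))) \<partial>lborel) =
    rig_kernel f (eff_edge p n w b) (eff_edge (p + 2 ^ n) n w b) * (ennreal (seg_density p n w b) * ennreal (seg_density (p + 2 ^ n) n w b))"
proof -
  define q where "q = p + 2 ^ n"
  have qR': "q + 2 ^ n \<le> R" using qR by (simp add: q_def)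
  note k = seg_vertices_disjoint(1)[OF qR, folded q_def]
  have e1: "eff_edge p n w (b(\<phi> q := y)) = eff_edge p n w b" "seg_density p n w (b(\<phi> q := y)) = seg_density p n w b" for y
    by (rule locality; use k qR in auto)+
  have e2: "eff_edge q n w (b(\<phi> q := y)) = eff_edge q n w b" "seg_density q n w (b(\<phi> q := y)) = seg_density q n w b" for y
    by (rule locality; use k qR' in auto)+
  define a1 a2 D where "a1 = eff_edge p n w b" "a2 = eff_edge q n w b" "D = ennreal (seg_density p n w b) * ennreal (seg_density q n w b)"
  define c where "c = mid_pivot p n q w b - 2 * b (\<phi> q)"
  have nn: "seg_density p n w b \<ge> 0" "seg_density q n w b \<ge> 0" by (simp_all add: seg_density_def)
  define g where "g x = f (a1 * a2 / x) * ennreal (rig_density (a1 + a2) x) * D" for x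
  have [measurable]: "g \<in> borel_measurable borel" unfolding g_def by measurable
  have "(\<integral>\<^sup>+y. f (eff_edge p (Suc n) w (b(\<phi> q := y))) * ennreal (seg_density p (Suc n) w (b(\<phi> q := y))) \<partial>lborel) =
     (\<integral>\<^sup>+y. 2 * g (c + 2 * y) \<partial>lborel)"
  proof (rule nn_integral_cong)
    fix y
    have "eff_edge p (Suc n) w (b(\<phi> q := y)) = a1 * a2 / (c + 2 * y)"
      unfolding eff_edge_Suc[OF q_def qR'] mid_pivot_fun_upd[OF q_def qR'] e1 e2 by (simp add: a1_a2_D_def c_def)
    moreover have "seg_density p (Suc n) w (b(\<phi> q := y)) = 2 * rig_density (a1 + a2) (c + 2 * y) * (seg_density p n w b * seg_density q n w b)"
      unfolding seg_density_Suc[OF q_def qR'] mid_pivot_fun_upd[OF q_def qR'] e1 e2 by (simp add: a1_a2_D_def c_def)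
    ultimately show "f (eff_edge p (Suc n) w (b(\<phi> q := y))) * ennreal (seg_density p (Suc n) w (b(\<phi> q := y))) = 2 * g (c + 2 * y)"
      using nn by (simp add: g_def a1_a2_D_def ennreal_mult' ennreal_mult mult_ac)
  qed
  also have "\<dots> = (\<integral>\<^sup>+x. g x \<partial>lborel)" by (rule nn_integral_affine_2) simp
  also have "\<dots> = rig_kernel f a1 a2 * D"
    unfolding g_def rig_kernel_def by (rule nn_integral_multc) simp
  finally show ?thesis by (simp add: a1_a2_D_def q_def)
qed

lemma measurable_PiM_eff_edge:
  assumes W: "W \<in> N \<rightarrow>\<^sub>M PiM I (\<lambda>_. \<mu>)" and B: "B \<in> N \<rightarrow>\<^sub>M RPi J"
    and \<mu>: "sets \<mu> = sets (borel :: real measure)"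
  shows "(\<lambda>x. eff_edge p n (W x) (B x)) \<in> borel_measurable N" "(\<lambda>x. seg_density p n (W x) (B x)) \<in> borel_measurable N"
    "(\<lambda>x. ennreal (seg_density p n (W x) (B x))) \<in> borel_measurable N"
  using measurable_PiM_any_component[OF W \<mu>] measurable_PiM_any_component[OF B]
  by (auto intro!: measurable_eff_edge measurable_compose[OF _ measurable_ennreal])

text \<open>Induction by bisection: the midpoint is integrated out, weights and field are split
  between the halves, and the hypothesis is applied to each half. It ranges over all test functions
  because the kernel with one argument fixed becomes the test function for the other half.\<close>

lemma segment_law:
  assumes \<mu>: "pos_law \<mu>" and "p + 2 ^ n \<le> R" and "f \<in> borel_measurable borel"
  shows "(\<integral>\<^sup>+w. \<integral>\<^sup>+b. f (eff_edge p n w b) * ennreal (seg_density p n w b)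
      \<partial>RPi (seg_vertices p n) \<partial>PiM (seg_edges p n) (\<lambda>_. \<mu>)) = (\<integral>\<^sup>+y. f y \<partial>(merge_law ^^ n) \<mu>)"
  using assms(2,3)
proof (induction n arbitrary: p f)
  case 0
  interpret M: prob_space \<mu> using \<mu> by (simp add: pos_law_def)
  interpret L: product_sigma_finite "\<lambda>_. lborel :: real measure" by standard
  interpret E: product_sigma_finite "\<lambda>_. \<mu>" by standard
  have V: "seg_vertices p 0 = {}" by (auto simp: seg_vertices_def)
  have Ed: "seg_edges p 0 = {{\<phi> p, \<phi> (Suc p)}}" by (auto simp: seg_edges_def)
  have pe: "{\<phi> p, \<phi> (Suc p)} \<in> Es" using 0 by (intro path_edge) auto
  have "\<phi> p \<noteq> \<phi> (Suc p)" using phi_eq_iff[of p "Suc p"] 0 by auto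
  then have eff_edge: "eff_edge p 0 w b = w {\<phi> p, \<phi> (Suc p)}" for w b
    using pe by (simp add: eff_edge_def schur_def seg_list_def Hpath_def Hmat_def wmat_def)
  have d: "seg_density p 0 w b = 1" for w b by (simp add: seg_density_def seg_list_def)
  have "(\<integral>\<^sup>+w. \<integral>\<^sup>+b. f (eff_edge p 0 w b) * ennreal (seg_density p 0 w b)
      \<partial>RPi (seg_vertices p 0) \<partial>PiM (seg_edges p 0) (\<lambda>_. \<mu>)) =
    (\<integral>\<^sup>+w. f (w {\<phi> p, \<phi> (Suc p)}) \<partial>PiM {{\<phi> p, \<phi> (Suc p)}} (\<lambda>_. \<mu>))"
    unfolding V Ed eff_edge d by (simp add: PiM_empty nn_integral_count_space_finite)
  also have "\<dots> = (\<integral>\<^sup>+y. f y \<partial>\<mu>)"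
    using 0 sets_pos_law[OF \<mu>] by (intro E.product_nn_integral_singleton) (simp cong: measurable_cong_sets)
  finally show ?case by simp
next
  case (Suc n)
  define q where "q = p + 2 ^ n"
  have qR: "p + 2 ^ n + 2 ^ n \<le> R" "q + 2 ^ n \<le> R" "p + 2 ^ n \<le> R" using Suc.prems by (auto simp: q_def)
  note f [measurable] = Suc.prems(2)
  note k = seg_vertices_disjoint[OF qR(1), folded q_def] and ed = seg_edges_disjoint[OF qR(1), folded q_def]
  interpret L: product_sigma_finite "\<lambda>_. lborel :: real measure" by standard
  note s\<mu> [measurable_cong] = sets_pos_law[OF \<mu>]
  interpret M: prob_space \<mu> using \<mu> by (simp add: pos_law_def)
  interpret E: product_sigma_finite "\<lambda>_. \<mu>" by standard
  define V1 V2 E1 E2 where "V1 = seg_vertices p n" "V2 = seg_vertices q n" "E1 = seg_edges p n" "E2 = seg_edges q n"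
  note sets = V1_V2_E1_E2_def
  have fin: "finite V1" "finite V2" "finite E1" "finite E2" by (simp_all add: sets)
  let ?V1 = "RPi V1" and ?V2 = "RPi V2" and ?V = "RPi (V1 \<union> V2)"
    and ?E1 = "PiM E1 (\<lambda>_. \<mu>)" and ?E2 = "PiM E2 (\<lambda>_. \<mu>)" and ?E = "PiM (E1 \<union> E2) (\<lambda>_. \<mu>)"
  define \<nu> where "\<nu> = (merge_law ^^ n) \<mu>"
  have \<nu>: "pos_law \<nu>" unfolding \<nu>_def by (rule pos_law_iterate[OF \<mu>])
  interpret N: prob_space \<nu> using \<nu> by (simp add: pos_law_def)
  note s\<nu> [measurable_cong] = sets_pos_law[OF \<nu>]
  interpret PV1: sigma_finite_measure "?V1" by (rule L.sigma_finite) (rule fin)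
  interpret PV2: sigma_finite_measure "?V2" by (rule L.sigma_finite) (rule fin)
  interpret PV: sigma_finite_measure "?V" by (rule L.sigma_finite) (use fin in auto)
  interpret PE2: sigma_finite_measure "?E2" by (rule E.sigma_finite) (rule fin)
  note mk = measurable_rig_kernel[OF f]
  define F1 where "F1 w b = ennreal (seg_density p n w b)" for w b
  define F2 where "F2 w b = ennreal (seg_density q n w b)" for w b
  define a1 where "a1 w b = eff_edge p n w b" for w b
  define a2 where "a2 w b = eff_edge q n w b" for w b
  have loc1: "a1 w b = a1 w' b'" "F1 w b = F1 w' b'"
    if "\<And>e. e \<in> E1 \<Longrightarrow> w e = w' e" "\<And>v. v \<in> V1 \<Longrightarrow> b v = b' v" for w w' b b'
    unfolding a1_def F1_def using locality[OF qR(3), of w w' b b'] that by (auto simp: sets)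
  have loc2: "a2 w b = a2 w' b'" "F2 w b = F2 w' b'"
    if "\<And>e. e \<in> E2 \<Longrightarrow> w e = w' e" "\<And>v. v \<in> V2 \<Longrightarrow> b v = b' v" for w w' b b'
    unfolding a2_def F2_def using locality[OF qR(2), of w w' b b'] that by (auto simp: sets)
  define H where "H w b = rig_kernel f (a1 w b) (a2 w b) * (F1 w b * F2 w b)" for w b
  define H2 where "H2 w1 w2 b1 b2 = rig_kernel f (a1 w1 b1) (a2 w2 b2) * (F1 w1 b1 * F2 w2 b2)" for w1 w2 b1 b2
  have "(\<integral>\<^sup>+w. \<integral>\<^sup>+b. f (eff_edge p (Suc n) w b) * ennreal (seg_density p (Suc n) w b)
      \<partial>RPi (seg_vertices p (Suc n)) \<partial>PiM (seg_edges p (Suc n)) (\<lambda>_. \<mu>)) =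
     (\<integral>\<^sup>+w. \<integral>\<^sup>+b. H w b \<partial>?V \<partial>?E)"
    unfolding seg_edges_Suc q_def[symmetric] sets(3,4)
  proof (rule nn_integral_cong, goal_cases)
    case w: (1 w)
    have m: "(\<lambda>b. f (eff_edge p (Suc n) w b) * ennreal (seg_density p (Suc n) w b)) \<in>
       borel_measurable (RPi (insert (\<phi> q) (V1 \<union> V2)))"
    proof -
      have "(\<lambda>_. w) \<in> RPi (insert (\<phi> q) (V1 \<union> V2)) \<rightarrow>\<^sub>M PiM (seg_edges p n \<union> seg_edges q n) (\<lambda>_. \<mu>)"
        using w by simp
      from measurable_PiM_eff_edge[OF this measurable_ident_sets[OF refl] s\<mu>, of p "Suc n"]
      show ?thesis by measurable
    qed
    have "(\<integral>\<^sup>+b. f (eff_edge p (Suc n) w b) * ennreal (seg_density p (Suc n) w b) \<partial>RPi (seg_vertices p (Suc n))) =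
      (\<integral>\<^sup>+b. \<integral>\<^sup>+y. f (eff_edge p (Suc n) w (b(\<phi> q := y))) * ennreal (seg_density p (Suc n) w (b(\<phi> q := y))) \<partial>lborel \<partial>?V)"
      unfolding seg_vertices_Suc q_def[symmetric] sets(1,2)
      by (rule L.product_nn_integral_insert) (use k m in \<open>auto simp: sets\<close>)
    also have "\<dots> = (\<integral>\<^sup>+b. H w b \<partial>?V)"
      using midpoint_integral[OF qR(1) f, folded q_def]
      by (simp add: H_def a1_def a2_def F1_def F2_def)
    finally show ?case .
  qed
  also have "\<dots> = (\<integral>\<^sup>+w1. \<integral>\<^sup>+w2. \<integral>\<^sup>+b. H (merge E1 E2 (w1, w2)) b \<partial>?V
      \<partial>?E2 \<partial>?E1)"
  proof (rule E.product_nn_integral_fold)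
    have "(\<lambda>z. H (fst z) (snd z)) \<in> borel_measurable (?E \<Otimes>\<^sub>M ?V)"
      unfolding H_def a1_def a2_def F1_def F2_def
      by (intro borel_measurable_times_ennreal mk measurable_PiM_eff_edge[OF measurable_fst measurable_snd s\<mu>])
    then show "(\<lambda>w. \<integral>\<^sup>+b. H w b \<partial>?V) \<in> borel_measurable ?E"
      using PV.borel_measurable_nn_integral[of H] by (simp add: case_prod_beta)
  qed (use fin ed in \<open>auto simp: sets\<close>)
  also have "\<dots> = (\<integral>\<^sup>+w1. \<integral>\<^sup>+w2. \<integral>\<^sup>+b1. \<integral>\<^sup>+b2. H2 w1 w2 b1 b2 \<partial>?V2 \<partial>?V1
      \<partial>?E2 \<partial>?E1)"
  proof (intro nn_integral_cong, goal_cases)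
    case w: (1 w1 w2)
    define w where "w = merge E1 E2 (w1, w2)"
    have wm: "(\<lambda>_. w) \<in> ?V \<rightarrow>\<^sub>M ?E"
      unfolding w_def using w measurable_space[OF measurable_merge[of E1 E2 "\<lambda>_. \<mu>"], of "(w1, w2)"]
      by (simp add: space_pair_measure)
    have "(\<integral>\<^sup>+b. H w b \<partial>?V) =
      (\<integral>\<^sup>+b1. \<integral>\<^sup>+b2. H w (merge V1 V2 (b1, b2)) \<partial>?V2 \<partial>?V1)"
    proof (rule L.product_nn_integral_fold)
      show "H w \<in> borel_measurable ?V"
        unfolding H_def a1_def a2_def F1_def F2_def
        by (intro borel_measurable_times_ennreal mk measurable_PiM_eff_edge[OF wm measurable_ident_sets[OF refl] s\<mu>])
    qed (use fin k in \<open>auto simp: sets\<close>)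
    also have "\<dots> = (\<integral>\<^sup>+b1. \<integral>\<^sup>+b2. H2 w1 w2 b1 b2 \<partial>?V2 \<partial>?V1)"
    proof (intro nn_integral_cong)
      fix b1 b2 :: "'x \<Rightarrow> real"
      have "w e = w1 e" if "e \<in> E1" for e using that by (simp add: w_def merge_def)
      moreover have "w e = w2 e" if "e \<in> E2" for e using that ed by (auto simp: w_def merge_def sets)
      moreover have "merge V1 V2 (b1, b2) v = b1 v" if "v \<in> V1" for v using that by (simp add: merge_def)
      moreover have "merge V1 V2 (b1, b2) v = b2 v" if "v \<in> V2" for v using that k by (auto simp: merge_def sets)
      ultimately show "H w (merge V1 V2 (b1, b2)) = H2 w1 w2 b1 b2"
        unfolding H_def H2_def using loc1[of w w1 "merge V1 V2 (b1, b2)" b1] loc2[of w w2 "merge V1 V2 (b1, b2)" b2]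
        by simp
    qed
    finally show ?case by (simp add: w_def)
  qed
  \<comment> \<open>The weights and the field of the right half are brought together, because the
    induction hypothesis treats them as one double integral.\<close>
  also have "\<dots> = (\<integral>\<^sup>+w1. \<integral>\<^sup>+b1. \<integral>\<^sup>+w2. \<integral>\<^sup>+b2. H2 w1 w2 b1 b2 \<partial>?V2 \<partial>?E2
      \<partial>?V1 \<partial>?E1)"
  proof (rule nn_integral_cong, goal_cases)
    case w1: (1 w1)
    interpret P: pair_sigma_finite "?V1" "?E2" by standard
    let ?X = "(?V1 \<Otimes>\<^sub>M ?E2) \<Otimes>\<^sub>M ?V2"
    have "(\<lambda>z. H2 w1 (snd (fst z)) (fst (fst z)) (snd z)) \<in> borel_measurable ?X"
    proof -
      have 1: "(\<lambda>_. w1) \<in> ?X \<rightarrow>\<^sub>M ?E1" using w1 by simp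
      have 2: "(\<lambda>z. snd (fst z)) \<in> ?X \<rightarrow>\<^sub>M ?E2" "(\<lambda>z. fst (fst z)) \<in> ?X \<rightarrow>\<^sub>M ?V1"
        "snd \<in> ?X \<rightarrow>\<^sub>M ?V2" by measurable
      show ?thesis unfolding H2_def a1_def a2_def F1_def F2_def
        by (intro borel_measurable_times_ennreal mk measurable_PiM_eff_edge[OF 1 2(2) s\<mu>] measurable_PiM_eff_edge[OF 2(1,3) s\<mu>])
    qed
    then have "(\<lambda>x. \<integral>\<^sup>+b2. H2 w1 (snd x) (fst x) b2 \<partial>?V2) \<in>
        borel_measurable (?V1 \<Otimes>\<^sub>M ?E2)"
      using PV2.borel_measurable_nn_integral[of "\<lambda>x b2. H2 w1 (snd x) (fst x) b2"]
      by (simp add: case_prod_beta)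
    then show ?case
      by (intro P.Fubini') (simp add: case_prod_beta)
  qed
  also have "\<dots> = (\<integral>\<^sup>+w1. \<integral>\<^sup>+b1. (\<integral>\<^sup>+y. rig_kernel f (a1 w1 b1) y \<partial>\<nu>) * F1 w1 b1
      \<partial>?V1 \<partial>?E1)"
  proof (intro nn_integral_cong, goal_cases)
    case (1 w1 b1)
    have mX: "(\<lambda>z. rig_kernel f (a1 w1 b1) (a2 (fst z) (snd z)) * F2 (fst z) (snd z)) \<in>
        borel_measurable (?E2 \<Otimes>\<^sub>M ?V2)"
      unfolding a2_def F2_def
      by (intro borel_measurable_times_ennreal mk measurable_PiM_eff_edge[OF measurable_fst measurable_snd s\<mu>]) simp
    have mW: "(\<lambda>b2. rig_kernel f (a1 w1 b1) (a2 w2 b2) * F2 w2 b2) \<in> borel_measurable ?V2"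
      if "w2 \<in> space ?E2" for w2
    proof -
      have "(\<lambda>_. w2) \<in> ?V2 \<rightarrow>\<^sub>M ?E2" using that by simp
      from measurable_PiM_eff_edge[OF this measurable_ident_sets[OF refl] s\<mu>]
      show ?thesis unfolding a2_def F2_def by (intro borel_measurable_times_ennreal mk) simp_all
    qed
    have "(\<integral>\<^sup>+w2. \<integral>\<^sup>+b2. H2 w1 w2 b1 b2 \<partial>?V2 \<partial>?E2) =
       (\<integral>\<^sup>+w2. (\<integral>\<^sup>+b2. rig_kernel f (a1 w1 b1) (a2 w2 b2) * F2 w2 b2 \<partial>?V2) * F1 w1 b1 \<partial>?E2)"
    proof (rule nn_integral_cong, goal_cases)
      case w2: (1 w2)
      have "(\<integral>\<^sup>+b2. H2 w1 w2 b1 b2 \<partial>?V2) =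
          (\<integral>\<^sup>+b2. rig_kernel f (a1 w1 b1) (a2 w2 b2) * F2 w2 b2 * F1 w1 b1 \<partial>?V2)"
        by (intro nn_integral_cong) (simp add: H2_def mult_ac)
      also have "\<dots> = (\<integral>\<^sup>+b2. rig_kernel f (a1 w1 b1) (a2 w2 b2) * F2 w2 b2 \<partial>?V2) * F1 w1 b1"
        by (rule nn_integral_multc) (rule mW[OF w2])
      finally show ?case .
    qed
    also have "\<dots> = (\<integral>\<^sup>+w2. \<integral>\<^sup>+b2. rig_kernel f (a1 w1 b1) (a2 w2 b2) * F2 w2 b2 \<partial>?V2 \<partial>?E2) * F1 w1 b1"
      using PV2.borel_measurable_nn_integral[of "\<lambda>w2 b2. rig_kernel f (a1 w1 b1) (a2 w2 b2) * F2 w2 b2"] mX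
      by (intro nn_integral_multc) (simp add: case_prod_beta)
    also have "(\<integral>\<^sup>+w2. \<integral>\<^sup>+b2. rig_kernel f (a1 w1 b1) (a2 w2 b2) * F2 w2 b2 \<partial>?V2 \<partial>?E2) =
       (\<integral>\<^sup>+y. rig_kernel f (a1 w1 b1) y \<partial>\<nu>)"
      unfolding a2_def F2_def sets \<nu>_def using qR(2) by (intro Suc.IH mk) simp_all
    finally show ?case .
  qed
  \<comment> \<open>The left half, with the kernel already averaged over the right half as test
    function.\<close>
  also have "\<dots> = (\<integral>\<^sup>+x. (\<integral>\<^sup>+y. rig_kernel f x y \<partial>\<nu>) \<partial>\<nu>)"
    unfolding a1_def F1_def sets \<nu>_def[symmetric]
  proof (unfold \<nu>_def, rule Suc.IH[OF qR(3)], fold \<nu>_def)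
    have "snd \<in> borel_measurable (borel \<Otimes>\<^sub>M \<nu>)"
      using measurable_snd[of borel \<nu>] s\<nu> by (simp cong: measurable_cong_sets)
    then have "(\<lambda>z. rig_kernel f (fst z) (snd z)) \<in> borel_measurable (borel \<Otimes>\<^sub>M \<nu>)"
      by (intro mk measurable_fst)
    then show "(\<lambda>x. \<integral>\<^sup>+y. rig_kernel f x y \<partial>\<nu>) \<in> borel_measurable borel"
      using N.borel_measurable_nn_integral[of "rig_kernel f"] by (simp add: case_prod_beta)
  qed
  also have "\<dots> = (\<integral>\<^sup>+y. f y \<partial>merge_law \<nu>)"
    by (rule nn_integral_merge_law_kernel[OF \<nu> f, symmetric])
  finally show ?case by (simp add: \<nu>_def)
qed

end

section \<open>Passage from the whole field to one segment\<close>

lemma measurable_wmat: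
  assumes "W \<in> N \<rightarrow>\<^sub>M PiM I (\<lambda>_. \<mu>)" "sets \<mu> = sets (borel :: real measure)"
  shows "(\<lambda>x. wmat Es (W x) i j) \<in> borel_measurable N"
  using measurable_PiM_any_component[OF assms] by (auto simp: wmat_def)

lemma measurable_Hmat_wmat:
  assumes W: "W \<in> N \<rightarrow>\<^sub>M PiM I (\<lambda>_. \<mu>)" "sets \<mu> = sets (borel :: real measure)"
    and B: "B \<in> N \<rightarrow>\<^sub>M RPi J"
  shows "(\<lambda>x. Hmat (wmat Es (W x)) (B x) i j) \<in> borel_measurable N"
  by (intro measurable_Hmat measurable_wmat[OF W] measurable_PiM_any_component[OF B]) simp

text \<open>Measurability is read off from the product form, which avoids the quantifier over all
  vectors in \<open>posdef_on\<close>.\<close>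

lemma measurable_nu_density:
  assumes "finite L" and W: "W \<in> N \<rightarrow>\<^sub>M PiM I (\<lambda>_. \<mu>)" "sets \<mu> = sets (borel :: real measure)"
    and B: "B \<in> N \<rightarrow>\<^sub>M RPi J"
  shows "(\<lambda>x. nu_density L (wmat Es (W x)) (B x)) \<in> borel_measurable N"
proof -
  obtain ks where ks: "set ks = L" "distinct ks" using finite_distinct_list[OF \<open>finite L\<close>] by blast
  have "nu_density L (wmat Es w) b = elim_density L ks (Hmat (wmat Es w) b)" for w b
    by (rule nu_density_eq_elim_density) (use ks wmat_sym in auto)
  then show ?thesis
    by (simp add: measurable_elim_density measurable_Hmat_wmat[OF W B])
qed

text \<open>The segment stands at the end of the list, so its interior is eliminated first and the
  field elsewhere integrates to 1; the weights elsewhere drop out as further factors of a product of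
  probability measures.\<close>

lemma (in path_graph) path_law:
  assumes \<mu>: "pos_law \<mu>" and pR: "p + 2 ^ n \<le> R" and f: "f \<in> borel_measurable borel"
  shows "(\<integral>\<^sup>+w. \<integral>\<^sup>+b. f (eff_edge p n w b) * ennreal (nu_density L (wmat Es w) b)
      \<partial>RPi L \<partial>PiM Es (\<lambda>_. \<mu>)) = (\<integral>\<^sup>+y. f y \<partial>(merge_law ^^ n) \<mu>)"
proof -
  note s\<mu> = sets_pos_law[OF \<mu>]
  interpret M: prob_space \<mu> using \<mu> by (simp add: pos_law_def)
  interpret L: product_sigma_finite "\<lambda>_. lborel :: real measure" by standard
  interpret E: product_prob_space "\<lambda>_. \<mu>" by standard
  have seg_vertices_L: "seg_vertices p n \<subseteq> L" using range_L pR by (auto simp: seg_vertices_def)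
  have seg_edges_Es: "seg_edges p n \<subseteq> Es" using path_edge pR by (auto simp: seg_edges_def)
  obtain ks where ks: "set ks = L - seg_vertices p n" "distinct ks"
    using finite_distinct_list[of "L - seg_vertices p n"] finite_L by auto
  have full: "distinct (ks @ seg_list p n)" "set (ks @ seg_list p n) = L"
    using ks seg_vertices_L distinct_seg_list[OF pR] by (auto simp: set_seg_list)
  define F where "F w = (\<integral>\<^sup>+b. f (eff_edge p n w b) * ennreal (seg_density p n w b) \<partial>RPi (seg_vertices p n))" for w
  have inner: "(\<integral>\<^sup>+b. f (eff_edge p n w b) * ennreal (nu_density L (wmat Es w) b) \<partial>RPi L) = F w"
    if pos: "\<And>e. e \<in> Es \<Longrightarrow> w e \<ge> 0" and w: "w \<in> space (PiM Es (\<lambda>_. \<mu>))" for w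
  proof -
    have "f (eff_edge p n w b) * ennreal (nu_density L (wmat Es w) b) =
        f (eff_edge p n w (restrict b (set (seg_list p n)))) * ennreal (elim_density L (ks @ seg_list p n) (Hmat (wmat Es w) b))" for b
    proof -
      have "eff_edge p n w (restrict b (set (seg_list p n))) = eff_edge p n w b"
        by (rule locality) (use pR in \<open>auto simp: set_seg_list\<close>)
      moreover have "nu_density L (wmat Es w) b = elim_density L (ks @ seg_list p n) (Hmat (wmat Es w) b)"
        by (rule nu_density_eq_elim_density) (use full wmat_sym in auto)
      ultimately show ?thesis by (simp only:)
    qed
    then have "(\<integral>\<^sup>+b. f (eff_edge p n w b) * ennreal (nu_density L (wmat Es w) b) \<partial>RPi L) =
      (\<integral>\<^sup>+b. f (eff_edge p n w (restrict b (set (seg_list p n)))) * ennreal (elim_density L (ks @ seg_list p n) (Hmat (wmat Es w) b))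
        \<partial>RPi (set (ks @ seg_list p n)))"
      unfolding full(2) by (rule nn_integral_cong)
    also have "\<dots> = (\<integral>\<^sup>+b. f (eff_edge p n w b) * ennreal (elim_density L (seg_list p n) (Hmat (wmat Es w) b))
        \<partial>RPi (set (seg_list p n)))"
    proof (rule elim_density_marginal[OF wmat_sym _ full(1)])
      show "wmat Es w i j \<ge> 0" for i j using pos by (simp add: wmat_def)
      have "(\<lambda>_. w) \<in> RPi (set (seg_list p n)) \<rightarrow>\<^sub>M PiM Es (\<lambda>_. \<mu>)" using w by simp
      from measurable_PiM_eff_edge(1)[OF this measurable_ident_sets[OF refl] s\<mu>]
      show "(\<lambda>b. f (eff_edge p n w b)) \<in> borel_measurable (RPi (set (seg_list p n)))"
        by (rule measurable_compose[OF _ f])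
    qed
    finally show ?thesis unfolding F_def seg_density_def Hpath_def set_seg_list .
  qed
  \<comment> \<open>Marginalizing the field uses nonnegative weights, which under the product law
    holds almost surely.\<close>
  have "AE w in PiM Es (\<lambda>_. \<mu>). \<forall>e\<in>Es. w e > 0"
  proof (rule AE_finite_allI[OF finite_Es])
    fix e assume e: "e \<in> Es"
    show "AE w in PiM Es (\<lambda>_. \<mu>). w e > 0"
      by (rule AE_PiM_component) (use e AE_pos_law[OF \<mu>] M.prob_space_axioms in auto)
  qed
  then have "(\<integral>\<^sup>+w. \<integral>\<^sup>+b. f (eff_edge p n w b) * ennreal (nu_density L (wmat Es w) b)
      \<partial>RPi L \<partial>PiM Es (\<lambda>_. \<mu>)) = (\<integral>\<^sup>+w. F w \<partial>PiM Es (\<lambda>_. \<mu>))"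
  proof (intro nn_integral_cong_AE, elim AE_mp, intro AE_I2 impI)
    fix w assume "w \<in> space (PiM Es (\<lambda>_. \<mu>))" "\<forall>e\<in>Es. w e > 0"
    then show "(\<integral>\<^sup>+b. f (eff_edge p n w b) * ennreal (nu_density L (wmat Es w) b) \<partial>RPi L) = F w"
      by (intro inner less_imp_le) auto
  qed
  also have "\<dots> = (\<integral>\<^sup>+w. F (restrict w (seg_edges p n)) \<partial>PiM Es (\<lambda>_. \<mu>))"
  proof (rule nn_integral_cong)
    fix w
    have "eff_edge p n (restrict w (seg_edges p n)) b = eff_edge p n w b" "seg_density p n (restrict w (seg_edges p n)) b = seg_density p n w b" for b
      by (rule locality; use pR in auto)+
    then show "F w = F (restrict w (seg_edges p n))" by (simp only: F_def)
  qed
  also have "\<dots> = (\<integral>\<^sup>+w. F w \<partial>PiM (seg_edges p n) (\<lambda>_. \<mu>))"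
  proof -
    interpret V: sigma_finite_measure "RPi (seg_vertices p n)" by (rule L.sigma_finite) simp
    have "(\<lambda>z. f (eff_edge p n (fst z) (snd z)) * ennreal (seg_density p n (fst z) (snd z))) \<in>
        borel_measurable (PiM (seg_edges p n) (\<lambda>_. \<mu>) \<Otimes>\<^sub>M RPi (seg_vertices p n))"
      by (intro borel_measurable_times_ennreal measurable_compose[OF _ f]
          measurable_PiM_eff_edge[OF measurable_fst measurable_snd s\<mu>])
    then have F: "F \<in> borel_measurable (PiM (seg_edges p n) (\<lambda>_. \<mu>))"
      unfolding F_def
      using V.borel_measurable_nn_integral[of "\<lambda>w b. f (eff_edge p n w b) * ennreal (seg_density p n w b)"]
      by (simp add: case_prod_beta)
    show ?thesis
      by (subst E.distr_restrict[OF seg_edges_Es finite_Es], subst nn_integral_distr)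
         (use F seg_edges_Es in \<open>auto intro: measurable_restrict_subset\<close>)
  qed
  also have "\<dots> = (\<integral>\<^sup>+y. f y \<partial>(merge_law ^^ n) \<mu>)"
    unfolding F_def by (rule segment_law[OF \<mu> pR f])
  finally show ?thesis .
qed

text \<open>The conditional law is prescribed through rectangles. These form an intersection-stable
  generator of the product sigma-algebra, so the joint law \<open>J\<close> coincides with the law
  \<open>K\<close> of density \<open>nu\<close>.\<close>

lemma joint_law:
  fixes Wf :: "'a \<Rightarrow> 'x set \<Rightarrow> real" and \<beta> :: "'a \<Rightarrow> 'x \<Rightarrow> real" and L :: "'x set" and Es :: "'x set set"
  assumes M: "prob_space M" and L: "finite L" and Es: "finite Es"
    and W_law: "distr M (PiM Es (\<lambda>_. \<mu>)) (\<lambda>\<omega>. restrict (Wf \<omega>) Es) = PiM Es (\<lambda>_. \<mu>)"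
    and W_meas: "(\<lambda>\<omega>. restrict (Wf \<omega>) Es) \<in> M \<rightarrow>\<^sub>M PiM Es (\<lambda>_. \<mu>)"
    and \<mu>: "pos_law \<mu>"
    and \<beta>_meas: "(\<lambda>\<omega>. restrict (\<beta> \<omega>) L) \<in> M \<rightarrow>\<^sub>M RPi L"
    and \<beta>_cond: "\<forall>A\<in>sets (RPi Es). \<forall>B\<in>sets (RPi L).
       emeasure M {\<omega>\<in>space M. restrict (Wf \<omega>) Es \<in> A \<and> restrict (\<beta> \<omega>) L \<in> B}
       = (\<integral>\<^sup>+\<omega>. indicator {\<omega>. restrict (Wf \<omega>) Es \<in> A} \<omega> * emeasure (nu_law L (wmat Es (Wf \<omega>))) B \<partial>M)"
    and F: "F \<in> borel_measurable (PiM Es (\<lambda>_. \<mu>) \<Otimes>\<^sub>M RPi L)"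
  shows "(\<integral>\<^sup>+\<omega>. F (restrict (Wf \<omega>) Es, restrict (\<beta> \<omega>) L) \<partial>M) =
    (\<integral>\<^sup>+w. \<integral>\<^sup>+b. F (w, b) * ennreal (nu_density L (wmat Es w) b) \<partial>RPi L \<partial>PiM Es (\<lambda>_. \<mu>))"
proof -
  let ?PE = "PiM Es (\<lambda>_. \<mu>)" and ?PL = "RPi L"
  note s\<mu> = sets_pos_law[OF \<mu>]
  interpret M: prob_space M by fact
  interpret \<mu>: prob_space \<mu> using \<mu> by (simp add: pos_law_def)
  interpret LL: product_sigma_finite "\<lambda>_. lborel :: real measure" by standard
  interpret PL: sigma_finite_measure ?PL by (rule LL.sigma_finite) (rule L)
  define J where "J = distr M (?PE \<Otimes>\<^sub>M ?PL) (\<lambda>\<omega>. (restrict (Wf \<omega>) Es, restrict (\<beta> \<omega>) L))"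
  define nu where "nu z = ennreal (nu_density L (wmat Es (fst z)) (snd z))" for z
  define K where "K = density (?PE \<Otimes>\<^sub>M ?PL) nu"
  have nu [measurable]: "nu \<in> borel_measurable (?PE \<Otimes>\<^sub>M ?PL)"
    unfolding nu_def
    by (intro measurable_compose[OF _ measurable_ennreal] measurable_nu_density[OF L measurable_fst s\<mu> measurable_snd])
  have WB [measurable]: "(\<lambda>\<omega>. (restrict (Wf \<omega>) Es, restrict (\<beta> \<omega>) L)) \<in> M \<rightarrow>\<^sub>M ?PE \<Otimes>\<^sub>M ?PL"
    by (intro measurable_Pair W_meas \<beta>_meas)
  have nn_K: "(\<integral>\<^sup>+z. G z \<partial>K) = (\<integral>\<^sup>+w. \<integral>\<^sup>+b. G (w, b) * nu (w, b) \<partial>?PL \<partial>?PE)"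
    if G [measurable]: "G \<in> borel_measurable (?PE \<Otimes>\<^sub>M ?PL)" for G
  proof -
    have "(\<integral>\<^sup>+z. G z \<partial>K) = (\<integral>\<^sup>+z. G z * nu z \<partial>(?PE \<Otimes>\<^sub>M ?PL))"
      unfolding K_def by (subst nn_integral_density) (auto simp: mult.commute)
    also have "\<dots> = (\<integral>\<^sup>+w. \<integral>\<^sup>+b. G (w, b) * nu (w, b) \<partial>?PL \<partial>?PE)"
      by (rule PL.nn_integral_fst[symmetric]) measurable
    finally show ?thesis .
  qed
  have rect: "emeasure J (A \<times> B) = emeasure K (A \<times> B)"
    if A: "A \<in> sets ?PE" and B: "B \<in> sets ?PL" for A B
  proof -
    have AL: "A \<in> sets (RPi Es)"
      using A s\<mu> by (simp cong: sets_PiM_cong)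
    define h where "h w = indicator A w * (\<integral>\<^sup>+b. indicator B b * nu (w, b) \<partial>?PL)" for w
    have h: "h \<in> borel_measurable ?PE"
      unfolding h_def
      using PL.borel_measurable_nn_integral[of "\<lambda>w b. indicator B b * nu (w, b)" ?PE] A B
      by (simp add: case_prod_beta')
    have nul: "emeasure (nu_law L (wmat Es w)) B = (\<integral>\<^sup>+b. indicator B b * nu (w, b) \<partial>?PL)"
      if w: "w \<in> space ?PE" for w
    proof -
      have "(\<lambda>b. nu (w, b)) \<in> borel_measurable ?PL" using w nu by measurable
      then show ?thesis
        unfolding nu_law_def using B
        by (subst emeasure_density) (auto simp: nu_def mult.commute)
    qed
    have "emeasure J (A \<times> B) = emeasure M {\<omega>\<in>space M. restrict (Wf \<omega>) Es \<in> A \<and> restrict (\<beta> \<omega>) L \<in> B}"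
      unfolding J_def using A B
      by (subst emeasure_distr[OF WB]) (auto intro!: arg_cong[of _ _ "emeasure M"])
    also have "\<dots> = (\<integral>\<^sup>+\<omega>. indicator {\<omega>. restrict (Wf \<omega>) Es \<in> A} \<omega> * emeasure (nu_law L (wmat Es (Wf \<omega>))) B \<partial>M)"
      using \<beta>_cond AL B by blast
    also have "\<dots> = (\<integral>\<^sup>+\<omega>. h (restrict (Wf \<omega>) Es) \<partial>M)"
    proof (rule nn_integral_cong)
      fix \<omega> assume "\<omega> \<in> space M"
      then have "restrict (Wf \<omega>) Es \<in> space ?PE" by (rule measurable_space[OF W_meas])
      moreover have "wmat Es (Wf \<omega>) = wmat Es (restrict (Wf \<omega>) Es)" by (auto simp: wmat_def fun_eq_iff)
      ultimately show "indicator {\<omega>. restrict (Wf \<omega>) Es \<in> A} \<omega> * emeasure (nu_law L (wmat Es (Wf \<omega>))) B =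
        h (restrict (Wf \<omega>) Es)"
        unfolding h_def using nul[of "restrict (Wf \<omega>) Es"] by (simp add: indicator_def)
    qed
    also have "\<dots> = (\<integral>\<^sup>+w. h w \<partial>distr M ?PE (\<lambda>\<omega>. restrict (Wf \<omega>) Es))"
      by (subst nn_integral_distr[OF W_meas]) (use h in simp_all)
    also have "\<dots> = (\<integral>\<^sup>+w. h w \<partial>?PE)" by (simp only: W_law)
    also have "\<dots> = (\<integral>\<^sup>+w. \<integral>\<^sup>+b. indicator (A \<times> B) (w, b) * nu (w, b) \<partial>?PL \<partial>?PE)"
      unfolding h_def by (intro nn_integral_cong) (auto simp: indicator_def)
    also have "\<dots> = (\<integral>\<^sup>+z. indicator (A \<times> B) z \<partial>K)"
      by (rule nn_K[symmetric]) (use A B in auto)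
    also have "\<dots> = emeasure K (A \<times> B)"
      using A B by (intro nn_integral_indicator) (auto simp: K_def)
    finally show ?thesis .
  qed
  have "J = K"
  proof (rule measure_eqI_generator_eq[OF Int_stable_pair_measure_generator pair_measure_closed])
    show "emeasure J X = emeasure K X" if "X \<in> {a \<times> b |a b. a \<in> sets ?PE \<and> b \<in> sets ?PL}" for X
      using that rect by blast
    show "sets J = sigma_sets (space ?PE \<times> space ?PL) {a \<times> b |a b. a \<in> sets ?PE \<and> b \<in> sets ?PL}"
      "sets K = sigma_sets (space ?PE \<times> space ?PL) {a \<times> b |a b. a \<in> sets ?PE \<and> b \<in> sets ?PL}"
      by (simp_all add: J_def K_def sets_pair_measure)
    show "range (\<lambda>_::nat. space ?PE \<times> space ?PL) \<subseteq> {a \<times> b |a b. a \<in> sets ?PE \<and> b \<in> sets ?PL}" by auto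
    show "(\<Union>i::nat. space ?PE \<times> space ?PL) = space ?PE \<times> space ?PL" by simp
    interpret JP: prob_space J unfolding J_def by (rule M.prob_space_distr[OF WB])
    show "emeasure J (space ?PE \<times> space ?PL) \<noteq> \<infinity>" by simp
  qed
  have "(\<integral>\<^sup>+\<omega>. F (restrict (Wf \<omega>) Es, restrict (\<beta> \<omega>) L) \<partial>M) = (\<integral>\<^sup>+z. F z \<partial>J)"
    unfolding J_def by (subst nn_integral_distr[OF WB]) (use F in simp_all)
  then show ?thesis unfolding \<open>J = K\<close> nn_K[OF F] by (simp add: nu_def)
qed

section \<open>Dyadic subdivisions\<close>

lemma pt_eq_iff:
  assumes "fst e \<noteq> snd e"
  shows "pt e x = pt e y \<longleftrightarrow> x = y"
  using assms by (auto simp: pt_def)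

lemma pt_inner_eq:
  assumes "x \<noteq> 0" "x \<noteq> 1" "pt e x = pt e' y"
  shows "e' = e \<and> y = x"
  using assms by (auto simp: pt_def split: if_splits)

locale sub_graph =
  fixes V :: "'v set" and E :: "('v \<times> 'v) set"
  assumes graph: "simple_conn_graph V E"
begin

lemma fst_neq_snd: "e \<in> E \<Longrightarrow> fst e \<noteq> snd e"
  using graph by (auto simp: simple_conn_graph_def)

lemma finite_E: "finite E"
  using graph finite_subset[of E "V \<times> V"] by (auto simp: simple_conn_graph_def)

definition vx :: "nat \<Rightarrow> 'v \<times> 'v \<Rightarrow> nat \<Rightarrow> 'v svtx" where
  "vx m e k = pt e (real k / 2 ^ m)"

lemma vx_eq_iff: "e \<in> E \<Longrightarrow> vx m e k = vx m e k' \<longleftrightarrow> k = k'"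
  by (simp add: vx_def pt_eq_iff[OF fst_neq_snd])

lemma vx_inner_eq:
  assumes "0 < k" "k < 2 ^ m" "vx m e k = vx m e' k'"
  shows "e' = e \<and> k' = k"
proof -
  have "real k < 2 ^ m" using assms(2) by (simp flip: of_nat_less_iff)
  then have "e' = e \<and> real k' / 2 ^ m = real k / 2 ^ m"
    using assms by (intro pt_inner_eq) (auto simp: vx_def)
  then show ?thesis by simp
qed

lemma vx_refine: "l \<le> r \<Longrightarrow> vx l e k = vx r e (k * 2 ^ (r - l))"
  using le_Suc_ex[of l r] by (auto simp: vx_def power_add)

lemma vx_in_vertices: "e \<in> E \<Longrightarrow> k \<le> 2 ^ m \<Longrightarrow> vx m e k \<in> sub_vertices V E m"
  unfolding sub_vertices_def vx_def by blast

lemma sub_vertices_cases: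
  assumes "x \<in> sub_vertices V E m"
  obtains v where "x = Inl v" | e k where "e \<in> E" "0 < k" "k < 2 ^ m" "x = vx m e k"
proof -
  have "(\<exists>v. x = Inl v) \<or> (\<exists>e k. e \<in> E \<and> 0 < k \<and> k < 2 ^ m \<and> x = vx m e k)"
  proof (cases "x \<in> Inl ` V")
    case False
    then obtain e k where k: "e \<in> E" "k \<le> 2 ^ m" "x = vx m e k"
      using assms by (auto simp: sub_vertices_def vx_def)
    show ?thesis
    proof (cases "k = 0 \<or> k = 2 ^ m")
      case True
      then show ?thesis using k by (auto simp: vx_def pt_def)
    next
      case False
      then have "0 < k \<and> k < 2 ^ m" using k by auto
      then show ?thesis using k by blast
    qed
  qed auto
  then show ?thesis using that by blast
qed

lemma finite_sub_vertices: "finite (sub_vertices V E m)"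
proof -
  have "{pt e (real k / 2 ^ m) |e k. e \<in> E \<and> k \<le> 2 ^ m} \<subseteq> (\<lambda>(e, k). pt e (real k / 2 ^ m)) ` (E \<times> {..2 ^ m})"
    by auto
  then have "finite {pt e (real k / 2 ^ m) |e k. e \<in> E \<and> k \<le> 2 ^ m}"
    by (rule finite_subset) (use finite_E in simp)
  moreover have "finite V" using graph by (simp add: simple_conn_graph_def)
  ultimately show ?thesis by (simp add: sub_vertices_def)
qed

lemma sub_edges_eq: "sub_edges E m = {{vx m e k, vx m e (Suc k)} |e k. e \<in> E \<and> k < 2 ^ m}"
  unfolding sub_edges_def vx_def
proof (intro set_eqI iffI; clarify)
  fix e :: "'v \<times> 'v" and j :: nat assume "e \<in> E" "1 \<le> j" "j \<le> 2 ^ m"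
  then show "\<exists>e' k. {pt e (real (j - 1) / 2 ^ m), pt e (real j / 2 ^ m)} =
      {pt e' (real k / 2 ^ m), pt e' (real (Suc k) / 2 ^ m)} \<and> e' \<in> E \<and> k < 2 ^ m"
    by (intro exI[of _ e] exI[of _ "j - 1"]) auto
next
  fix e :: "'v \<times> 'v" and k :: nat assume "e \<in> E" "k < 2 ^ m"
  then show "\<exists>e' j. {pt e (real k / 2 ^ m), pt e (real (Suc k) / 2 ^ m)} =
      {pt e' (real (j - 1) / 2 ^ m), pt e' (real j / 2 ^ m)} \<and> e' \<in> E \<and> 1 \<le> j \<and> j \<le> 2 ^ m"
    by (intro exI[of _ e] exI[of _ "Suc k"]) auto
qed

lemma finite_sub_edges: "finite (sub_edges E m)"
proof -
  have "sub_edges E m \<subseteq> (\<lambda>(e, k). {vx m e k, vx m e (Suc k)}) ` (E \<times> {..<2 ^ m})"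
    unfolding sub_edges_eq by auto
  then show ?thesis using finite_E by (auto intro: finite_subset)
qed

lemma path_graph_vx:
  assumes e: "e \<in> E"
  shows "path_graph (sub_vertices V E r) (sub_edges E r) (vx r e) (2 ^ r)"
proof
  show "finite (sub_vertices V E r)" by (rule finite_sub_vertices)
  show "finite (sub_edges E r)" by (rule finite_sub_edges)
  show no_loop: "{x} \<notin> sub_edges E r" for x
    using vx_eq_iff by (fastforce simp: sub_edges_eq doubleton_eq_iff singleton_insert_inj_eq')
  show "inj_on (vx r e) {..2 ^ r}" using vx_eq_iff[OF e] by (auto simp: inj_on_def)
  show "vx r e ` {..2 ^ r} \<subseteq> sub_vertices V E r" using vx_in_vertices[OF e] by auto
  show "{vx r e i, vx r e (Suc i)} \<in> sub_edges E r" if "i < 2 ^ r" for i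
    using that e unfolding sub_edges_eq by blast
  show nbr: "x = vx r e (i - 1) \<or> x = vx r e (i + 1)"
    if i: "0 < i" "i < 2 ^ r" and ix: "{vx r e i, x} \<in> sub_edges E r" for i x
  proof -
    obtain e' k where k: "{vx r e i, x} = {vx r e' k, vx r e' (Suc k)}" "e' \<in> E" "k < 2 ^ r"
      using ix unfolding sub_edges_eq by blast
    then consider "vx r e i = vx r e' k" "x = vx r e' (Suc k)" | "vx r e i = vx r e' (Suc k)" "x = vx r e' k"
      by (auto simp: doubleton_eq_iff)
    then show ?thesis
    proof cases
      case 1
      then have "e' = e \<and> k = i" using vx_inner_eq[OF i] by blast
      then show ?thesis using 1 by simp
    next
      case 2
      then have "e' = e \<and> Suc k = i" using vx_inner_eq[OF i] by blast
      then show ?thesis using 2 by auto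
    qed
  qed
  \<comment> \<open>Two original vertices are adjacent in the subdivision only if no edge is
    divided, i.e. 2^r = 1; this rules out a chord between the two ends.\<close>
  have long: "2 ^ r = Suc 0" if "i \<in> {0, 2 ^ r}" "j \<in> {0, 2 ^ r}" and ij: "{vx r e i, vx r e j} \<in> sub_edges E r" for i j
  proof -
    obtain e' k where k: "{vx r e i, vx r e j} = {vx r e' k, vx r e' (Suc k)}" "e' \<in> E" "k < 2 ^ r"
      using ij unfolding sub_edges_eq by blast
    have "\<exists>v. vx r e i = Inl v" "\<exists>v. vx r e j = Inl v" using that(1,2) by (auto simp: vx_def pt_def)
    then have inl: "\<exists>v. vx r e' k = Inl v" "\<exists>v. vx r e' (Suc k) = Inl v"
      using k(1) by (auto simp: doubleton_eq_iff)
    have "real k < 2 ^ r" using k(3) by (simp flip: of_nat_less_iff)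
    then have "k = 0" using inl(1) by (auto simp: vx_def pt_def split: if_splits)
    moreover have "real (Suc k) / 2 ^ r = 1" using inl(2) by (auto simp: vx_def pt_def split: if_splits)
    then have "real (Suc k) = real (2 ^ r)" by (simp add: field_simps)
    then have "Suc k = 2 ^ r" by (simp only: of_nat_eq_iff)
    ultimately show ?thesis by simp
  qed
  show "j = Suc i \<or> i = Suc j" if ij: "i \<le> 2 ^ r" "j \<le> 2 ^ r" "{vx r e i, vx r e j} \<in> sub_edges E r" for i j
  proof -
    consider "0 < i" "i < 2 ^ r" | "0 < j" "j < 2 ^ r" | "i = j" | "i = 0" "j = 2 ^ r" | "i = 2 ^ r" "j = 0"
      using ij by linarith
    then show ?thesis
    proof cases
      case 1
      then show ?thesis using nbr[OF 1 ij(3)] vx_eq_iff[OF e] by auto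
    next
      case 2
      then show ?thesis using nbr[OF 2, of "vx r e i"] ij(3) vx_eq_iff[OF e] by (auto simp: insert_commute)
    next
      case 3
      then show ?thesis using ij(3) no_loop by simp
    next
      case 4
      then show ?thesis using long[of i j] ij(3) by simp
    next
      case 5
      then show ?thesis using long[of i j] ij(3) by simp
    qed
  qed
qed

text \<open>An end inside an original edge determines that edge. Otherwise l = 0, and the original
  edge is determined by its two ends because each undirected edge is stored once.\<close>

lemma edge_param_inj:
  assumes "e \<in> E" "e' \<in> E" "c < 2 ^ l" "c' < 2 ^ l"
    and sub: "vx l e c \<in> {vx l e' c', vx l e' (Suc c')}" "vx l e (Suc c) \<in> {vx l e' c', vx l e' (Suc c')}"
  shows "e' = e \<and> c' = c"
proof -
  have "e' = e"
  proof (cases "(0 < c \<and> c < 2 ^ l) \<or> (0 < Suc c \<and> Suc c < 2 ^ l)")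
    case True
    then show ?thesis using sub vx_inner_eq[of c l e e'] vx_inner_eq[of "Suc c" l e e'] by blast
  next
    case False
    then have "c = 0" using assms(3) by auto
    have "Suc c = 2 ^ l" using False assms(3) by (intro le_antisym) auto
    have "l = 0"
    proof (cases l)
      case (Suc n)
      then have "even ((2::nat) ^ l)" by simp
      then show ?thesis using \<open>c = 0\<close> \<open>Suc c = 2 ^ l\<close> by (metis even_Suc even_zero)
    qed
    with \<open>c = 0\<close> have l: "l = 0" "c = 0" "c' = 0" using assms(4) by auto
    have "{fst e, snd e} \<subseteq> {fst e', snd e'}" using sub by (auto simp: l vx_def pt_def)
    moreover have "(snd e, fst e) \<notin> E" using graph assms(1) by (auto simp: simple_conn_graph_def)
    ultimately show ?thesis using fst_neq_snd[OF assms(1)] assms(2) by (cases e; cases e') auto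
  qed
  moreover from this have "c' = c" using sub vx_eq_iff[OF assms(1)] by auto
  ultimately show ?thesis by simp
qed

section \<open>Blocks of fine vertices between coarse vertices\<close>

context
  fixes l r :: nat
  assumes lr: "l \<le> r"
begin

lemma segment_le:
  assumes "c < 2 ^ l"
  shows "c * 2 ^ (r - l) + 2 ^ (r - l) \<le> (2 ^ r :: nat)"
proof -
  have "c * 2 ^ (r - l) + 2 ^ (r - l) = Suc c * 2 ^ (r - l)" by simp
  also have "\<dots> \<le> 2 ^ l * 2 ^ (r - l)" using assms by (intro mult_right_mono) auto
  also have "\<dots> = 2 ^ r" using lr by (simp flip: power_add)
  finally show ?thesis .
qed

lemma coarse_dvd:
  assumes "e \<in> E" "k \<le> 2 ^ r" "vx r e k \<in> sub_vertices V E l"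
  shows "2 ^ (r - l) dvd k"
proof (cases "k = 0 \<or> k = 2 ^ r")
  case True
  then show ?thesis by (auto intro: le_imp_power_dvd)
next
  case False
  then have k: "0 < k" "k < 2 ^ r" using assms by auto
  show ?thesis using assms(3)
  proof (cases rule: sub_vertices_cases)
    case (1 v)
    then show ?thesis using k by (auto simp: vx_def pt_def split: if_splits)
  next
    case (2 e' t)
    then have "vx r e k = vx r e' (t * 2 ^ (r - l))" using vx_refine[OF lr] by simp
    then have "t * 2 ^ (r - l) = k" using vx_inner_eq[OF k] by blast
    then show ?thesis by auto
  qed
qed

lemma coarse_vx:
  assumes "e \<in> E" "k \<le> 2 ^ r" "2 ^ (r - l) dvd k"
  shows "vx r e k = vx l e (k div 2 ^ (r - l))" "vx r e k \<in> sub_vertices V E l"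
proof -
  show 1: "vx r e k = vx l e (k div 2 ^ (r - l))" using vx_refine[OF lr] assms(3) by simp
  have "k div 2 ^ (r - l) \<le> 2 ^ r div 2 ^ (r - l)" by (rule div_le_mono) fact
  also have "\<dots> = 2 ^ l" using lr by (simp flip: power_diff)
  finally show "vx r e k \<in> sub_vertices V E l" unfolding 1 by (rule vx_in_vertices[OF assms(1)])
qed

lemma fine_cases:
  assumes "x \<in> sub_vertices V E r - sub_vertices V E l"
  obtains e k where "e \<in> E" "0 < k" "k < 2 ^ r" "x = vx r e k" "\<not> 2 ^ (r - l) dvd k"
proof -
  have "x \<in> sub_vertices V E r" using assms by simp
  then show ?thesis
  proof (cases rule: sub_vertices_cases)
    case (1 v)
    then have "x \<in> Inl ` V \<or> (\<exists>e k. e \<in> E \<and> k \<le> 2 ^ r \<and> x = vx r e k)"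
      using assms by (auto simp: sub_vertices_def vx_def)
    then have "x \<in> sub_vertices V E l"
    proof
      assume "\<exists>e k. e \<in> E \<and> k \<le> 2 ^ r \<and> x = vx r e k"
      then obtain e k where k: "e \<in> E" "k \<le> 2 ^ r" "x = vx r e k" by blast
      then have "k = 0 \<or> k = 2 ^ r" using 1 by (auto simp: vx_def pt_def split: if_splits)
      then have "2 ^ (r - l) dvd k" by (auto intro: le_imp_power_dvd)
      then show ?thesis using coarse_vx(2) k by blast
    qed (auto simp: sub_vertices_def)
    then show ?thesis using assms by simp
  next
    case (2 e k)
    then have "\<not> 2 ^ (r - l) dvd k" using coarse_vx(2)[of e k] assms by auto
    then show ?thesis using 2 that by blast
  qed
qed

text \<open>The level-\<open>l\<close> edge (with its position) in the interior of which a fine vertex lies.\<close>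
definition blk :: "'v svtx \<Rightarrow> ('v \<times> 'v) \<times> nat" where
  "blk x = (case x of Inl v \<Rightarrow> undefined | Inr (e, q) \<Rightarrow> (e, nat \<lfloor>q * 2 ^ l\<rfloor>))"

lemma blk_vx:
  assumes "0 < k" "k < 2 ^ r"
  shows "blk (vx r e k) = (e, k div 2 ^ (r - l))"
proof -
  have kr: "real k < 2 ^ r" using assms(2) by (simp flip: of_nat_less_iff)
  then have "vx r e k = Inr (e, real k / 2 ^ r)" using assms by (auto simp: vx_def pt_def)
  moreover have "real k / 2 ^ r * 2 ^ l = real k / real (2 ^ (r - l))"
    using le_Suc_ex[OF lr] by (auto simp: power_add)
  moreover have "nat \<lfloor>real k / real (2 ^ (r - l))\<rfloor> = k div 2 ^ (r - l)"
    by (simp only: floor_divide_of_nat_eq nat_int)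
  ultimately show ?thesis by (simp add: blk_def)
qed

definition ends :: "('v \<times> 'v) \<times> nat \<Rightarrow> 'v svtx set" where
  "ends B = {vx l (fst B) (snd B), vx l (fst B) (Suc (snd B))}"

lemma blk_props:
  assumes "x \<in> sub_vertices V E r - sub_vertices V E l"
  shows "fst (blk x) \<in> E" "snd (blk x) < 2 ^ l"
proof -
  obtain e k where k: "e \<in> E" "0 < k" "k < 2 ^ r" "x = vx r e k" using fine_cases[OF assms] by metis
  have "k div 2 ^ (r - l) < 2 ^ l"
    using k(3) lr by (simp add: div_less_iff_less_mult flip: power_add)
  then show "fst (blk x) \<in> E" "snd (blk x) < 2 ^ l" using k by (simp_all add: blk_vx)
qed

text \<open>Along an original edge the quotient of the position by 2^(r - l) changes only at
  multiples of 2^(r - l), i.e. at coarse vertices. Paths through fine vertices therefore stay within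
  one block.\<close>

lemma adjacent_blk:
  assumes x: "x \<in> sub_vertices V E r - sub_vertices V E l" and xy: "{x, y} \<in> sub_edges E r"
  shows "y \<in> sub_vertices V E r"
    and "y \<notin> sub_vertices V E l \<Longrightarrow> blk y = blk x"
    and "y \<in> sub_vertices V E l \<Longrightarrow> y \<in> ends (blk x)"
proof -
  let ?N = "2 ^ (r - l) :: nat"
  obtain e k where k: "{x, y} = {vx r e k, vx r e (Suc k)}" "e \<in> E" "k < 2 ^ r"
    using xy by (auto simp: sub_edges_eq)
  then consider (left) "x = vx r e k" "y = vx r e (Suc k)" | (right) "x = vx r e (Suc k)" "y = vx r e k"
    by (auto simp: doubleton_eq_iff)
  note c = this
  then show yr: "y \<in> sub_vertices V E r" using vx_in_vertices[of e _ r] k by cases auto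
  have nd: "\<not> ?N dvd j" if "z = vx r e j" "j \<le> 2 ^ r" "z \<notin> sub_vertices V E l" for z j
    using coarse_vx(2)[of e j] k that by auto
  have nd0: "0 < j" "j < 2 ^ r" if "\<not> ?N dvd j" "j \<le> 2 ^ r" for j
  proof -
    have "j \<noteq> 0" using that(1) by (intro notI) simp
    moreover have "j \<noteq> 2 ^ r" using that(1) le_imp_power_dvd[of "r - l" r "2::nat"] by auto
    ultimately show "0 < j" "j < 2 ^ r" using that(2) by auto
  qed
  show "blk y = blk x" if y: "y \<notin> sub_vertices V E l"
  proof -
    have "\<not> ?N dvd k \<and> \<not> ?N dvd Suc k"
    proof (cases rule: c)
      case left
      then show ?thesis using nd[of x k] nd[of y "Suc k"] x y k(3) by simp
    next
      case right
      then show ?thesis using nd[of y k] nd[of x "Suc k"] x y k(3) by simp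
    qed
    then have d: "\<not> ?N dvd k" "\<not> ?N dvd Suc k" by auto
    have "Suc k div ?N = k div ?N" using d by (simp add: div_Suc dvd_eq_mod_eq_0)
    then have "blk (vx r e (Suc k)) = blk (vx r e k)"
      using nd0[OF d(1)] nd0[OF d(2)] k by (simp add: blk_vx)
    then have "blk (vx r e k) = blk (vx r e (Suc k))" by simp
    then show ?thesis using \<open>blk (vx r e (Suc k)) = blk (vx r e k)\<close> by (cases rule: c) simp_all
  qed
  show "y \<in> ends (blk x)" if y: "y \<in> sub_vertices V E l"
  proof (cases rule: c)
    case left
    have d: "\<not> ?N dvd k" by (rule nd[of x]) (use left x k in simp_all)
    have y': "?N dvd Suc k" by (rule coarse_dvd[OF k(2)]) (use left y k in simp_all)
    then have "Suc k div ?N = Suc (k div ?N)" by (simp add: div_Suc dvd_eq_mod_eq_0)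
    moreover have "y = vx l e (Suc k div ?N)"
      unfolding left(2) by (rule coarse_vx(1)[OF k(2) _ y']) (use k in simp)
    moreover have "blk x = (e, k div ?N)" unfolding left(1) using nd0[OF d] k by (intro blk_vx) simp_all
    ultimately show ?thesis by (simp add: ends_def)
  next
    case right
    have d: "\<not> ?N dvd Suc k" by (rule nd[of x]) (use right x k in simp_all)
    have y': "?N dvd k" by (rule coarse_dvd[OF k(2)]) (use right y k in simp_all)
    have "Suc k div ?N = k div ?N" using d by (simp add: div_Suc dvd_eq_mod_eq_0)
    moreover have "y = vx l e (k div ?N)"
      unfolding right(2) by (rule coarse_vx(1)[OF k(2) _ y']) (use k in simp)
    moreover have "blk x = (e, Suc k div ?N)" unfolding right(1) using nd0[OF d] k by (intro blk_vx) simp_all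
    ultimately show ?thesis by (simp add: ends_def)
  qed
qed

text \<open>Once the segment between u and v is eliminated, the remaining fine vertices are sorted
  by whether their block touches u. No edge links the two classes and no remaining block touching u
  reaches v, so the entry at u and v changes no more. Both orientations are stated because edges of
  level l are unordered pairs.\<close>

lemma eff_W_eq_eff_edge:
  assumes e: "e \<in> E" and c: "c < 2 ^ l"
    and pd: "posdef_on (sub_vertices V E r) (Hmat (wmat (sub_edges E r) w) b)"
  defines "p \<equiv> c * 2 ^ (r - l)"
  shows "eff_W V E r l w b (vx l e c) (vx l e (Suc c)) =
      path_graph.eff_edge (sub_edges E r) (vx r e) p (r - l) w b"
    and "eff_W V E r l w b (vx l e (Suc c)) (vx l e c) =
      path_graph.eff_edge (sub_edges E r) (vx r e) p (r - l) w b"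
proof -
  let ?L = "sub_vertices V E r" and ?Ll = "sub_vertices V E l" and ?Es = "sub_edges E r"
  let ?n = "r - l"
  interpret path_graph ?L ?Es "vx r e" "2 ^ r" by (rule path_graph_vx[OF e])
  define A where "A = Hpath w b"
  have Asym: "A i j = A j i" for i j unfolding A_def by (rule Hpath_sym)
  have Adef: "A = Hmat (wmat ?Es w) b" by (simp add: A_def Hpath_def)
  have Aadj: "{i, j} \<in> ?Es" if "A i j \<noteq> 0" "i \<noteq> j" for i j
    using that by (auto simp: Adef Hmat_def wmat_def split: if_splits)
  have pR: "p + 2 ^ ?n \<le> 2 ^ r" unfolding p_def by (rule segment_le[OF c])
  define u where "u = vx l e c"
  define v where "v = vx l e (Suc c)"
  have u: "u = vx r e p" using vx_refine[OF lr] by (simp add: u_def p_def)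
  have v: "v = vx r e (p + 2 ^ ?n)" using vx_refine[OF lr, of e "Suc c"] by (simp add: v_def p_def add.commute)
  have uv: "u \<noteq> v" "u \<in> ?Ll" "v \<in> ?Ll"
    using vx_eq_iff[OF e] vx_in_vertices[OF e] c by (auto simp: u_def v_def)
  have seg_vertices_fine: "seg_vertices p ?n \<subseteq> ?L - ?Ll"
  proof
    fix x assume "x \<in> seg_vertices p ?n"
    then obtain k where k: "x = vx r e k" "p < k" "k < p + 2 ^ ?n" by (auto simp: seg_vertices_def)
    have "\<not> 2 ^ ?n dvd k"
    proof
      assume "2 ^ ?n dvd k"
      then obtain t where t: "k = t * 2 ^ ?n" by (metis dvdE mult.commute)
      have "c * 2 ^ ?n < t * 2 ^ ?n" "t * 2 ^ ?n < Suc c * 2 ^ ?n" using k(2,3) by (simp_all add: p_def t)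
      then have "c < t" "t < Suc c" by (simp_all only: mult_less_cancel2)
      then show False by simp
    qed
    then show "x \<in> ?L - ?Ll" using coarse_dvd[OF e, of k] k pR vx_in_vertices[OF e, of k r] by auto
  qed
  have blk_seg_vertices: "x \<in> seg_vertices p ?n" if x: "x \<in> ?L - ?Ll" and B: "blk x = (e, c)" for x
  proof -
    obtain e' k where k: "e' \<in> E" "0 < k" "k < 2 ^ r" "x = vx r e' k" "\<not> 2 ^ ?n dvd k"
      using fine_cases[OF x] by metis
    then have "e' = e" "k div 2 ^ ?n = c" using B by (simp_all add: blk_vx)
    then have "p + k mod 2 ^ ?n = k" using div_mult_mod_eq[of k "2 ^ ?n"] by (simp add: p_def)
    moreover have "k mod 2 ^ ?n < 2 ^ ?n" by simp
    ultimately have "p \<le> k" "k < p + 2 ^ ?n" by linarith+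
    moreover have "k \<noteq> p" using k(5) by (auto simp: p_def)
    ultimately show ?thesis using k \<open>e' = e\<close> by (auto simp: seg_vertices_def)
  qed
  obtain ks where ks: "set ks = ?L - ?Ll - seg_vertices p ?n" "distinct ks"
    using finite_distinct_list[of "?L - ?Ll - seg_vertices p ?n"] finite_L by auto
  have full: "distinct (ks @ seg_list p ?n)" "set (ks @ seg_list p ?n) = ?L - ?Ll"
    using ks seg_vertices_fine distinct_seg_list[OF pR] by (auto simp: set_seg_list)
  have pp: "pos_pivots (ks @ seg_list p ?n) A"
    using posdef_on_subset[OF pd, of "?L - ?Ll"] finite_L
      posdef_on_iff_pos_pivots[of A "ks @ seg_list p ?n"] Asym full by (auto simp: Adef)
  have notpath: "x \<notin> vx r e ` {p..p + 2 ^ ?n}" if "x \<in> set ks" for x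
  proof
    assume "x \<in> vx r e ` {p..p + 2 ^ ?n}"
    then obtain k where k: "x = vx r e k" "p \<le> k" "k \<le> p + 2 ^ ?n" by auto
    then consider "x = u" | "x = v" | "x \<in> seg_vertices p ?n" unfolding u v seg_vertices_def
      by (cases "k = p"; cases "k = p + 2 ^ ?n") auto
    then show False using that ks uv by cases auto
  qed
  define D where "D i j = schur p ?n w b i j - A i j" for i j
  have D0: "D i j = 0" if "i \<in> set ks \<or> j \<in> set ks" for i j
    using that notpath schur_outside[OF pR, of i w b j] schur_outside[OF pR, of j w b i] by (auto simp: D_def A_def)
  have el: "elim (ks @ seg_list p ?n) A i j = elim ks A i j + D i j" for i j
  proof -
    have "elim (seg_list p ?n) A = (\<lambda>i j. A i j + D i j)" by (simp add: D_def schur_def A_def)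
    then show ?thesis unfolding elim_append by (simp add: elim_add[OF D0])
  qed
  have sep: "elim ks A u v = A u v"
  proof (rule elim_eq_separated[where P = "{u} \<union> {x \<in> set ks. u \<in> ends (blk x)}"
        and Q = "{v} \<union> {x \<in> set ks. u \<notin> ends (blk x)}"])
    have fine: "x \<in> ?L - ?Ll" if "x \<in> set ks" for x using that ks by auto
    show "A x k = 0" if "x \<in> {u} \<union> {x \<in> set ks. u \<in> ends (blk x)}"
      "k \<in> ({v} \<union> {x \<in> set ks. u \<notin> ends (blk x)}) \<inter> set ks" for x k
    proof (rule ccontr)
      assume nz: "A x k \<noteq> 0"
      have k: "k \<in> set ks" "u \<notin> ends (blk k)" using that(2) fine uv by auto
      have "x \<noteq> k" using that(1) k uv fine by auto
      then have adj: "{k, x} \<in> ?Es" using Aadj[OF nz] by (simp add: insert_commute)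
      show False
      proof (cases "x = u")
        case True
        then show False using adjacent_blk(3)[OF fine[OF k(1)] adj] uv k by simp
      next
        case False
        then have x: "x \<in> set ks" "u \<in> ends (blk x)" using that(1) by auto
        then have "blk x = blk k" using adjacent_blk(2)[OF fine[OF k(1)] adj] fine by auto
        then show False using x k by simp
      qed
    qed
    show "A k y = 0" if "k \<in> ({u} \<union> {x \<in> set ks. u \<in> ends (blk x)}) \<inter> set ks"
      "y \<in> {v} \<union> {x \<in> set ks. u \<notin> ends (blk x)}" for k y
    proof (rule ccontr)
      assume nz: "A k y \<noteq> 0"
      have k: "k \<in> set ks" "u \<in> ends (blk k)" using that(1) fine uv by auto
      have "k \<noteq> y" using that(2) k uv fine by auto
      then have adj: "{k, y} \<in> ?Es" using Aadj[OF nz] by simp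
      show False
      proof (cases "y = v")
        case True
        then have "v \<in> ends (blk k)" using adjacent_blk(3)[OF fine[OF k(1)] adj] uv by simp
        \<comment> \<open>A block with both u and v as ends must be (e, c), whose vertices form the
          segment itself and hence are not in \<open>ks\<close>.\<close>
        then have "fst (blk k) = e \<and> snd (blk k) = c"
          using k(2) blk_props[OF fine[OF k(1)]]
          by (intro edge_param_inj[OF e _ c]) (auto simp: ends_def u_def v_def)
        then have "blk k = (e, c)" by (simp add: prod_eq_iff)
        then show False using blk_seg_vertices[OF fine[OF k(1)]] k ks by auto
      next
        case False
        then have y: "y \<in> set ks" "u \<notin> ends (blk y)" using that(2) by auto
        then have "blk y = blk k" using adjacent_blk(2)[OF fine[OF k(1)] adj] fine by auto
        then show False using y k by simp
      qed
    qed
  qed auto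
  have schur_uv: "elim (ks @ seg_list p ?n) A u v = - eff_edge p ?n w b"
    unfolding el sep by (simp add: D_def eff_edge_def u v)
  have eff: "eff_W V E r l w b i j = - elim (ks @ seg_list p ?n) A i j" if ij: "i \<in> ?Ll" "j \<in> ?Ll" "i \<noteq> j" for i j
  proof -
    have "elim (ks @ seg_list p ?n) A i j =
      A i j - (\<Sum>a\<in>?L - ?Ll. \<Sum>c\<in>?L - ?Ll. A i a * inv_on (?L - ?Ll) A a c * A c j)"
      using elim_eq_inv_on[of A "ks @ seg_list p ?n", OF Asym full(1) pp] full(2) by simp
    \<comment> \<open>i and j are coarse, so the entries linking them to the eliminated block are
      off-diagonal; their two minus signs cancel.\<close>
    also have "(\<Sum>a\<in>?L - ?Ll. \<Sum>c\<in>?L - ?Ll. A i a * inv_on (?L - ?Ll) A a c * A c j) =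
       (\<Sum>a\<in>?L - ?Ll. \<Sum>c\<in>?L - ?Ll. wmat ?Es w i a * inv_on (?L - ?Ll) A a c * wmat ?Es w c j)"
      using ij by (intro sum.cong refl) (auto simp: Adef Hmat_def)
    also have "A i j = - wmat ?Es w i j" using ij by (simp add: Adef Hmat_def)
    finally show ?thesis by (simp add: eff_W_def eff_weight_def Adef)
  qed
  show "eff_W V E r l w b (vx l e c) (vx l e (Suc c)) = eff_edge p ?n w b"
    using eff[of u v] uv schur_uv by (simp add: u_def v_def)
  have "elim (ks @ seg_list p ?n) A v u = elim (ks @ seg_list p ?n) A u v" by (rule elim_sym) (rule Asym)
  then show "eff_W V E r l w b (vx l e (Suc c)) (vx l e c) = eff_edge p ?n w b"
    using eff[of v u] uv schur_uv by (simp add: u_def v_def)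
qed

end

end

section \<open>Law of the effective weights and the final bounds\<close>

text \<open>Identifying the effective weight with \<open>eff_edge\<close> uses positive
  definiteness, which holds almost surely because the density vanishes elsewhere. After that
  \<open>joint_law\<close> and \<open>path_law\<close> give the integrals.\<close>

lemma (in sub_graph) eff_W_law:
  fixes M :: "'a measure" and Wf :: "'a \<Rightarrow> 'v svtx set \<Rightarrow> real" and \<beta> :: "'a \<Rightarrow> 'v svtx \<Rightarrow> real"
  assumes lr: "l \<le> r"
    and M: "prob_space M"
    and W_meas: "\<forall>e\<in>sub_edges E r. (\<lambda>\<omega>. Wf \<omega> e) \<in> borel_measurable M"
    and W_pos: "\<forall>\<omega>\<in>space M. \<forall>e\<in>sub_edges E r. Wf \<omega> e > 0"
    and W_indep: "prob_space.indep_vars M (\<lambda>_. borel) (\<lambda>e \<omega>. Wf \<omega> e) (sub_edges E r)"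
    and W_ident: "\<forall>e\<in>sub_edges E r. \<forall>e'\<in>sub_edges E r.
                    distr M borel (\<lambda>\<omega>. Wf \<omega> e) = distr M borel (\<lambda>\<omega>. Wf \<omega> e')"
    and \<beta>_meas: "(\<lambda>\<omega>. restrict (\<beta> \<omega>) (sub_vertices V E r))
                  \<in> M \<rightarrow>\<^sub>M RPi (sub_vertices V E r)"
    and \<beta>_cond: "\<forall>A\<in>sets (RPi (sub_edges E r)).
                 \<forall>B\<in>sets (RPi (sub_vertices V E r)).
       emeasure M {\<omega>\<in>space M. restrict (Wf \<omega>) (sub_edges E r) \<in> A \<and>
                               restrict (\<beta> \<omega>) (sub_vertices V E r) \<in> B}
       = (\<integral>\<^sup>+\<omega>. indicator {\<omega>. restrict (Wf \<omega>) (sub_edges E r) \<in> A} \<omega> *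
                 emeasure (nu_law (sub_vertices V E r) (wmat (sub_edges E r) (Wf \<omega>))) B \<partial>M)"
    and ij: "{i, j} \<in> sub_edges E l" and e': "e' \<in> sub_edges E r"
  defines "\<mu> \<equiv> distr M borel (\<lambda>\<omega>. Wf \<omega> e')"
  shows "pos_law \<mu>"
    and "f \<in> borel_measurable borel \<Longrightarrow> (\<integral>\<^sup>+\<omega>. f (eff_W V E r l (Wf \<omega>) (\<beta> \<omega>) i j) \<partial>M) =
      (\<integral>\<^sup>+y. f y \<partial>(merge_law ^^ (r - l)) \<mu>)"
proof -
  let ?L = "sub_vertices V E r" and ?Es = "sub_edges E r"
  interpret M: prob_space M by fact
  have We [measurable]: "(\<lambda>\<omega>. Wf \<omega> e') \<in> borel_measurable M" using W_meas e' by blast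
  show \<mu>: "pos_law \<mu>"
    unfolding pos_law_def
  proof (intro conjI)
    show "prob_space \<mu>" unfolding \<mu>_def by (rule M.prob_space_distr) measurable
    show "AE a in \<mu>. a > 0" unfolding \<mu>_def using W_pos e' by (subst AE_distr_iff) auto
  qed (simp add: \<mu>_def)
  note s\<mu> = sets_pos_law[OF \<mu>]
  have s: "sets (PiM ?Es (\<lambda>_. \<mu>)) = sets (PiM ?Es (\<lambda>_. borel))"
    by (rule sets_PiM_cong) (use s\<mu> in auto)
  have W_res: "(\<lambda>\<omega>. restrict (Wf \<omega>) ?Es) \<in> M \<rightarrow>\<^sub>M PiM ?Es (\<lambda>_. borel)"
    by (rule measurable_restrict) (use W_meas in blast)
  then have W_res': "(\<lambda>\<omega>. restrict (Wf \<omega>) ?Es) \<in> M \<rightarrow>\<^sub>M PiM ?Es (\<lambda>_. \<mu>)"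
    using s by (simp cong: measurable_cong_sets)
  have "distr M (PiM ?Es (\<lambda>_. borel)) (\<lambda>\<omega>. restrict (Wf \<omega>) ?Es) = PiM ?Es (\<lambda>e. distr M borel (\<lambda>\<omega>. Wf \<omega> e))"
    using M.indep_vars_iff_distr_eq_PiM'[where I = ?Es and M' = "\<lambda>_. borel" and X = "\<lambda>e \<omega>. Wf \<omega> e"] W_indep W_meas e' by auto
  also have "\<dots> = PiM ?Es (\<lambda>_. \<mu>)"
    unfolding \<mu>_def by (rule PiM_cong) (use W_ident e' in blast)+
  finally have W_law: "distr M (PiM ?Es (\<lambda>_. \<mu>)) (\<lambda>\<omega>. restrict (Wf \<omega>) ?Es) = PiM ?Es (\<lambda>_. \<mu>)"
    using distr_cong[of M M "PiM ?Es (\<lambda>_. \<mu>)" "PiM ?Es (\<lambda>_. borel)" "\<lambda>\<omega>. restrict (Wf \<omega>) ?Es"] s by simp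
  note joint = joint_law[OF M finite_sub_vertices finite_sub_edges W_law W_res' \<mu> \<beta>_meas \<beta>_cond]
  obtain e c where e: "e \<in> E" and c: "c < 2 ^ l" and ec: "{i, j} = {vx l e c, vx l e (Suc c)}"
    using ij unfolding sub_edges_eq by blast
  interpret path_graph ?L ?Es "vx r e" "2 ^ r" by (rule path_graph_vx[OF e])
  define p where "p = c * 2 ^ (r - l)"
  have pR: "p + 2 ^ (r - l) \<le> 2 ^ r"
    unfolding p_def by (rule segment_le[OF lr c])
  have seg_vertices_L: "seg_vertices p (r - l) \<subseteq> ?L" using range_L pR by (auto simp: seg_vertices_def)
  have seg_edges_Es: "seg_edges p (r - l) \<subseteq> ?Es" using path_edge pR by (auto simp: seg_edges_def)
  have eff_edge_restrict: "eff_edge p (r - l) (restrict w ?Es) (restrict b ?L) = eff_edge p (r - l) w b" for w b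
    by (rule locality) (use pR seg_vertices_L seg_edges_Es in auto)
  have eff: "eff_W V E r l w b i j = eff_edge p (r - l) w b" if pd: "posdef_on ?L (Hmat (wmat ?Es w) b)" for w b
    using eff_W_eq_eff_edge[OF lr e c pd] ec unfolding p_def by (auto simp: doubleton_eq_iff)
  obtain ks where ks: "set ks = ?L" "distinct ks" using finite_distinct_list[OF finite_sub_vertices] by blast
  have pd_iff: "posdef_on ?L (Hmat (wmat ?Es w) b) \<longleftrightarrow> pos_pivots ks (Hmat (wmat ?Es w) b)" for w b
    using posdef_on_iff_pos_pivots[of "Hmat (wmat ?Es w) b" ks] Hmat_sym[of "wmat ?Es w"] wmat_sym ks by metis
  have pd_restrict: "posdef_on ?L (Hmat (wmat ?Es (restrict w ?Es)) (restrict b ?L)) \<longleftrightarrow> posdef_on ?L (Hmat (wmat ?Es w) b)" for w b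
  proof -
    have "Hmat (wmat ?Es (restrict w ?Es)) (restrict b ?L) i j = Hmat (wmat ?Es w) b i j" if "i \<in> ?L" "j \<in> ?L" for i j
      using that by (simp add: Hmat_def wmat_def)
    then show ?thesis unfolding posdef_on_def by (simp cong: sum.cong)
  qed
  let ?X = "PiM ?Es (\<lambda>_. \<mu>) \<Otimes>\<^sub>M PiM ?L (\<lambda>_. lborel)"
  \<comment> \<open>Indicator of the failure of positive definiteness, expressed through pivots so
    that it is measurable.\<close>
  define bad where "bad = (\<lambda>z. if pos_pivots ks (Hmat (wmat ?Es (fst z)) (snd z)) then 0 else (1::ennreal))"
  have pred: "Measurable.pred ?X (\<lambda>z. pos_pivots ks (Hmat (wmat ?Es (fst z)) (snd z)))"
    by (intro pred_pos_pivots measurable_Hmat_wmat[OF measurable_fst s\<mu> measurable_snd])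
  then have bad: "bad \<in> borel_measurable ?X"
    unfolding bad_def by measurable
  have "(\<integral>\<^sup>+\<omega>. bad (restrict (Wf \<omega>) ?Es, restrict (\<beta> \<omega>) ?L) \<partial>M) = 0"
    unfolding joint[OF bad]
    by (intro nn_integral_zero' AE_I2) (simp add: bad_def nu_density_def pd_iff)
  moreover have "(\<lambda>\<omega>. bad (restrict (Wf \<omega>) ?Es, restrict (\<beta> \<omega>) ?L)) \<in> borel_measurable M"
    by (rule measurable_compose[OF measurable_Pair[OF W_res' \<beta>_meas] bad])
  ultimately have "AE \<omega> in M. bad (restrict (Wf \<omega>) ?Es, restrict (\<beta> \<omega>) ?L) = 0"
    by (subst (asm) nn_integral_0_iff_AE) auto
  then have AE_pd: "AE \<omega> in M. posdef_on ?L (Hmat (wmat ?Es (Wf \<omega>)) (\<beta> \<omega>))"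
    by eventually_elim (simp add: bad_def pd_iff[symmetric] pd_restrict split: if_splits)
  show "(\<integral>\<^sup>+\<omega>. f (eff_W V E r l (Wf \<omega>) (\<beta> \<omega>) i j) \<partial>M) = (\<integral>\<^sup>+y. f y \<partial>(merge_law ^^ (r - l)) \<mu>)"
    if f: "f \<in> borel_measurable borel"
  proof -
    have "(\<integral>\<^sup>+\<omega>. f (eff_W V E r l (Wf \<omega>) (\<beta> \<omega>) i j) \<partial>M) =
      (\<integral>\<^sup>+\<omega>. f (eff_edge p (r - l) (fst (restrict (Wf \<omega>) ?Es, restrict (\<beta> \<omega>) ?L)) (snd (restrict (Wf \<omega>) ?Es, restrict (\<beta> \<omega>) ?L))) \<partial>M)"
      by (rule nn_integral_cong_AE) (use AE_pd in eventually_elim, simp only: eff eff_edge_restrict fst_conv snd_conv)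
    also have "\<dots> = (\<integral>\<^sup>+w. \<integral>\<^sup>+b. f (eff_edge p (r - l) (fst (w, b)) (snd (w, b))) * ennreal (nu_density ?L (wmat ?Es w) b)
        \<partial>PiM ?L (\<lambda>_. lborel) \<partial>PiM ?Es (\<lambda>_. \<mu>))"
      by (rule joint, rule measurable_compose[OF _ f])
         (rule measurable_PiM_eff_edge(1)[OF measurable_fst measurable_snd s\<mu>])
    also have "\<dots> = (\<integral>\<^sup>+y. f y \<partial>(merge_law ^^ (r - l)) \<mu>)"
      using path_law[OF \<mu> pR f] by simp
    finally show ?thesis .
  qed
qed

theorem theorem1p6:
  fixes V :: "'v set" and E :: "('v \<times> 'v) set" and l r :: nat
    and M :: "'a measure"
    and Wf :: "'a \<Rightarrow> 'v svtx set \<Rightarrow> real"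
    and \<beta> :: "'a \<Rightarrow> 'v svtx \<Rightarrow> real"
  assumes graph: "simple_conn_graph V E"
    and lr: "l \<le> r"
    and M: "prob_space M"
    and W_meas: "\<forall>e\<in>sub_edges E r. (\<lambda>\<omega>. Wf \<omega> e) \<in> borel_measurable M"
    and W_pos: "\<forall>\<omega>\<in>space M. \<forall>e\<in>sub_edges E r. Wf \<omega> e > 0"
    and W_indep: "prob_space.indep_vars M (\<lambda>_. borel) (\<lambda>e \<omega>. Wf \<omega> e) (sub_edges E r)"
    and W_ident: "\<forall>e\<in>sub_edges E r. \<forall>e'\<in>sub_edges E r.
                    distr M borel (\<lambda>\<omega>. Wf \<omega> e) = distr M borel (\<lambda>\<omega>. Wf \<omega> e')"
    and \<beta>_meas: "(\<lambda>\<omega>. restrict (\<beta> \<omega>) (sub_vertices V E r))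
                  \<in> M \<rightarrow>\<^sub>M PiM (sub_vertices V E r) (\<lambda>_. lborel)"
    and \<beta>_cond: "\<forall>A\<in>sets (PiM (sub_edges E r) (\<lambda>_. lborel)).
                 \<forall>B\<in>sets (PiM (sub_vertices V E r) (\<lambda>_. lborel)).
       emeasure M {\<omega>\<in>space M. restrict (Wf \<omega>) (sub_edges E r) \<in> A \<and>
                               restrict (\<beta> \<omega>) (sub_vertices V E r) \<in> B}
       = (\<integral>\<^sup>+\<omega>. indicator {\<omega>. restrict (Wf \<omega>) (sub_edges E r) \<in> A} \<omega> *
                 emeasure (nu_law (sub_vertices V E r) (wmat (sub_edges E r) (Wf \<omega>))) B \<partial>M)"
  shows "\<forall>i j e'. {i, j} \<in> sub_edges E l \<and> e' \<in> sub_edges E r \<longrightarrow>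
     (\<forall>\<alpha>\<in>{0..1}.
        (\<integral>\<^sup>+\<omega>. ennreal (eff_W V E r l (Wf \<omega>) (\<beta> \<omega>) i j powr \<alpha>) \<partial>M)
          \<le> ennreal ((2 powr (- \<alpha>)) ^ (r - l)) * (\<integral>\<^sup>+\<omega>. ennreal (Wf \<omega> e' powr \<alpha>) \<partial>M)) \<and>
     (\<forall>\<alpha>. 0 \<le> \<alpha> \<and> \<alpha> < 1/2 \<longrightarrow>
        (\<integral>\<^sup>+\<omega>. ennreal (eff_W V E r l (Wf \<omega>) (\<beta> \<omega>) i j powr \<alpha>) \<partial>M)
          \<le> Min (pow_bound \<alpha> (\<integral>\<^sup>+\<omega>. ennreal (Wf \<omega> e' powr \<alpha>) \<partial>M) l r ` {l..r})) \<and>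
     ext_expectation M (\<lambda>\<omega>. ln (eff_W V E r l (Wf \<omega>) (\<beta> \<omega>) i j))
        \<le> Min (log_bound (ext_expectation M (\<lambda>\<omega>. ln (Wf \<omega> e'))) l r ` {l..r}) \<and>
     (\<forall>\<alpha>. 0 < \<alpha> \<and> \<alpha> < 1/2 \<and> (\<integral>\<^sup>+\<omega>. ennreal (Wf \<omega> e' powr \<alpha>) \<partial>M) < \<infinity> \<longrightarrow>
        (let EW = \<integral>\<^sup>+\<omega>. ennreal (Wf \<omega> e' powr \<alpha>) \<partial>M;
             m\<^sub>0 = int r - 2 - \<lfloor>log 2 (C_const \<alpha> * enn2real EW) / \<alpha>\<rfloor>;
             f = pow_bound \<alpha> EW l r
         in (m\<^sub>0 \<in> {int l..int r} \<longrightarrow> is_arg_min f (\<lambda>m. m \<in> {l..r}) (nat m\<^sub>0)) \<and>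
            (m\<^sub>0 < int l \<longrightarrow> is_arg_min f (\<lambda>m. m \<in> {l..r}) l) \<and>
            (m\<^sub>0 > int r \<longrightarrow> is_arg_min f (\<lambda>m. m \<in> {l..r}) r))) \<and>
     (\<forall>x::real. ext_expectation M (\<lambda>\<omega>. ln (Wf \<omega> e')) = ereal x \<longrightarrow>
        (let m\<^sub>1 = int r - 2 - \<lfloor>(x + c2_const) / ln 2\<rfloor>;
             f = log_bound (ereal x) l r
         in (m\<^sub>1 \<in> {int l..int r} \<longrightarrow> is_arg_min f (\<lambda>m. m \<in> {l..r}) (nat m\<^sub>1)) \<and>
            (m\<^sub>1 < int l \<longrightarrow> is_arg_min f (\<lambda>m. m \<in> {l..r}) l) \<and>
            (m\<^sub>1 > int r \<longrightarrow> is_arg_min f (\<lambda>m. m \<in> {l..r}) r)))"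
proof (intro allI impI, goal_cases)
  case (1 i j e')
  then have ij: "{i, j} \<in> sub_edges E l" and e': "e' \<in> sub_edges E r" by auto
  interpret M: prob_space M by fact
  interpret sub_graph V E by standard fact
  define \<mu> where "\<mu> = distr M borel (\<lambda>\<omega>. Wf \<omega> e')"
  define \<nu> where "\<nu> = (merge_law ^^ (r - l)) \<mu>"
  have We [measurable]: "(\<lambda>\<omega>. Wf \<omega> e') \<in> borel_measurable M" using W_meas e' by blast
  note law = eff_W_law[OF lr M W_meas W_pos W_indep W_ident \<beta>_meas \<beta>_cond ij e', folded \<mu>_def]
  note \<mu> = law(1) and eff = law(2)[folded \<nu>_def]
  have powr_eff: "(\<integral>\<^sup>+\<omega>. ennreal (eff_W V E r l (Wf \<omega>) (\<beta> \<omega>) i j powr \<alpha>) \<partial>M) = moment \<alpha> \<nu>" for \<alpha>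
    by (rule eff) measurable
  have powr_W: "(\<integral>\<^sup>+\<omega>. ennreal (Wf \<omega> e' powr \<alpha>) \<partial>M) = moment \<alpha> \<mu>" for \<alpha>
    unfolding \<mu>_def by (subst nn_integral_distr) auto
  \<comment> \<open>The two parts of the logarithm are transferred separately, as \<open>eff\<close>
    speaks about nonnegative functions.\<close>
  have ln_eff: "ext_expectation M (\<lambda>\<omega>. ln (eff_W V E r l (Wf \<omega>) (\<beta> \<omega>) i j)) = ext_expectation \<nu> ln"
    using eff[of "\<lambda>y. ennreal (ln y)"] eff[of "\<lambda>y. ennreal (- ln y)"]
    by (simp add: ext_expectation_def)
  have ln_W: "ext_expectation M (\<lambda>\<omega>. ln (Wf \<omega> e')) = ext_expectation \<mu> ln"
    unfolding \<mu>_def by (subst ext_expectation_distr) auto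
  have nat_bounds: "l \<le> nat m" "nat m \<le> r" "int (nat m) = m" if "m \<in> {int l..int r}" for m
    using that by auto
  show ?case
    unfolding powr_eff powr_W ln_eff ln_W Let_def
  proof (intro conjI ballI allI impI; (elim conjE)?)
    fix \<alpha> :: real assume "\<alpha> \<in> {0..1}"
    then show "moment \<alpha> \<nu> \<le> ennreal ((2 powr - \<alpha>) ^ (r - l)) * moment \<alpha> \<mu>"
      unfolding \<nu>_def by (intro powr_iterate_le_first[OF \<mu>]) auto
  next
    fix \<alpha> :: real assume "0 \<le> \<alpha>" "\<alpha> < 1/2"
    then show "moment \<alpha> \<nu> \<le> Min (pow_bound \<alpha> (moment \<alpha> \<mu>) l r ` {l..r})"
      unfolding \<nu>_def using lr powr_iterate_le_pow_bound[OF \<mu>] by (subst Min_ge_iff) auto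
  next
    show "ext_expectation \<nu> ln \<le> Min (log_bound (ext_expectation \<mu> ln) l r ` {l..r})"
      unfolding \<nu>_def using lr ln_iterate_le_log_bound[OF \<mu>] by (subst Min_ge_iff) auto
  next
    fix \<alpha> :: real assume \<alpha>: "0 < \<alpha>" "\<alpha> < 1/2" and fin: "moment \<alpha> \<mu> < \<infinity>"
    \<comment> \<open>A zero moment would leave the logarithm in m0 at a default value; positivity
      of the weight excludes it.\<close>
    have "(\<integral>\<^sup>+\<omega>. ennreal (Wf \<omega> e' powr \<alpha>) \<partial>M) \<noteq> 0"
    proof
      assume "(\<integral>\<^sup>+\<omega>. ennreal (Wf \<omega> e' powr \<alpha>) \<partial>M) = 0"
      then have "AE \<omega> in M. ennreal (Wf \<omega> e' powr \<alpha>) = 0" by (subst (asm) nn_integral_0_iff_AE) auto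
      moreover have "Wf \<omega> e' \<noteq> 0" if "\<omega> \<in> space M" for \<omega> using W_pos e' that by fastforce
      ultimately have "AE \<omega> in M. False"
        by (elim AE_mp) (auto intro!: AE_I2)
      then show False by simp
    qed
    then have nz: "moment \<alpha> \<mu> \<noteq> 0" unfolding powr_W .
    \<comment> \<open>The three cases below meet its clamping conditions with x = m0, x = l and x =
      r.\<close>
    note minimizer = pow_bound_minimizer[OF \<alpha> nz fin refl]
    let ?m = "int r - 2 - \<lfloor>log 2 (C_const \<alpha> * enn2real (moment \<alpha> \<mu>)) / \<alpha>\<rfloor>"
    show "is_arg_min (pow_bound \<alpha> (moment \<alpha> \<mu>) l r) (\<lambda>m. m \<in> {l..r}) (nat ?m)"
      if "?m \<in> {int l..int r}"
      by (rule minimizer[OF nat_bounds(1,2)[OF that]]) (simp_all only: nat_bounds(3)[OF that] order_refl simp_thms)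
    show "is_arg_min (pow_bound \<alpha> (moment \<alpha> \<mu>) l r) (\<lambda>m. m \<in> {l..r}) l"
      if "?m < int l"
      using that lr by (intro minimizer) auto
    show "is_arg_min (pow_bound \<alpha> (moment \<alpha> \<mu>) l r) (\<lambda>m. m \<in> {l..r}) r"
      if "?m > int r"
      using that lr by (intro minimizer) auto
  next
    fix x :: real
    note minimizer = log_bound_minimizer[OF refl]
    let ?m = "int r - 2 - \<lfloor>(x + c2_const) / ln 2\<rfloor>"
    show "is_arg_min (log_bound (ereal x) l r) (\<lambda>m. m \<in> {l..r}) (nat ?m)" if "?m \<in> {int l..int r}"
      by (rule minimizer[OF nat_bounds(1,2)[OF that]]) (simp_all only: nat_bounds(3)[OF that] order_refl simp_thms)
    show "is_arg_min (log_bound (ereal x) l r) (\<lambda>m. m \<in> {l..r}) l" if "?m < int l"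
      using that lr by (intro minimizer) auto
    show "is_arg_min (log_bound (ereal x) l r) (\<lambda>m. m \<in> {l..r}) r" if "?m > int r"
      using that lr by (intro minimizer) auto
  qed
qed

end
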